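(* Suppose the solution $\theta^*$ of the linear program $$\theta^*=\arg\min_{\theta\in\mathbb{R}^d}\{v^\top\theta:\ \bar A\theta\le\bar\beta\}$$ is unique. Then $$\lim_{N\to\infty}\theta_N^r=\lim_{N\to\infty}\theta_N=\theta^*\quad\text{with probability one.}$$ The mean-square error admits the approximation $$N\,\mathsf{E}\bigl[(\theta_N^r-\theta^* )(\theta_N^r-\theta^* )^\top\bigr]=\Sigma_\theta+O\bigl(\tfrac1{\sqrt N}\bigr),$$ where $$\Sigma_\theta=[\bar A^+]^{-1}\Sigma_W([\bar A^+]^{-1})^\top,\qquad\Sigma_W=\lim_{N\to\infty}N\,\mathsf{E}[\overline W_N\overline W_N^\top].$$ Moreover, $\sqrt N(\theta_N^r-\theta^* )\to N(0,\Sigma_\theta)$ in distribution.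
   Context: $\{Y_k:k\ge0\}$ is a Markov chain on a finite state space $\mathsf{Y}$ that is uni-chain and aperiodic, with unique invariant pmf $\varpi$. For integers $1<d<d_+$, let $A:\mathsf{Y}\to\mathbb{R}^{d_+\times d}$ and $\beta:\mathsf{Y}\to\mathbb{R}^{d_+}$ be functions, $A_k=A(Y_k)$, $\beta_k=\beta(Y_k)$, $\bar A=\sum_y\varpi(y)A(y)$, $\bar\beta=\sum_y\varpi(y)\beta(y)$, and $$\bar A_N=\frac1N\sum_{k=1}^NA_k,\qquad\bar\beta_N=\frac1N\sum_{k=1}^N\beta_k.$$ Let $v\in\mathbb{R}^d$ be a vector. $\theta_N$ denotes the solution of the linear program: minimize $v^\top\theta$ over $\theta\in\mathbb{R}^d$ subject to $\bar A_N\theta\le\bar\beta_N$ (component-wise). Fix $r>0$ with $|\theta_i^*|<r$ for each $i$; $\theta_N^r$ is the $L_\infty$ projection of $\theta_N$ onto $\{\theta\in\mathbb{R}^d:|\theta_i|\le r,\ 1\le i\le d\}$, with $\theta_N^r=0$ if the linear program defining $\theta_N$ is unbounded or infeasible. Uniqueness makes $\theta^*$ a basic feasible solution, and $\mathcal{I}_+=\{i_1,\dots,i_d\}$ denotes the set of $d$ indices for which the constraint is tight: $[\bar A\theta^*-\bar\beta]_\ell=0$ for $\ell\in\mathcal{I}_+$, and $[\bar A\theta^*-\bar\beta]_i<0$ otherwise. $\bar A^+$ is the $d\times d$ matrix whose $\ell$-th row is row $i_\ell$ of $\bar A$, and $\bar\beta^+=(\bar\beta_{i_1},\dots,\bar\beta_{i_d})\in\mathbb{R}^d$,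 so that $\theta^*=[\bar A^+]^{-1}\bar\beta^+$. With $\tilde A_k=A_k-\bar A$ and $\tilde\beta_k=\beta_k-\bar\beta$, $\tilde A_k^+$ and $\tilde\beta_k^+$ are obtained by extracting the same rows/elements $i_1,\dots,i_d$, and $$W_k=\tilde\beta_k^+-\tilde A_k^+\theta^*,\qquad\overline W_N=\frac1N\sum_{k=1}^NW_k.$$ *)

theory Defs
  imports "HOL-Probability.Probability"
begin

section \<open>Finite Markov chains\<close>

definition nstep :: "('y \<Rightarrow> 'y pmf) \<Rightarrow> nat \<Rightarrow> 'y \<Rightarrow> 'y pmf" where
  "nstep K n x = ((\<lambda>p. bind_pmf p K) ^^ n) (return_pmf x)"

definition reaches :: "('y \<Rightarrow> 'y pmf) \<Rightarrow> 'y \<Rightarrow> 'y \<Rightarrow> bool" where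
  "reaches K x y \<longleftrightarrow> (\<exists>n. pmf (nstep K n x) y > 0)"

text \<open>Closed communicating classes; on a finite state space these are exactly the recurrent classes.\<close>

definition recurrent_class :: "('y \<Rightarrow> 'y pmf) \<Rightarrow> 'y set \<Rightarrow> bool" where
  "recurrent_class K C \<longleftrightarrow> C \<noteq> {} \<and> (\<forall>x\<in>C. {y. reaches K x y} = C)"

text \<open>Transient states are allowed, and nothing is required of their periods.\<close>

definition uni_chain :: "('y \<Rightarrow> 'y pmf) \<Rightarrow> bool" where
  "uni_chain K \<longleftrightarrow> (\<exists>!C. recurrent_class K C)"

definition aperiodic :: "('y \<Rightarrow> 'y pmf) \<Rightarrow> bool" where
  "aperiodic K \<longleftrightarrow>
     (\<forall>C x. recurrent_class K C \<and> x \<in> C \<longrightarrow> Gcd {n. n \<ge> 1 \<and> pmf (nstep K n x) x > 0} = 1)"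

definition invariant_pmf :: "('y \<Rightarrow> 'y pmf) \<Rightarrow> 'y pmf \<Rightarrow> bool" where
  "invariant_pmf K p \<longleftrightarrow> bind_pmf p K = p"

text \<open>The law of the initial state \<open>Y 0\<close> is arbitrary.\<close>

definition markov_chain ::
    "'w measure \<Rightarrow> ('y \<Rightarrow> 'y pmf) \<Rightarrow> (nat \<Rightarrow> 'w \<Rightarrow> 'y) \<Rightarrow> bool" where
  "markov_chain M K Y \<longleftrightarrow>
     prob_space M \<and>
     (\<forall>k. Y k \<in> measurable M (count_space UNIV)) \<and>
     (\<forall>n y z. \<P>(\<omega> in M. \<forall>k\<le>n. Y k \<omega> = y k) > 0 \<longrightarrow>
        \<P>(\<omega> in M. Y (Suc n) \<omega> = z \<bar> \<forall>k\<le>n. Y k \<omega> = y k) = pmf (K (y n)) z)"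

definition stat_mean :: "'y::finite pmf \<Rightarrow> ('y \<Rightarrow> 'a::real_vector) \<Rightarrow> 'a" where
  "stat_mean p f = (\<Sum>y\<in>UNIV. pmf p y *\<^sub>R f y)"

definition emp_mean ::
    "(nat \<Rightarrow> 'w \<Rightarrow> 'y) \<Rightarrow> ('y \<Rightarrow> 'a::real_vector) \<Rightarrow> nat \<Rightarrow> 'w \<Rightarrow> 'a" where
  "emp_mean Y f N \<omega> = (1 / real N) *\<^sub>R (\<Sum>k=1..N. f (Y k \<omega>))"

section \<open>Linear programs\<close>

text \<open>The program: minimize \<open>v \<bullet> x\<close> subject to \<open>A *v x \<le> b\<close>. The order on vectors is componentwise.\<close>

definition lp_feasible :: "real^'n^'m \<Rightarrow> real^'m \<Rightarrow> (real^'n) set" where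
  "lp_feasible A b = {x. A *v x \<le> b}"

definition lp_solution :: "real^'n \<Rightarrow> real^'n^'m \<Rightarrow> real^'m \<Rightarrow> real^'n \<Rightarrow> bool" where
  "lp_solution v A b x \<longleftrightarrow> x \<in> lp_feasible A b \<and> (\<forall>z\<in>lp_feasible A b. v \<bullet> x \<le> v \<bullet> z)"

definition lp_infeasible :: "real^'n^'m \<Rightarrow> real^'m \<Rightarrow> bool" where
  "lp_infeasible A b \<longleftrightarrow> lp_feasible A b = {}"

definition lp_unbounded :: "real^'n \<Rightarrow> real^'n^'m \<Rightarrow> real^'m \<Rightarrow> bool" where
  "lp_unbounded v A b \<longleftrightarrow> (\<forall>c. \<exists>x\<in>lp_feasible A b. v \<bullet> x < c)"

text \<open>
  Nearest points in the maximum norm need not be unique, hence a predicate.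
  Componentwise clipping to \<open>[-r, r]\<close> is one such nearest point in the case of the box.
\<close>

definition Linf_projection :: "(real^'n) set \<Rightarrow> real^'n \<Rightarrow> real^'n \<Rightarrow> bool" where
  "Linf_projection S x z \<longleftrightarrow> z \<in> S \<and> (\<forall>w\<in>S. infnorm (x - z) \<le> infnorm (x - w))"

definition sym_box :: "real \<Rightarrow> (real^'n) set" where
  "sym_box r = {x. \<forall>i. \<bar>x $ i\<bar> \<le> r}"

text \<open>Selection of the rows of a matrix, or of the entries of a vector, listed by \<open>idx\<close>.\<close>

definition select_rows :: "('n \<Rightarrow> 'm) \<Rightarrow> 'a^'m \<Rightarrow> 'a^'n" where
  "select_rows idx X = (\<chi> l. X $ idx l)"

definition outer :: "real^'n \<Rightarrow> real^'n \<Rightarrow> real^'n^'n" where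
  "outer x y = (\<chi> i j. x $ i * y $ j)"

text \<open>The function \<open>w\<close> of the state for which \<open>W\<^sub>k = w (Y k)\<close>.\<close>

definition lp_noise ::
    "'y::finite pmf \<Rightarrow> ('y \<Rightarrow> real^'n^'m) \<Rightarrow> ('y \<Rightarrow> real^'m) \<Rightarrow> ('n \<Rightarrow> 'm) \<Rightarrow> real^'n \<Rightarrow> 'y \<Rightarrow> real^'n"
  where
  "lp_noise p A b idx x y =
     select_rows idx (b y - stat_mean p b) - select_rows idx (A y - stat_mean p A) *v x"

section \<open>Convergence in distribution and Gaussian laws\<close>

definition weak_conv_borel :: "(nat \<Rightarrow> 'a::metric_space measure) \<Rightarrow> 'a measure \<Rightarrow> bool" where
  "weak_conv_borel Q G \<longleftrightarrow>
     (\<forall>f :: 'a \<Rightarrow> real. continuous_on UNIV f \<and> bounded (range f) \<longrightarrow>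
        (\<lambda>n. \<integral>x. f x \<partial>Q n) \<longlonglongrightarrow> (\<integral>x. f x \<partial>G))"

text \<open>
  The covariance \<open>S\<close> may be singular, so the law is specified by its characteristic function,
  not by a density. That a characteristic function is bounded by 1 in modulus makes \<open>S\<close> positive
  semidefinite.
\<close>

definition multivariate_normal :: "real^'n \<Rightarrow> real^'n^'n \<Rightarrow> (real^'n) measure \<Rightarrow> bool" where
  "multivariate_normal m S G \<longleftrightarrow>
     prob_space G \<and> sets G = sets borel \<and> transpose S = S \<and>
     (\<forall>t. (\<integral>x. iexp (t \<bullet> x) \<partial>G) =
        exp (\<i> * complex_of_real (t \<bullet> m) - complex_of_real ((t \<bullet> (S *v t)) / 2)))"

end

theory Submission
  imports Defs
begin

text \<open>
  The linear program is reduced to a linear system. Uniqueness of \<open>\<theta>star\<close> together with the strict slack of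
  the inactive constraints makes the minimum sharp: the objective grows at least linearly along every direction
  that is feasible for the active constraints (\<open>lp_sharp_minimum\<close>). Sharpness survives small changes of
  the data, so as soon as the empirical data are close to their means the empirical program has exactly one
  solution, it solves the square system of the same active rows, and
  \<open>\<theta> - \<theta>star = B *v W + O(\<Delta>\<^sup>2)\<close>, where \<open>B\<close> is the inverse of the averaged active rows, \<open>W\<close> the mean of the
  noise and \<open>\<Delta>\<close> the size of the deviation of the empirical data (\<open>lp_perturbation\<close>). Far from the means both
  sides are controlled by the box and by \<open>\<Delta>\<close>, so the same expansion holds for the projected estimate on the
  whole probability space, with a larger constant; no event has to be excluded when moments are taken.

  The remaining questions concern empirical means along the chain. Uniqueness of the invariant law
  solves the Poisson equation \<open>h - K h = g - \<pi> g\<close> for every \<open>g\<close> (\<open>poisson_equation\<close>), which turns a centred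
  sum into a martingale with bounded increments plus a bounded boundary term. Its fourth moment is \<open>O(n\<^sup>2)\<close>, so
  \<open>E \<Delta>\<^sup>4 = O(1/n\<^sup>2)\<close>. This one estimate yields the almost sure convergence (the fourth moments are
  summable) and, by interpolation, \<open>E \<Delta>\<^sup>3 = O(n powr (-3/2))\<close>, which is the error of the mean-square
  expansion. The covariance of the linear part is that of the martingale up to \<open>O(1 / sqrt n)\<close>
  (\<open>emp_mean_covariance_rate\<close>).

  For the limit law, a corrector solving a second Poisson equation makes the characteristic function of the
  martingale satisfy \<open>\<Psi> (k + 1) = (1 - s\<^sup>2 \<sigma>\<^sup>2 / 2) \<Psi> k + O(s\<^sup>3)\<close>, and iterating this \<open>n\<close> times with
  \<open>s = 1 / sqrt n\<close> gives the Gaussian limit (\<open>mart_char_limit\<close>). Bounded second moments upgrade pointwise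
  convergence of characteristic functions to weak convergence (\<open>weak_conv_of_char\<close>), and the limiting Gaussian
  law is the image of finitely many independent standard normal variables, one for each transition of
  the chain (\<open>asymptotic_gaussian\<close>).
\<close>

section \<open>Stability of a nondegenerate linear program\<close>

lemma norm_matrix_vector_mult_le:
  fixes A :: "real^'n^'m"
  shows "norm (A *v x) \<le> norm A * norm x"
proof -
  have "norm (A *v x) = L2_set (\<lambda>i. \<bar>A $ i \<bullet> x\<bar>) UNIV"
    by (simp add: norm_vec_def matrix_mult_dot)
  also have "\<dots> \<le> L2_set (\<lambda>i. norm x * norm (A $ i)) UNIV"
    by (intro L2_set_mono) (auto simp: Cauchy_Schwarz_ineq2 mult.commute[of "norm x"])
  also have "\<dots> = norm A * norm x"
    by (simp add: L2_set_right_distrib[symmetric] norm_vec_def)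
  finally show ?thesis .
qed

lemma matrix_inv_inverse:
  fixes P :: "real^'n^'n"
  assumes "invertible P"
  shows "matrix_inv P ** P = mat 1" "P ** matrix_inv P = mat 1"
  using assms someI_ex[of "\<lambda>Q. P ** Q = mat 1 \<and> Q ** P = mat 1"]
  unfolding invertible_def matrix_inv_def by auto

lemma norm_select_rows_le:
  fixes X :: "'a::real_normed_vector^'m"
  assumes "inj idx"
  shows "norm (select_rows idx X) \<le> norm X"
proof -
  have "norm (select_rows idx X) = sqrt (\<Sum>l\<in>UNIV. (norm (X $ idx l))\<^sup>2)"
    by (simp add: select_rows_def norm_vec_def L2_set_def)
  also have "(\<Sum>l\<in>UNIV. (norm (X $ idx l))\<^sup>2) = (\<Sum>i\<in>range idx. (norm (X $ i))\<^sup>2)"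
    using assms by (simp add: sum.reindex)
  also have "sqrt \<dots> \<le> sqrt (\<Sum>i\<in>UNIV. (norm (X $ i))\<^sup>2)"
    by (intro real_sqrt_le_mono sum_mono2) auto
  finally show ?thesis by (simp add: norm_vec_def L2_set_def)
qed

lemma select_rows_diff: "select_rows idx (X - Z) = select_rows idx X - select_rows idx Z"
  by (simp add: select_rows_def vec_eq_iff)

lemma select_rows_component: "select_rows idx X $ l = X $ idx l"
  by (simp add: select_rows_def)

lemma select_rows_mult_component:
  fixes A :: "real^'n^'m"
  shows "(select_rows idx A *v x) $ l = (A *v x) $ idx l"
  by (simp add: select_rows_def matrix_mult_dot)

text \<open>A short step along \<open>d\<close> stays feasible: active constraints do not increase and inactive ones have
  slack. If \<open>v \<bullet> d\<close> were not positive, its endpoint would be a second solution.\<close>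

lemma lp_direction_increases:
  fixes A :: "real^'n^'m" and idx :: "'k::finite \<Rightarrow> 'm"
  assumes opt: "lp_solution v A b x"
    and uniq: "\<And>z. lp_solution v A b z \<Longrightarrow> z = x"
    and inact: "\<And>i. i \<notin> range idx \<Longrightarrow> (A *v x - b) $ i < 0"
    and d: "\<And>l. (select_rows idx A *v d) $ l \<le> 0" "d \<noteq> 0"
  shows "v \<bullet> d > 0"
proof -
  have feas: "A *v x \<le> b" using opt by (simp add: lp_solution_def lp_feasible_def)
  have "\<forall>\<^sub>F \<epsilon> in at_right 0. (A *v x) $ i + \<epsilon> * (A *v d) $ i \<le> b $ i" for i
  proof (cases "i \<in> range idx")
    case True
    then obtain l where l: "i = idx l" by auto
    have "(A *v d) $ i \<le> 0" using d(1)[of l] by (simp add: l select_rows_mult_component)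
    moreover have "(A *v x) $ i \<le> b $ i" using feas by (simp add: less_eq_vec_def)
    ultimately have "(A *v x) $ i + \<epsilon> * (A *v d) $ i \<le> b $ i" if "\<epsilon> > 0" for \<epsilon>
      using that mult_nonneg_nonpos[of \<epsilon> "(A *v d) $ i"] by linarith
    then show ?thesis by (auto simp: eventually_at_right_less intro: eventually_mono[OF eventually_at_right_less])
  next
    case False
    have "((\<lambda>\<epsilon>. (A *v x) $ i + \<epsilon> * (A *v d) $ i) \<longlongrightarrow> (A *v x) $ i + 0 * (A *v d) $ i) (at_right 0)"
      by (intro tendsto_intros)
    moreover have "(A *v x) $ i + 0 * (A *v d) $ i < b $ i" using inact[OF False] by simp
    ultimately have "\<forall>\<^sub>F \<epsilon> in at_right 0. (A *v x) $ i + \<epsilon> * (A *v d) $ i < b $ i"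
      by (rule order_tendstoD(2))
    then show ?thesis by eventually_elim simp
  qed
  then have "\<forall>\<^sub>F \<epsilon> in at_right 0. \<forall>i. (A *v x) $ i + \<epsilon> * (A *v d) $ i \<le> b $ i"
    by (intro eventually_all_finite)
  then have "\<forall>\<^sub>F \<epsilon> in at_right (0::real). 0 < \<epsilon> \<and> (\<forall>i. (A *v x) $ i + \<epsilon> * (A *v d) $ i \<le> b $ i)"
    using eventually_at_right_less[of "0::real"] by eventually_elim simp
  then obtain \<epsilon> where \<epsilon>: "\<epsilon> > 0" "\<And>i. (A *v x) $ i + \<epsilon> * (A *v d) $ i \<le> b $ i"
    using eventually_happens'[OF trivial_limit_at_right_real] by blast
  let ?z = "x + \<epsilon> *\<^sub>R d"
  have zf: "?z \<in> lp_feasible A b"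
    using \<epsilon>(2) by (simp add: lp_feasible_def less_eq_vec_def matrix_vector_right_distrib matrix_vector_mult_scaleR)
  have "?z \<noteq> x" using \<epsilon>(1) d(2) by simp
  then have "\<not> lp_solution v A b ?z" using uniq by blast
  then obtain z where "z \<in> lp_feasible A b" "v \<bullet> z < v \<bullet> ?z"
    using zf by (auto simp: lp_solution_def not_le)
  moreover have "v \<bullet> x \<le> v \<bullet> z" using calculation(1) opt by (simp add: lp_solution_def)
  ultimately have "\<epsilon> * (v \<bullet> d) > 0" by (simp add: inner_add_right)
  then show ?thesis using \<epsilon>(1) by (simp add: zero_less_mult_iff)
qed

text \<open>Compactness of the unit vectors in the cone of directions turns strict growth into a linear rate.\<close>

lemma lp_sharp_minimum:
  fixes A :: "real^'n^'m" and idx :: "'k::finite \<Rightarrow> 'm"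
  assumes opt: "lp_solution v A b x"
    and uniq: "\<And>z. lp_solution v A b z \<Longrightarrow> z = x"
    and inact: "\<And>i. i \<notin> range idx \<Longrightarrow> (A *v x - b) $ i < 0"
  obtains c where "c > 0" "\<And>d. (\<And>l. (select_rows idx A *v d) $ l \<le> 0) \<Longrightarrow> c * norm d \<le> v \<bullet> d"
proof -
  let ?P = "select_rows idx A"
  let ?S = "sphere 0 1 \<inter> (\<Inter>l. {d. (?P *v d) $ l \<le> 0})"
  have cl: "closed {d. (?P *v d) $ l \<le> 0}" for l
    by (intro closed_Collect_le continuous_intros continuous_on_component linear_continuous_on
        linear_conv_bounded_linear[THEN iffD1] matrix_vector_mul_linear)
  have comp: "compact ?S"
    by (intro compact_Int_closed closed_INT ballI cl) simp
  obtain c where c: "c > 0" "\<And>d. d \<in> ?S \<Longrightarrow> c \<le> v \<bullet> d"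
  proof (cases "?S = {}")
    case True
    then show ?thesis using that[of 1] by auto
  next
    case False
    have "continuous_on ?S (\<lambda>d. v \<bullet> d)" by (intro continuous_intros)
    from continuous_attains_inf[OF comp False this]
    obtain d0 where d0: "d0 \<in> ?S" "\<And>d. d \<in> ?S \<Longrightarrow> v \<bullet> d0 \<le> v \<bullet> d" by blast
    have "d0 \<noteq> 0" using d0(1) by auto
    then have "v \<bullet> d0 > 0" using d0(1) lp_direction_increases[OF opt uniq inact, where idx = idx and d = d0] by auto
    then show ?thesis using that d0 by blast
  qed
  show ?thesis
  proof (rule that[OF c(1)])
    fix d assume d: "\<And>l. (?P *v d) $ l \<le> 0"
    show "c * norm d \<le> v \<bullet> d"
    proof (cases "d = 0")
      case False
      let ?d = "(1 / norm d) *\<^sub>R d"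
      have "?d \<in> ?S" using False d
        by (auto simp: matrix_vector_mult_scaleR divide_le_0_iff)
      from c(2)[OF this] show ?thesis using False by (simp add: field_simps)
    qed simp
  qed
qed

text \<open>A kernel vector \<open>d\<close> of the active rows would make both \<open>v \<bullet> d\<close> and \<open>v \<bullet> (- d)\<close> positive.\<close>

lemma lp_active_rows_invertible:
  fixes A :: "real^'n^'m" and idx :: "'n \<Rightarrow> 'm"
  assumes opt: "lp_solution v A b x"
    and uniq: "\<And>z. lp_solution v A b z \<Longrightarrow> z = x"
    and inact: "\<And>i. i \<notin> range idx \<Longrightarrow> (A *v x - b) $ i < 0"
  shows "invertible (select_rows idx A)"
proof -
  let ?P = "select_rows idx A"
  have "d = 0" if "?P *v d = 0" for d
  proof (rule ccontr)
    assume "d \<noteq> 0"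
    have "?P *v (- d) = 0" using that using matrix_vector_mult_diff_distrib[of ?P 0 d] by simp
    then have "v \<bullet> d > 0" "v \<bullet> (- d) > 0"
      using that \<open>d \<noteq> 0\<close> lp_direction_increases[OF opt uniq inact, where idx = idx and d = d]
        lp_direction_increases[OF opt uniq inact, where idx = idx and d = "- d"] by auto
    then show False by simp
  qed
  then show ?thesis
    by (simp add: invertible_left_inverse matrix_left_invertible_ker)
qed

text \<open>The candidate \<open>x'\<close> solves the perturbed active system. It is optimal because a direction \<open>d\<close> that is
  feasible for the perturbed active rows \<open>Q\<close> is close to the direction \<open>d' = d + B (Q - P) d\<close>, which is feasible for
  the original rows \<open>P\<close> since \<open>P d' = Q d\<close>; so the sharp growth at \<open>x\<close> carries over. The expansion comes from
  \<open>e = B w - B (Q - P) e\<close> for the displacement \<open>e = x' - x\<close>.\<close>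

lemma lp_perturbation:
  fixes A :: "real^'n^'m" and idx :: "'n \<Rightarrow> 'm"
  assumes opt: "lp_solution v A b x"
    and uniq: "\<And>z. lp_solution v A b z \<Longrightarrow> z = x"
    and inj: "inj idx"
    and act: "\<And>i. i \<in> range idx \<Longrightarrow> (A *v x - b) $ i = 0"
    and inact: "\<And>i. i \<notin> range idx \<Longrightarrow> (A *v x - b) $ i < 0"
    and r: "\<And>i. \<bar>x $ i\<bar> < r"
  shows "\<exists>\<delta>>0. \<exists>C\<ge>0. \<forall>A' b'. norm (A' - A) \<le> \<delta> \<longrightarrow> norm (b' - b) \<le> \<delta> \<longrightarrow>
      (\<exists>x'. (\<forall>z. lp_solution v A' b' z \<longleftrightarrow> z = x') \<and> x' \<in> sym_box r \<and>
        norm (x' - x - matrix_inv (select_rows idx A) *v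
                (select_rows idx b' - select_rows idx A' *v x))
          \<le> C * norm (A' - A) * norm (select_rows idx b' - select_rows idx A' *v x))"
proof -
  define P where "P = select_rows idx A"
  define B where "B = matrix_inv P"
  define \<beta> where "\<beta> = norm B"
  \<comment> \<open>\<open>\<delta> * L\<close> bounds both the displacement of the solution and the change of the constraint residuals.\<close>
  define L where "L = (1 + norm x) * (1 + 2 * \<beta> * (norm A + 1))"
  have invP: "invertible P" using lp_active_rows_invertible[OF opt uniq inact] by (simp add: P_def)
  have BP: "B ** P = mat 1" and PB: "P ** B = mat 1"
    using invP by (simp_all add: B_def matrix_inv_inverse)
  have BPv: "B *v (P *v z) = z" for z by (simp add: matrix_vector_mul_assoc BP)
  have PBv: "P *v (B *v z) = z" for z by (simp add: matrix_vector_mul_assoc PB)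
  have \<beta>0: "\<beta> \<ge> 0" by (simp add: \<beta>_def)
  have Bn: "norm (B *v z) \<le> \<beta> * norm z" for z
    using norm_matrix_vector_mult_le by (simp add: \<beta>_def)
  obtain c where c: "c > 0" "\<And>d. (\<And>l. (P *v d) $ l \<le> 0) \<Longrightarrow> c * norm d \<le> v \<bullet> d"
    using lp_sharp_minimum[OF opt uniq inact] unfolding P_def by blast
  have "\<forall>\<^sub>F \<delta> in at_right 0. 2 * \<beta> * \<delta> < 1"
    by (rule order_tendstoD(2)[where y = "2 * \<beta> * 0"]) (auto intro!: tendsto_eq_intros)
  moreover have "\<forall>\<^sub>F \<delta> in at_right 0. 0 < c * (1 - \<beta> * \<delta>) - norm v * (\<beta> * \<delta>)"
    by (rule order_tendstoD(1)[where y = "c * (1 - \<beta> * 0) - norm v * (\<beta> * 0)"])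
      (use c in \<open>auto intro!: tendsto_eq_intros\<close>)
  moreover have "\<forall>\<^sub>F \<delta> in at_right 0. \<delta> < (1::real)"
    by (rule order_tendstoD(2)[where y = "0"]) (auto intro!: tendsto_eq_intros)
  moreover have "\<forall>\<^sub>F \<delta> in at_right 0. \<forall>i. i \<notin> range idx \<longrightarrow> (A *v x - b) $ i + \<delta> * L < 0"
  proof (intro eventually_all_finite)
    fix i
    show "\<forall>\<^sub>F \<delta> in at_right 0. i \<notin> range idx \<longrightarrow> (A *v x - b) $ i + \<delta> * L < 0"
    proof (cases "i \<in> range idx")
      case False
      have "\<forall>\<^sub>F \<delta> in at_right 0. (A *v x - b) $ i + \<delta> * L < 0"
        by (rule order_tendstoD(2)[where y = "(A *v x - b) $ i + 0 * L"])
          (use inact[OF False] in \<open>auto intro!: tendsto_eq_intros\<close>)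
      then show ?thesis by eventually_elim simp
    qed simp
  qed
  moreover have "\<forall>\<^sub>F \<delta> in at_right 0. \<forall>i. \<bar>x $ i\<bar> + \<delta> * L < r"
    by (intro eventually_all_finite order_tendstoD(2)[where y = "\<bar>x $ _\<bar> + 0 * L"])
      (use r in \<open>auto intro!: tendsto_eq_intros\<close>)
  moreover have "\<forall>\<^sub>F \<delta> in at_right (0::real). 0 < \<delta>" by (rule eventually_at_right_less)
  ultimately have "\<forall>\<^sub>F \<delta> in at_right 0. 0 < \<delta> \<and> 2 * \<beta> * \<delta> < 1 \<and> \<delta> < 1 \<and>
      0 < c * (1 - \<beta> * \<delta>) - norm v * (\<beta> * \<delta>) \<and>
      (\<forall>i. i \<notin> range idx \<longrightarrow> (A *v x - b) $ i + \<delta> * L < 0) \<and> (\<forall>i. \<bar>x $ i\<bar> + \<delta> * L < r)"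
    by eventually_elim simp
  then obtain \<delta> where \<delta>: "0 < \<delta>" "2 * \<beta> * \<delta> < 1" "\<delta> < 1"
      "0 < c * (1 - \<beta> * \<delta>) - norm v * (\<beta> * \<delta>)"
      "\<And>i. i \<notin> range idx \<Longrightarrow> (A *v x - b) $ i + \<delta> * L < 0" "\<And>i. \<bar>x $ i\<bar> + \<delta> * L < r"
    using eventually_happens'[OF trivial_limit_at_right_real] by blast
  show ?thesis
  proof (rule exI[of _ \<delta>], rule conjI[OF \<delta>(1)], rule exI[of _ "2 * \<beta> * \<beta>"], intro conjI allI impI)
    show "2 * \<beta> * \<beta> \<ge> 0" using \<beta>0 by simp
    fix A' b'
    assume nA: "norm (A' - A) \<le> \<delta>" and nb: "norm (b' - b) \<le> \<delta>"
    define Q where "Q = select_rows idx A'"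
    define w where "w = select_rows idx b' - Q *v x"
    have nE: "norm (Q - P) \<le> norm (A' - A)"
      using norm_select_rows_le[OF inj, of "A' - A"] by (simp add: Q_def P_def select_rows_diff)
    have QP: "Q *v z = P *v z + (Q - P) *v z" for z
      by (simp add: matrix_vector_mult_diff_rdistrib)
    have BE: "norm (B *v ((Q - P) *v z)) \<le> \<beta> * norm (A' - A) * norm z" for z
    proof -
      have "norm (B *v ((Q - P) *v z)) \<le> \<beta> * (norm (Q - P) * norm z)"
        using Bn norm_matrix_vector_mult_le \<beta>0 by (meson mult_left_mono order_trans)
      also have "\<dots> \<le> \<beta> * (norm (A' - A) * norm z)"
        using nE \<beta>0 by (intro mult_left_mono mult_right_mono) auto
      finally show ?thesis by (simp add: mult.assoc)
    qed
    have BE\<delta>: "norm (B *v ((Q - P) *v z)) \<le> \<beta> * \<delta> * norm z" for z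
      using BE[of z] nA \<beta>0 by (smt (verit) mult_left_mono mult_right_mono norm_ge_zero)
    have half: "\<beta> * \<delta> * norm z \<le> norm z / 2" for z :: "real^'n"
      using \<delta>(2) mult_right_mono[of "\<beta> * \<delta>" "1/2" "norm z"] by simp
    have solve: "z = B *v (Q *v z) - B *v ((Q - P) *v z)" for z
      by (simp add: QP matrix_vector_right_distrib BPv)
    have ker: "norm z \<le> 2 * \<beta> * norm (Q *v z)" for z
    proof -
      have "norm z \<le> norm (B *v (Q *v z)) + norm (B *v ((Q - P) *v z))"
        by (subst (1) solve) (rule norm_triangle_ineq4)
      also have "\<dots> \<le> \<beta> * norm (Q *v z) + norm z / 2"
        using Bn[of "Q *v z"] BE\<delta>[of z] half[of z] by linarith
      finally show ?thesis by simp
    qed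
    have "z = 0" if "Q *v z = 0" for z using ker[of z] that by simp
    then have "invertible Q" by (simp add: invertible_left_inverse matrix_left_invertible_ker)
    then have "Q *v (matrix_inv Q *v w) = w"
      by (simp add: matrix_vector_mul_assoc matrix_inv_inverse)
    then obtain e where e: "Q *v e = w" by blast
    define x' where "x' = x + e"
    have Qx': "Q *v x' = select_rows idx b'"
      by (simp add: x'_def matrix_vector_right_distrib e w_def)
    have ne: "norm e \<le> 2 * \<beta> * norm w" using ker[of e] e by simp
    have err: "norm (e - B *v w) \<le> 2 * \<beta> * \<beta> * norm (A' - A) * norm w"
    proof -
      have "e - B *v w = - (B *v ((Q - P) *v e))" by (subst (1) solve) (simp add: e)
      then have "norm (e - B *v w) \<le> \<beta> * norm (A' - A) * norm e" using BE[of e] by simp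
      also have "\<dots> \<le> \<beta> * norm (A' - A) * (2 * \<beta> * norm w)"
        using ne \<beta>0 by (intro mult_left_mono) auto
      finally show ?thesis by (simp add: algebra_simps)
    qed
    have nw: "norm w \<le> \<delta> * (1 + norm x)"
    proof -
      have "select_rows idx b = P *v x"
        using act by (simp add: vec_eq_iff P_def select_rows_mult_component select_rows_component)
      then have "w = select_rows idx (b' - b) - (Q - P) *v x"
        by (simp add: w_def select_rows_diff matrix_vector_mult_diff_rdistrib)
      then have "norm w \<le> norm (select_rows idx (b' - b)) + norm ((Q - P) *v x)"
        by (simp add: norm_triangle_ineq4)
      also have "\<dots> \<le> norm (b' - b) + norm (A' - A) * norm x"
        using norm_select_rows_le[OF inj, of "b' - b"] norm_matrix_vector_mult_le[of "Q - P" x]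
          mult_right_mono[OF nE norm_ge_zero[of x]] by linarith
      also have "\<dots> \<le> \<delta> + \<delta> * norm x" using nA nb by (intro add_mono mult_right_mono) auto
      finally show ?thesis by (simp add: algebra_simps)
    qed
    have ne\<delta>: "norm e \<le> 2 * \<beta> * (\<delta> * (1 + norm x))"
      using ne nw \<beta>0 by (smt (verit) mult_left_mono)
    have dev: "norm ((A' *v x' - b') - (A *v x - b)) \<le> \<delta> * L"
    proof -
      have "(A' *v x' - b') - (A *v x - b) = (A' - A) *v x + A' *v e - (b' - b)"
        by (simp add: x'_def matrix_vector_right_distrib matrix_vector_mult_diff_rdistrib)
      then have "norm ((A' *v x' - b') - (A *v x - b)) \<le> norm ((A' - A) *v x) + norm (A' *v e) + norm (b' - b)"
        by (smt (verit) norm_triangle_ineq norm_triangle_ineq4)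
      also have "\<dots> \<le> \<delta> * norm x + (norm A + 1) * (2 * \<beta> * (\<delta> * (1 + norm x))) + \<delta>"
      proof (intro add_mono nb)
        show "norm ((A' - A) *v x) \<le> \<delta> * norm x"
          using norm_matrix_vector_mult_le[of "A' - A" x] mult_right_mono[OF nA norm_ge_zero[of x]] by linarith
        have "norm A' \<le> norm A + 1" using nA \<delta>(3) norm_triangle_ineq2[of A' A] by linarith
        then show "norm (A' *v e) \<le> (norm A + 1) * (2 * \<beta> * (\<delta> * (1 + norm x)))"
          using norm_matrix_vector_mult_le[of A' e] ne\<delta> \<beta>0 \<delta>(1)
          by (smt (verit) mult_mono norm_ge_zero)
      qed
      also have "\<dots> = \<delta> * L" by (simp add: L_def algebra_simps)
      finally show ?thesis .
    qed
    have e_le: "norm e \<le> \<delta> * L"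
    proof -
      have "2 * \<beta> * (\<delta> * (1 + norm x)) \<le> \<delta> * L"
        using \<beta>0 \<delta>(1) by (simp add: L_def algebra_simps add_nonneg_nonneg)
      then show ?thesis using ne\<delta> by linarith
    qed
    have box: "x' \<in> sym_box r"
    proof -
      have "\<bar>x' $ i\<bar> \<le> r" for i
        using component_le_norm_cart[of e i] e_le \<delta>(6)[of i] by (simp add: x'_def)
      then show ?thesis by (simp add: sym_box_def)
    qed
    have feas: "x' \<in> lp_feasible A' b'"
    proof -
      have "(A' *v x') $ i \<le> b' $ i" for i
      proof (cases "i \<in> range idx")
        case True
        then obtain l where "i = idx l" by auto
        then show ?thesis
          using arg_cong[OF Qx', of "\<lambda>u. u $ l"] by (simp add: Q_def select_rows_mult_component select_rows_component)
      next
        case False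
        have "\<bar>((A' *v x' - b') - (A *v x - b)) $ i\<bar> \<le> \<delta> * L"
          using component_le_norm_cart dev order_trans by blast
        then show ?thesis using \<delta>(5)[OF False] by simp
      qed
      then show ?thesis by (simp add: lp_feasible_def less_eq_vec_def)
    qed
    have better: "v \<bullet> x' < v \<bullet> z" if z: "z \<in> lp_feasible A' b'" "z \<noteq> x'" for z
    proof -
      define d where "d = z - x'"
      define d' where "d' = d + B *v ((Q - P) *v d)"
      have "P *v d' = Q *v d"
        by (simp add: d'_def matrix_vector_right_distrib PBv QP[of d])
      moreover have "(Q *v d) $ l \<le> 0" for l
      proof -
        have "(Q *v z) $ l \<le> (Q *v x') $ l"
          using z(1) unfolding Qx'
          by (simp add: lp_feasible_def less_eq_vec_def Q_def select_rows_mult_component select_rows_component)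
        then show ?thesis by (simp add: d_def matrix_vector_mult_diff_distrib)
      qed
      ultimately have "c * norm d' \<le> v \<bullet> d'" using c(2)[of d'] by simp
      moreover have "norm d - \<beta> * \<delta> * norm d \<le> norm d'"
        using BE\<delta>[of d] norm_triangle_ineq2[of d "- (B *v ((Q - P) *v d))"] by (simp add: d'_def)
      then have "c * (norm d - \<beta> * \<delta> * norm d) \<le> c * norm d'" using c(1) by simp
      moreover have "v \<bullet> (B *v ((Q - P) *v d)) \<le> norm v * (\<beta> * \<delta> * norm d)"
        using norm_cauchy_schwarz[of v "B *v ((Q - P) *v d)"] mult_left_mono[OF BE\<delta>[of d] norm_ge_zero[of v]] by linarith
      ultimately have "(c * (1 - \<beta> * \<delta>) - norm v * (\<beta> * \<delta>)) * norm d \<le> v \<bullet> d"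
        by (simp add: d'_def inner_add_right algebra_simps)
      moreover have "norm d > 0" using z(2) by (simp add: d_def)
      ultimately have "v \<bullet> d > 0" using \<delta>(4) by (smt (verit) mult_pos_pos)
      then show ?thesis by (simp add: d_def inner_diff_right)
    qed
    have "lp_solution v A' b' z \<longleftrightarrow> z = x'" for z
      using better feas unfolding lp_solution_def by (metis less_le_not_le order_less_imp_le order_refl)
    moreover have "norm (x' - x - B *v w) \<le> 2 * \<beta> * \<beta> * norm (A' - A) * norm w"
      using err by (simp add: x'_def)
    ultimately show "\<exists>x'. (\<forall>z. lp_solution v A' b' z \<longleftrightarrow> z = x') \<and> x' \<in> sym_box r \<and>
        norm (x' - x - matrix_inv (select_rows idx A) *v
                (select_rows idx b' - select_rows idx A' *v x))
          \<le> 2 * \<beta> * \<beta> * norm (A' - A) * norm (select_rows idx b' - select_rows idx A' *v x)"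
      using box unfolding w_def Q_def B_def P_def by blast
  qed
qed

section \<open>Averages over a finite state space and the Poisson equation\<close>

lemma sum_pmf_finite: "(\<Sum>y\<in>UNIV. pmf p (y :: 'y::finite)) = 1"
  using sum_pmf_eq_1[of UNIV p] by simp

lemma stat_mean_const [simp]: "stat_mean p (\<lambda>_. c) = c"
  by (simp add: stat_mean_def scaleR_sum_left[symmetric] sum_pmf_finite)

lemma stat_mean_diff: "stat_mean p (\<lambda>x. f x - g x) = stat_mean p f - stat_mean p g"
  by (simp add: stat_mean_def scaleR_diff_right sum_subtractf)

lemma stat_mean_add: "stat_mean p (\<lambda>x. f x + g x) = stat_mean p f + stat_mean p g"
  by (simp add: stat_mean_def scaleR_add_right sum.distrib)

lemma stat_mean_linear:
  assumes "linear L"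
  shows "stat_mean p (\<lambda>x. L (f x)) = L (stat_mean p f)"
  by (simp add: stat_mean_def linear_sum[OF assms] linear_cmul[OF assms])

lemma stat_mean_mono:
  fixes f g :: "'y::finite \<Rightarrow> real"
  shows "(\<And>x. f x \<le> g x) \<Longrightarrow> stat_mean p f \<le> stat_mean p g"
  unfolding stat_mean_def by (intro sum_mono) (simp add: mult_left_mono)

lemma norm_stat_mean_le:
  fixes f :: "'y::finite \<Rightarrow> 'a::real_normed_vector"
  assumes "\<And>x. norm (f x) \<le> C"
  shows "norm (stat_mean p f) \<le> C"
proof -
  have "norm (stat_mean p f) \<le> (\<Sum>y\<in>UNIV. norm (pmf p y *\<^sub>R f y))"
    unfolding stat_mean_def by (rule norm_sum)
  also have "\<dots> \<le> (\<Sum>y\<in>UNIV. pmf p y * C)"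
    using assms by (intro sum_mono) (simp add: mult_left_mono)
  finally show ?thesis by (simp add: sum_distrib_right[symmetric] sum_pmf_finite)
qed

lemma stat_mean_of_real: "stat_mean p (\<lambda>x. complex_of_real (f x)) = complex_of_real (stat_mean p f)"
  by (rule stat_mean_linear) (simp add: bounded_linear.linear bounded_linear_of_real)

lemma stat_mean_mult_left:
  fixes f :: "'y::finite \<Rightarrow> 'a::real_normed_algebra"
  shows "stat_mean p (\<lambda>x. c * f x) = c * stat_mean p f"
  by (rule stat_mean_linear) (simp add: bounded_linear.linear bounded_linear_mult_right)

lemma nonneg_invariant_proportional:
  fixes K :: "'y::finite \<Rightarrow> 'y pmf" and \<nu> :: "'y \<Rightarrow> real"
  assumes uniq: "\<And>q. invariant_pmf K q \<Longrightarrow> q = p"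
    and nonneg: "\<And>x. \<nu> x \<ge> 0" and invar: "\<And>y. (\<Sum>x\<in>UNIV. \<nu> x * pmf (K x) y) = \<nu> y"
  shows "\<exists>c. \<forall>y. \<nu> y = c * pmf p y"
proof (cases "(\<Sum>x\<in>UNIV. \<nu> x) = 0")
  case True
  then have "\<nu> y = 0" for y using nonneg by (simp add: sum_nonneg_eq_0_iff)
  then show ?thesis by (intro exI[of _ 0]) simp
next
  case False
  define m where "m = (\<Sum>x\<in>UNIV. \<nu> x)"
  have m: "m > 0" using False nonneg by (simp add: m_def sum_nonneg less_le)
  have nn: "(\<integral>\<^sup>+x. ennreal (\<nu> x / m) \<partial>count_space UNIV) = 1"
    using m nonneg by (simp add: nn_integral_count_space_finite sum_ennreal sum_divide_distrib[symmetric] m_def[symmetric])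
  define q where "q = embed_pmf (\<lambda>x. \<nu> x / m)"
  have q: "pmf q x = \<nu> x / m" for x
    unfolding q_def using m nonneg nn by (intro pmf_embed_pmf) auto
  have "bind_pmf q K = q"
    by (rule pmf_eqI) (simp add: pmf_bind integral_measure_pmf[of UNIV] q invar sum_divide_distrib[symmetric])
  then have "q = p" using uniq by (simp add: invariant_pmf_def)
  then show ?thesis using q m by (intro exI[of _ m]) (auto simp: field_simps)
qed

text \<open>Positive and negative part of a signed invariant vector are invariant too: the inequality
  \<open>|\<mu>| \<le> |\<mu>| K\<close> is an equality because both sides have the same total mass.\<close>

lemma invariant_proportional:
  fixes K :: "'y::finite \<Rightarrow> 'y pmf" and \<mu> :: "'y \<Rightarrow> real"
  assumes uniq: "\<And>q. invariant_pmf K q \<Longrightarrow> q = p"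
    and invar: "\<And>y. (\<Sum>x\<in>UNIV. \<mu> x * pmf (K x) y) = \<mu> y"
  shows "\<exists>c. \<forall>y. \<mu> y = c * pmf p y"
proof -
  have le: "\<bar>\<mu> y\<bar> \<le> (\<Sum>x\<in>UNIV. \<bar>\<mu> x\<bar> * pmf (K x) y)" for y
    unfolding invar[of y, symmetric] by (rule order_trans[OF sum_abs]) (simp add: abs_mult)
  have "(\<Sum>y\<in>UNIV. \<Sum>x\<in>UNIV. \<bar>\<mu> x\<bar> * pmf (K x) y) = (\<Sum>x\<in>UNIV. \<Sum>y\<in>UNIV. \<bar>\<mu> x\<bar> * pmf (K x) y)"
    by (rule sum.swap)
  then have "(\<Sum>y\<in>UNIV. (\<Sum>x\<in>UNIV. \<bar>\<mu> x\<bar> * pmf (K x) y) - \<bar>\<mu> y\<bar>) = 0"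
    by (simp add: sum_subtractf sum_distrib_left[symmetric] sum_pmf_finite)
  then have "(\<Sum>x\<in>UNIV. \<bar>\<mu> x\<bar> * pmf (K x) y) - \<bar>\<mu> y\<bar> = 0" for y
    using le by (subst (asm) sum_nonneg_eq_0_iff) auto
  then have abs: "(\<Sum>x\<in>UNIV. \<bar>\<mu> x\<bar> * pmf (K x) y) = \<bar>\<mu> y\<bar>" for y by simp
  have "\<exists>c. \<forall>y. (\<bar>\<mu> y\<bar> + \<mu> y) = c * pmf p y"
    by (rule nonneg_invariant_proportional[OF uniq]) (auto simp: distrib_right sum.distrib abs invar)
  moreover have "\<exists>c. \<forall>y. (\<bar>\<mu> y\<bar> - \<mu> y) = c * pmf p y"
    by (rule nonneg_invariant_proportional[OF uniq]) (auto simp: left_diff_distrib sum_subtractf abs invar)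
  ultimately obtain c1 c2 where "\<And>y. \<bar>\<mu> y\<bar> + \<mu> y = c1 * pmf p y" "\<And>y. \<bar>\<mu> y\<bar> - \<mu> y = c2 * pmf p y"
    by metis
  then have "2 * \<mu> y = (c1 - c2) * pmf p y" for y
    by (smt (verit) left_diff_distrib)
  then have "\<mu> y = ((c1 - c2) / 2) * pmf p y" for y by (simp add: field_simps)
  then show ?thesis by blast
qed

text \<open>The range of \<open>h \<mapsto> h - K h\<close> has the invariant signed vectors as orthogonal complement, and these are
  the multiples of \<open>p\<close>. So every \<open>g\<close> with mean zero lies in the range.\<close>

lemma poisson_equation_real:
  fixes K :: "'y::finite \<Rightarrow> 'y pmf" and g :: "'y \<Rightarrow> real"
  assumes inv: "invariant_pmf K p" and uniq: "\<And>q. invariant_pmf K q \<Longrightarrow> q = p"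
  shows "\<exists>h. \<forall>x. h x - stat_mean (K x) h = g x - stat_mean p g"
proof -
  define T :: "real^'y \<Rightarrow> real^'y" where "T = (\<lambda>h. \<chi> x. h $ x - stat_mean (K x) (\<lambda>y. h $ y))"
  define g0 :: "real^'y" where "g0 = (\<chi> x. g x - stat_mean p g)"
  have "linear T"
    by (rule linearI)
      (simp_all add: T_def vec_eq_iff stat_mean_def sum.distrib sum_distrib_left algebra_simps)
  then have sub: "subspace (range T)" by (simp add: linear_subspace_image)
  obtain y z where y: "y \<in> span (range T)" and z: "\<And>w. w \<in> span (range T) \<Longrightarrow> orthogonal z w"
    and g0: "g0 = y + z" using orthogonal_subspace_decomp_exists[of "range T" g0] by metis
  have span: "span (range T) = range T" using sub by (simp add: span_eq_iff)
  \<comment> \<open>Testing orthogonality against the images of unit vectors shows that \<open>z\<close> is invariant.\<close>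
  have "(\<Sum>x\<in>UNIV. z $ x * pmf (K x) j) = z $ j" for j
  proof -
    have "orthogonal z (T (axis j 1))" using z span by blast
    moreover have "T (axis j 1) $ x = (if x = j then 1 else 0) - pmf (K x) j" for x
    proof -
      have "stat_mean (K x) (($) (axis j (1::real))) = (\<Sum>y\<in>UNIV. if y = j then pmf (K x) y else 0)"
        unfolding stat_mean_def by (rule sum.cong) (auto simp: axis_def)
      moreover have "axis j (1::real) $ x = (if x = j then 1 else 0)" by (simp add: axis_def)
      ultimately show ?thesis by (simp add: T_def)
    qed
    ultimately have "(\<Sum>x\<in>UNIV. z $ x * (if x = j then 1 else 0)) = (\<Sum>x\<in>UNIV. z $ x * pmf (K x) j)"
      by (simp only: orthogonal_def inner_vec_def inner_real_def right_diff_distrib sum_subtractf)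
    then show ?thesis by (simp add: mult_delta_right)
  qed
  then obtain c where c: "\<And>j. z $ j = c * pmf p j"
    using invariant_proportional[where K = K and \<mu> = "\<lambda>x. z $ x", OF uniq] by blast
  have "z \<bullet> z = z \<bullet> g0" using z[OF y] by (simp add: g0 inner_add_right orthogonal_def)
  also have "\<dots> = c * (\<Sum>x\<in>UNIV. pmf p x * (g x - stat_mean p g))"
    by (simp add: inner_vec_def g0_def c sum_distrib_left algebra_simps)
  also have "(\<Sum>x\<in>UNIV. pmf p x * (g x - stat_mean p g)) = stat_mean p (\<lambda>x. g x - stat_mean p g)"
    by (simp add: stat_mean_def)
  also have "\<dots> = 0" by (simp add: stat_mean_diff)
  finally have "g0 \<in> range T" using y g0 span by simp
  then obtain h where "g0 = T h" by blast
  then have "h $ x - stat_mean (K x) (\<lambda>y. h $ y) = g x - stat_mean p g" for x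
    by (simp add: g0_def T_def vec_eq_iff)
  then show ?thesis by (intro exI[of _ "\<lambda>x. h $ x"]) simp
qed

lemma poisson_equation:
  fixes K :: "'y::finite \<Rightarrow> 'y pmf" and g :: "'y \<Rightarrow> 'a::euclidean_space"
  assumes inv: "invariant_pmf K p" and uniq: "\<And>q. invariant_pmf K q \<Longrightarrow> q = p"
  obtains h where "\<And>x. h x - stat_mean (K x) h = g x - stat_mean p g"
proof -
  have "\<exists>H. \<forall>b x. H b x - stat_mean (K x) (H b) = g x \<bullet> b - stat_mean p (\<lambda>x. g x \<bullet> b)"
    using poisson_equation_real[where g = "\<lambda>x. g x \<bullet> _", OF inv uniq] by (intro choice allI) blast
  then obtain H where H: "\<And>b x. H b x - stat_mean (K x) (H b) = g x \<bullet> b - stat_mean p (\<lambda>x. g x \<bullet> b)"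
    by blast
  define h where "h = (\<lambda>x. \<Sum>b\<in>Basis. H b x *\<^sub>R b)"
  have inner: "stat_mean q f \<bullet> b = stat_mean q (\<lambda>x. f x \<bullet> b)" for q and f :: "'y \<Rightarrow> 'a" and b
    by (simp add: stat_mean_def inner_sum_left)
  show ?thesis
  proof (rule that)
    fix x
    show "h x - stat_mean (K x) h = g x - stat_mean p g"
      by (rule euclidean_eqI) (simp add: inner_diff_left inner H h_def)
  qed
qed

section \<open>Moments of additive functionals of the chain\<close>

locale uniquely_ergodic_chain = prob_space M
  for M :: "'w measure" +
  fixes K :: "'y::finite \<Rightarrow> 'y pmf" and Y :: "nat \<Rightarrow> 'w \<Rightarrow> 'y" and p :: "'y pmf"
  assumes chain: "markov_chain M K Y"
    and inv: "invariant_pmf K p"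
    and uniq: "\<And>q. invariant_pmf K q \<Longrightarrow> q = p"
begin

text \<open>A pointwise form of adaptedness to the filtration generated by the chain. There are only finitely many
  histories up to time \<open>n\<close>, so a determined function is simple, hence measurable and integrable.\<close>

definition determined :: "nat \<Rightarrow> ('w \<Rightarrow> 'b) \<Rightarrow> bool" where
  "determined n Z \<longleftrightarrow>
     (\<forall>\<omega>\<in>space M. \<forall>\<omega>'\<in>space M. (\<forall>k\<le>n. Y k \<omega> = Y k \<omega>') \<longrightarrow> Z \<omega> = Z \<omega>')"

definition hist :: "nat \<Rightarrow> 'w \<Rightarrow> nat \<Rightarrow> 'y" where
  "hist n \<omega> = restrict (\<lambda>k. Y k \<omega>) {..n}"

abbreviation paths :: "nat \<Rightarrow> (nat \<Rightarrow> 'y) set" where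
  "paths n \<equiv> Pi\<^sub>E {..n} (\<lambda>_. UNIV)"

lemma measurable_Y [measurable]: "Y k \<in> measurable M (count_space UNIV)"
  using chain by (simp add: markov_chain_def)

lemma hist_in_paths: "hist n \<omega> \<in> paths n"
  by (auto simp: hist_def)

lemma finite_paths: "finite (paths n)"
  by (intro finite_PiE) auto

lemma hist_eq_iff: "q \<in> paths n \<Longrightarrow> hist n \<omega> = q \<longleftrightarrow> (\<forall>k\<le>n. Y k \<omega> = q k)"
  by (auto simp: hist_def fun_eq_iff PiE_def extensional_def)

lemma hist_eq_hist_iff: "hist n \<omega> = hist n \<omega>' \<longleftrightarrow> (\<forall>k\<le>n. Y k \<omega> = Y k \<omega>')"
  using hist_eq_iff[OF hist_in_paths[of n \<omega>'], of \<omega>] by (simp add: hist_def)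

lemma determined_factor:
  assumes "determined n Z"
  obtains c where "\<And>\<omega>. \<omega> \<in> space M \<Longrightarrow> Z \<omega> = c (hist n \<omega>)"
proof
  fix \<omega> assume \<omega>: "\<omega> \<in> space M"
  define \<omega>' where "\<omega>' = (SOME \<omega>'. \<omega>' \<in> space M \<and> hist n \<omega>' = hist n \<omega>)"
  have w: "\<omega>' \<in> space M \<and> hist n \<omega>' = hist n \<omega>"
    unfolding \<omega>'_def by (rule someI[of _ \<omega>]) (use \<omega> in simp)
  then have "\<forall>k\<le>n. Y k \<omega> = Y k \<omega>'" by (metis hist_eq_hist_iff)
  then have "Z \<omega> = Z \<omega>'" using assms \<omega> w unfolding determined_def by blast
  then show "Z \<omega> = (\<lambda>q. Z (SOME \<omega>'. \<omega>' \<in> space M \<and> hist n \<omega>' = q)) (hist n \<omega>)"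
    by (simp add: \<omega>'_def)
qed

lemma sets_hist: "q \<in> paths n \<Longrightarrow> {\<omega> \<in> space M. hist n \<omega> = q} \<in> sets M"
  by (simp add: hist_eq_iff)

text \<open>The elementary conditional probabilities that specify the chain give the joint law of the history and
  the next state; a history of probability zero contributes nothing to either side.\<close>

lemma expectation_next:
  fixes F :: "(nat \<Rightarrow> 'y) \<Rightarrow> 'y \<Rightarrow> 'b::{banach,second_countable_topology}"
  shows "integrable M (\<lambda>\<omega>. F (hist n \<omega>) (Y (Suc n) \<omega>))" (is ?I)
    and "(\<integral>\<omega>. F (hist n \<omega>) (Y (Suc n) \<omega>) \<partial>M) =
      (\<Sum>q\<in>paths n. \<P>(\<omega> in M. hist n \<omega> = q) *\<^sub>R stat_mean (K (q n)) (F q))" (is ?E)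
proof -
  define S where "S = (\<lambda>q z. {\<omega> \<in> space M. hist n \<omega> = q \<and> Y (Suc n) \<omega> = z})"
  have S: "S q z \<in> sets M" if "q \<in> paths n" for q z
    unfolding S_def using sets_hist[OF that] by measurable
  have eq: "F (hist n \<omega>) (Y (Suc n) \<omega>) = (\<Sum>q\<in>paths n. \<Sum>z\<in>UNIV. indicator (S q z) \<omega> *\<^sub>R F q z)"
    if "\<omega> \<in> space M" for \<omega>
  proof -
    have "(\<Sum>q\<in>paths n. \<Sum>z\<in>UNIV. indicator (S q z) \<omega> *\<^sub>R F q z) =
        (\<Sum>q\<in>paths n. \<Sum>z\<in>UNIV. if z = Y (Suc n) \<omega> then (if q = hist n \<omega> then F q z else 0) else 0)"
      using that by (intro sum.cong) (auto simp: S_def indicator_def)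
    also have "\<dots> = F (hist n \<omega>) (Y (Suc n) \<omega>)"
      using hist_in_paths finite_paths by simp
    finally show ?thesis by simp
  qed
  have int: "integrable M (\<lambda>\<omega>. indicator (S q z) \<omega> *\<^sub>R F q z)" if "q \<in> paths n" for q z
    using S[OF that] by (intro integrable_scaleR_left) (simp add: integrable_indicator_iff emeasure_eq_measure)
  have "integrable M (\<lambda>\<omega>. \<Sum>q\<in>paths n. \<Sum>z\<in>UNIV. indicator (S q z) \<omega> *\<^sub>R F q z)"
    using int by (intro Bochner_Integration.integrable_sum)
  then show ?I by (subst Bochner_Integration.integrable_cong[OF refl eq])
  have S_prob: "measure M (S q z) = \<P>(\<omega> in M. hist n \<omega> = q) * pmf (K (q n)) z" if q: "q \<in> paths n" for q z
  proof (cases "\<P>(\<omega> in M. hist n \<omega> = q) = 0")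
    case True
    have "measure M (S q z) \<le> \<P>(\<omega> in M. hist n \<omega> = q)"
      using sets_hist[OF q] by (intro finite_measure_mono) (auto simp: S_def)
    then show ?thesis using True by (simp add: measure_le_0_iff)
  next
    case False
    then have "\<P>(\<omega> in M. hist n \<omega> = q) > 0" by (simp add: less_le)
    then have "cond_prob M (\<lambda>\<omega>. Y (Suc n) \<omega> = z) (\<lambda>\<omega>. hist n \<omega> = q) = pmf (K (q n)) z"
      using chain q by (simp add: markov_chain_def hist_eq_iff)
    then show ?thesis using False by (simp add: cond_prob_def S_def conj_commute field_simps)
  qed
  have "(\<integral>\<omega>. F (hist n \<omega>) (Y (Suc n) \<omega>) \<partial>M) =
      (\<integral>\<omega>. (\<Sum>q\<in>paths n. \<Sum>z\<in>UNIV. indicator (S q z) \<omega> *\<^sub>R F q z) \<partial>M)"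
    by (rule Bochner_Integration.integral_cong[OF refl eq])
  also have "\<dots> = (\<Sum>q\<in>paths n. \<Sum>z\<in>UNIV. (\<integral>\<omega>. indicator (S q z) \<omega> *\<^sub>R F q z \<partial>M))"
  proof (subst Bochner_Integration.integral_sum)
    show "integrable M (\<lambda>\<omega>. \<Sum>z\<in>UNIV. indicator (S q z) \<omega> *\<^sub>R F q z)" if "q \<in> paths n" for q
      using int[OF that] by (intro Bochner_Integration.integrable_sum)
    show "(\<Sum>q\<in>paths n. (\<integral>\<omega>. (\<Sum>z\<in>UNIV. indicator (S q z) \<omega> *\<^sub>R F q z) \<partial>M)) =
        (\<Sum>q\<in>paths n. \<Sum>z\<in>UNIV. (\<integral>\<omega>. indicator (S q z) \<omega> *\<^sub>R F q z \<partial>M))"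
      by (intro sum.cong refl Bochner_Integration.integral_sum int)
  qed
  also have "\<dots> = (\<Sum>q\<in>paths n. \<Sum>z\<in>UNIV. measure M (S q z) *\<^sub>R F q z)"
  proof (intro sum.cong refl)
    fix q z assume q: "q \<in> paths n"
    have "(\<integral>\<omega>. indicator (S q z) \<omega> *\<^sub>R F q z \<partial>M) = (\<integral>\<omega>. indicator (S q z) \<omega> \<partial>M) *\<^sub>R F q z"
      using S[OF q] by (intro integral_scaleR_left) (simp add: integrable_indicator_iff emeasure_eq_measure)
    also have "(\<integral>\<omega>. indicator (S q z) \<omega> \<partial>M) = measure M (S q z)"
      using S[OF q] by simp
    finally show "(\<integral>\<omega>. indicator (S q z) \<omega> *\<^sub>R F q z \<partial>M) = measure M (S q z) *\<^sub>R F q z" .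
  qed
  also have "\<dots> = (\<Sum>q\<in>paths n. \<P>(\<omega> in M. hist n \<omega> = q) *\<^sub>R stat_mean (K (q n)) (F q))"
    by (intro sum.cong) (simp_all add: S_prob stat_mean_def scaleR_sum_right)
  finally show ?E .
qed

lemma determined_integrable:
  fixes Z :: "'w \<Rightarrow> 'b::{banach,second_countable_topology}"
  assumes "determined n Z"
  shows "integrable M Z"
proof -
  obtain c where c: "\<And>\<omega>. \<omega> \<in> space M \<Longrightarrow> Z \<omega> = c (hist n \<omega>)"
    using determined_factor[OF assms] by blast
  show ?thesis
    using expectation_next(1)[of "\<lambda>q _. c q" n] by (subst Bochner_Integration.integrable_cong[OF refl c])
qed

lemma markov_property:
  fixes Z :: "'w \<Rightarrow> 'b::{real_normed_field,banach,second_countable_topology}"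
  assumes "determined n Z"
  shows "(\<integral>\<omega>. Z \<omega> * g (Y n \<omega>) (Y (Suc n) \<omega>) \<partial>M) =
    (\<integral>\<omega>. Z \<omega> * stat_mean (K (Y n \<omega>)) (g (Y n \<omega>)) \<partial>M)"
proof -
  obtain c where c: "\<And>\<omega>. \<omega> \<in> space M \<Longrightarrow> Z \<omega> = c (hist n \<omega>)"
    using determined_factor[OF assms] by blast
  have n: "Y n \<omega> = hist n \<omega> n" for \<omega> by (simp add: hist_def)
  have lin: "stat_mean (K (q n)) (\<lambda>z. c q * g (q n) z) = c q * stat_mean (K (q n)) (g (q n))" for q
    by (rule stat_mean_linear) (simp add: bounded_linear.linear bounded_linear_mult_right)
  have "(\<integral>\<omega>. Z \<omega> * g (Y n \<omega>) (Y (Suc n) \<omega>) \<partial>M) =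
      (\<integral>\<omega>. c (hist n \<omega>) * g (hist n \<omega> n) (Y (Suc n) \<omega>) \<partial>M)"
    by (intro Bochner_Integration.integral_cong) (auto simp: c n)
  also have "\<dots> = (\<integral>\<omega>. c (hist n \<omega>) * stat_mean (K (hist n \<omega> n)) (g (hist n \<omega> n)) \<partial>M)"
    using expectation_next(2)[of "\<lambda>q z. c q * g (q n) z" n]
      expectation_next(2)[of "\<lambda>q z. c q * stat_mean (K (q n)) (g (q n))" n] by (simp add: lin)
  also have "\<dots> = (\<integral>\<omega>. Z \<omega> * stat_mean (K (Y n \<omega>)) (g (Y n \<omega>)) \<partial>M)"
    by (intro Bochner_Integration.integral_cong) (auto simp: c n)
  finally show ?thesis .
qed

text \<open>When \<open>h\<close> solves the Poisson equation for \<open>f\<close>, this is the martingale part of the sum of \<open>f\<close> along the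
  chain; \<open>sum_eq_mart\<close> identifies the boundary term.\<close>

definition mart :: "('y \<Rightarrow> 'a::real_vector) \<Rightarrow> nat \<Rightarrow> 'w \<Rightarrow> 'a" where
  "mart h n \<omega> = (\<Sum>k<n. h (Y (Suc k) \<omega>) - stat_mean (K (Y k \<omega>)) h)"

lemma mart_Suc: "mart h (Suc n) \<omega> = mart h n \<omega> + (h (Y (Suc n) \<omega>) - stat_mean (K (Y n \<omega>)) h)"
  by (simp add: mart_def)

lemma mart_0 [simp]: "mart h 0 \<omega> = 0"
  by (simp add: mart_def)

lemma sum_eq_mart:
  "(\<Sum>k=1..n. h (Y k \<omega>) - stat_mean (K (Y k \<omega>)) h) =
    mart h n \<omega> + stat_mean (K (Y 0 \<omega>)) h - stat_mean (K (Y n \<omega>)) h"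
  by (induction n) (simp_all add: mart_Suc)

lemma determined_mart_self: "determined n (mart h n)"
  unfolding determined_def mart_def by (auto intro!: sum.cong)

lemma determined_apply2: "determined n f \<Longrightarrow> determined n g \<Longrightarrow> determined n (\<lambda>\<omega>. F (f \<omega>) (g \<omega>))"
  unfolding determined_def by (intro ballI impI arg_cong2[where f = F]) blast+

lemma determined_state: "determined n (Y n)"
  by (simp add: determined_def)

lemma determined_mart: "determined n (\<lambda>\<omega>. F (mart h n \<omega>) (Y n \<omega>))"
  by (rule determined_apply2[OF determined_mart_self determined_state])

lemmas integrable_mart = determined_integrable[OF determined_mart]

lemma integrable_state:
  fixes f :: "'y \<Rightarrow> 'b::{banach,second_countable_topology}"
  shows "integrable M (\<lambda>\<omega>. f (Y n \<omega>))"
  using integrable_mart[of "\<lambda>_ y. f y" "\<lambda>_. 0::real" n] by simp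

lemma expectation_next_state:
  fixes f :: "'y \<Rightarrow> 'b::{real_normed_field,banach,second_countable_topology}"
  shows "(\<integral>\<omega>. f (Y (Suc n) \<omega>) \<partial>M) = (\<integral>\<omega>. stat_mean (K (Y n \<omega>)) f \<partial>M)"
  using markov_property[of n "\<lambda>_. 1" "\<lambda>_. f"] by (simp add: determined_def)

lemma finite_state_bound:
  fixes f :: "'y \<Rightarrow> 'b::real_normed_vector"
  obtains C where "C \<ge> 0" "\<And>x. norm (f x) \<le> C"
proof (rule that)
  show "(\<Sum>x\<in>UNIV. norm (f x)) \<ge> 0" by (intro sum_nonneg) auto
  show "norm (f x) \<le> (\<Sum>x\<in>UNIV. norm (f x))" for x by (rule member_le_sum) auto
qed

lemma expectation_abs_le:
  fixes f :: "'y \<Rightarrow> real"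
  assumes "\<And>x. \<bar>f x\<bar> \<le> C"
  shows "\<bar>\<integral>\<omega>. f (Y n \<omega>) \<partial>M\<bar> \<le> C"
proof -
  have "\<bar>\<integral>\<omega>. f (Y n \<omega>) \<partial>M\<bar> \<le> (\<integral>\<omega>. \<bar>f (Y n \<omega>)\<bar> \<partial>M)" by (rule integral_abs_bound)
  also have "\<dots> \<le> (\<integral>\<omega>. C \<partial>M)"
    using assms integrable_state by (intro integral_mono) auto
  finally show ?thesis by (simp add: prob_space)
qed

text \<open>The error is bounded uniformly in \<open>n\<close>: by the Poisson equation for \<open>c\<close> the expectations telescope.\<close>

lemma expectation_ergodic_sum:
  fixes c :: "'y \<Rightarrow> real"
  obtains C where "\<And>n. \<bar>(\<Sum>k<n. (\<integral>\<omega>. c (Y k \<omega>) \<partial>M)) - real n * stat_mean p c\<bar> \<le> C"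
proof -
  obtain u where u: "\<And>x. u x - stat_mean (K x) u = c x - stat_mean p c"
    using poisson_equation[OF inv uniq] by metis
  obtain B where B: "\<And>x. norm (u x) \<le> B" using finite_state_bound by metis
  have "(\<integral>\<omega>. c (Y k \<omega>) \<partial>M) - stat_mean p c = (\<integral>\<omega>. u (Y k \<omega>) \<partial>M) - (\<integral>\<omega>. u (Y (Suc k) \<omega>) \<partial>M)" for k
  proof -
    have "(\<integral>\<omega>. u (Y k \<omega>) \<partial>M) - (\<integral>\<omega>. u (Y (Suc k) \<omega>) \<partial>M) = (\<integral>\<omega>. u (Y k \<omega>) - stat_mean (K (Y k \<omega>)) u \<partial>M)"
      using integrable_state[of u k] integrable_state[of "\<lambda>x. stat_mean (K x) u" k]
      by (simp add: expectation_next_state)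
    also have "\<dots> = (\<integral>\<omega>. c (Y k \<omega>) \<partial>M) - stat_mean p c"
      by (simp add: u integrable_state prob_space)
    finally show ?thesis by simp
  qed
  then have "(\<Sum>k<n. (\<integral>\<omega>. c (Y k \<omega>) \<partial>M) - stat_mean p c) = (\<integral>\<omega>. u (Y 0 \<omega>) \<partial>M) - (\<integral>\<omega>. u (Y n \<omega>) \<partial>M)" for n
    by (induction n) simp_all
  then have eq: "(\<Sum>k<n. (\<integral>\<omega>. c (Y k \<omega>) \<partial>M)) - real n * stat_mean p c = (\<integral>\<omega>. u (Y 0 \<omega>) \<partial>M) - (\<integral>\<omega>. u (Y n \<omega>) \<partial>M)" for n
    by (simp add: sum_subtractf)
  show ?thesis
  proof (rule that[of "2 * B"])
    fix n
    show "\<bar>(\<Sum>k<n. (\<integral>\<omega>. c (Y k \<omega>) \<partial>M)) - real n * stat_mean p c\<bar> \<le> 2 * B"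
      unfolding eq using expectation_abs_le[of u B 0] expectation_abs_le[of u B n] B by (simp add: abs_le_iff)
  qed
qed

definition cond_cov :: "('y \<Rightarrow> real) \<Rightarrow> ('y \<Rightarrow> real) \<Rightarrow> 'y \<Rightarrow> real" where
  "cond_cov h h' x = stat_mean (K x) (\<lambda>y. (h y - stat_mean (K x) h) * (h' y - stat_mean (K x) h'))"

lemma mart_orthogonal:
  fixes Z :: "'w \<Rightarrow> real"
  assumes "determined n Z"
  shows "(\<integral>\<omega>. Z \<omega> * (h (Y (Suc n) \<omega>) - stat_mean (K (Y n \<omega>)) h) \<partial>M) = 0"
  using markov_property[OF assms, of "\<lambda>x y. h y - stat_mean (K x) h"] by (simp add: stat_mean_diff)

lemma determined_mono: "determined n Z \<Longrightarrow> n \<le> n' \<Longrightarrow> determined n' Z"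
  unfolding determined_def by (meson le_trans)

lemma determined_mult:
  "determined n Z \<Longrightarrow> determined n Z' \<Longrightarrow> determined n (\<lambda>\<omega>. Z \<omega> * Z' \<omega>)"
  by (rule determined_apply2)

lemma determined_step: "k < n \<Longrightarrow> determined n (\<lambda>\<omega>. g (Y k \<omega>) (Y (Suc k) \<omega>))"
  by (auto simp: determined_def)

lemma integrable_step:
  fixes Z :: "'w \<Rightarrow> 'b::{real_normed_field,banach,second_countable_topology}"
  shows "determined n Z \<Longrightarrow> integrable M (\<lambda>\<omega>. Z \<omega> * g (Y n \<omega>) (Y (Suc n) \<omega>))"
  by (intro determined_integrable[of "Suc n"] determined_mult determined_step) (auto intro: determined_mono)

lemma mart_cov:
  fixes h h' :: "'y \<Rightarrow> real"
  shows "(\<integral>\<omega>. mart h n \<omega> * mart h' n \<omega> \<partial>M) = (\<Sum>k<n. (\<integral>\<omega>. cond_cov h h' (Y k \<omega>) \<partial>M))"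
proof (induction n)
  case (Suc n)
  let ?D = "\<lambda>h x y. h y - stat_mean (K x) h"
  let ?M = "mart h n" and ?M' = "mart h' n"
  have d: "determined n (\<lambda>\<omega>. mart f n \<omega>)" for f :: "'y \<Rightarrow> real"
    by (rule determined_mart_self)
  have d1: "determined n (\<lambda>\<omega>. 1::real)" by (simp add: determined_def)
  have i1: "integrable M (\<lambda>\<omega>. ?M \<omega> * ?M' \<omega>)" by (intro determined_integrable[of n] determined_mult d)
  note i2 = integrable_step[OF d[of h], of "?D h'"] and i3 = integrable_step[OF d[of h'], of "?D h"]
    and i4 = integrable_step[OF d1, of "\<lambda>x y. ?D h x y * ?D h' x y", simplified]
  have "(\<integral>\<omega>. mart h (Suc n) \<omega> * mart h' (Suc n) \<omega> \<partial>M) =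
      (\<integral>\<omega>. ?M \<omega> * ?M' \<omega> + ?M \<omega> * ?D h' (Y n \<omega>) (Y (Suc n) \<omega>) + ?M' \<omega> * ?D h (Y n \<omega>) (Y (Suc n) \<omega>)
        + ?D h (Y n \<omega>) (Y (Suc n) \<omega>) * ?D h' (Y n \<omega>) (Y (Suc n) \<omega>) \<partial>M)"
    by (rule Bochner_Integration.integral_cong) (simp_all add: mart_Suc algebra_simps)
  also have "\<dots> = (\<integral>\<omega>. ?M \<omega> * ?M' \<omega> \<partial>M) + (\<integral>\<omega>. ?M \<omega> * ?D h' (Y n \<omega>) (Y (Suc n) \<omega>) \<partial>M)
      + (\<integral>\<omega>. ?M' \<omega> * ?D h (Y n \<omega>) (Y (Suc n) \<omega>) \<partial>M)
      + (\<integral>\<omega>. ?D h (Y n \<omega>) (Y (Suc n) \<omega>) * ?D h' (Y n \<omega>) (Y (Suc n) \<omega>) \<partial>M)"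
    using i1 i2 i3 i4 by (simp only: Bochner_Integration.integral_add Bochner_Integration.integrable_add)
  also have "\<dots> = (\<integral>\<omega>. ?M \<omega> * ?M' \<omega> \<partial>M)
      + (\<integral>\<omega>. ?D h (Y n \<omega>) (Y (Suc n) \<omega>) * ?D h' (Y n \<omega>) (Y (Suc n) \<omega>) \<partial>M)"
    by (simp only: mart_orthogonal[OF d] add_0_right)
  also have "(\<integral>\<omega>. ?D h (Y n \<omega>) (Y (Suc n) \<omega>) * ?D h' (Y n \<omega>) (Y (Suc n) \<omega>) \<partial>M) =
      (\<integral>\<omega>. cond_cov h h' (Y n \<omega>) \<partial>M)"
    using markov_property[OF d1, of "\<lambda>x y. ?D h x y * ?D h' x y"] by (simp add: cond_cov_def)
  finally show ?case using Suc by simp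
qed simp

lemma mart_covariance:
  fixes h h' :: "'y \<Rightarrow> real"
  obtains C where "\<And>n. \<bar>(\<integral>\<omega>. mart h n \<omega> * mart h' n \<omega> \<partial>M) - real n * stat_mean p (cond_cov h h')\<bar> \<le> C"
  using expectation_ergodic_sum[of "cond_cov h h'"] by (simp add: mart_cov) blast

lemma increment_bound:
  fixes h :: "'y \<Rightarrow> real"
  obtains b where "b \<ge> 0" "\<And>x y. \<bar>h y - stat_mean (K x) h\<bar> \<le> b"
proof -
  obtain B1 where B1: "\<And>x. norm (h x) \<le> B1" using finite_state_bound by metis
  obtain B2 where B2: "\<And>x. norm (stat_mean (K x) h) \<le> B2"
    using finite_state_bound[of "\<lambda>x. stat_mean (K x) h"] by blast
  show ?thesis
  proof (rule that[of "\<bar>B1\<bar> + \<bar>B2\<bar>"])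
    fix x y show "\<bar>h y - stat_mean (K x) h\<bar> \<le> \<bar>B1\<bar> + \<bar>B2\<bar>"
      using B1[of y] B2[of x] by simp
  qed simp
qed

text \<open>Expanding \<open>(m + d) ^ 4\<close>, the term linear in the increment vanishes in expectation and the cubic one is
  absorbed by its neighbours, so that the fourth moment grows by at most a multiple of the second moment,
  which is linear in \<open>n\<close>.\<close>

lemma mart_fourth_moment:
  fixes h :: "'y \<Rightarrow> real"
  assumes b: "b \<ge> 0" "\<And>x y. \<bar>h y - stat_mean (K x) h\<bar> \<le> b"
  shows "(\<integral>\<omega>. mart h n \<omega> ^ 2 \<partial>M) \<le> b ^ 2 * real n"
    and "(\<integral>\<omega>. mart h n \<omega> ^ 4 \<partial>M) \<le> 11 * b ^ 4 * real n ^ 2"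
proof -
  have sq: "(h y - stat_mean (K x) h)\<^sup>2 \<le> b\<^sup>2" for x y
    using b by (metis abs_le_square_iff abs_of_nonneg)
  have "\<bar>cond_cov h h x\<bar> \<le> b\<^sup>2" for x
  proof -
    have "0 \<le> cond_cov h h x" by (simp add: cond_cov_def stat_mean_def sum_nonneg)
    moreover have "cond_cov h h x \<le> stat_mean (K x) (\<lambda>_. b\<^sup>2)"
      unfolding cond_cov_def using sq by (intro stat_mean_mono) (simp add: power2_eq_square)
    ultimately show ?thesis by simp
  qed
  then have "(\<integral>\<omega>. cond_cov h h (Y k \<omega>) \<partial>M) \<le> b\<^sup>2" for k
    using expectation_abs_le[of "cond_cov h h" "b\<^sup>2" k] by simp
  then have "(\<Sum>k<n. (\<integral>\<omega>. cond_cov h h (Y k \<omega>) \<partial>M)) \<le> (\<Sum>k<n. b\<^sup>2)" for n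
    by (intro sum_mono)
  then show second: "(\<integral>\<omega>. mart h n \<omega> ^ 2 \<partial>M) \<le> b ^ 2 * real n" for n
    by (simp add: power2_eq_square[of "mart _ _ _"] mart_cov mult.commute)
  show "(\<integral>\<omega>. mart h n \<omega> ^ 4 \<partial>M) \<le> 11 * b ^ 4 * real n ^ 2"
  proof (induction n)
    case (Suc n)
    let ?D = "\<lambda>x y. h y - stat_mean (K x) h"
    have pt: "(m + d) ^ 4 \<le> (m ^ 4 + 8 * b\<^sup>2 * m\<^sup>2 + 3 * b ^ 4) + 4 * m ^ 3 * d" if "d\<^sup>2 \<le> b\<^sup>2" for m d :: real
    proof -
      have "(m + d) ^ 4 = m ^ 4 + 4 * m ^ 3 * d + 6 * m\<^sup>2 * d\<^sup>2 + 4 * m * d ^ 3 + d ^ 4"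
        by (simp add: power4_eq_xxxx power3_eq_cube power2_eq_square algebra_simps)
      moreover have "4 * m * d ^ 3 \<le> 2 * m\<^sup>2 * d\<^sup>2 + 2 * d ^ 4"
      proof -
        have "0 \<le> 2 * (d * (m - d))\<^sup>2" by simp
        then show ?thesis by (simp add: power4_eq_xxxx power3_eq_cube power2_eq_square algebra_simps)
      qed
      moreover have "m\<^sup>2 * d\<^sup>2 \<le> b\<^sup>2 * m\<^sup>2" using mult_right_mono[OF that, of "m\<^sup>2"] by (simp add: mult.commute)
      moreover have "d ^ 4 \<le> b ^ 4"
        using power_mono[OF that, of 2] by simp
      ultimately show ?thesis by linarith
    qed
    have d3: "determined n (\<lambda>\<omega>. 4 * mart h n \<omega> ^ 3)"
      using determined_mart[of n "\<lambda>m _. 4 * m ^ 3" h] .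
    have i: "integrable M (\<lambda>\<omega>. G (mart h k \<omega>))" for G :: "real \<Rightarrow> real" and k
      using integrable_mart[of "\<lambda>m _. G m" h k] .
    have "(\<integral>\<omega>. mart h (Suc n) \<omega> ^ 4 \<partial>M) \<le> (\<integral>\<omega>. (mart h n \<omega> ^ 4 + 8 * b\<^sup>2 * mart h n \<omega> ^ 2 + 3 * b ^ 4)
        + 4 * mart h n \<omega> ^ 3 * ?D (Y n \<omega>) (Y (Suc n) \<omega>) \<partial>M)"
    proof (rule integral_mono)
      show "integrable M (\<lambda>\<omega>. mart h (Suc n) \<omega> ^ 4)" using i[of "\<lambda>m. m ^ 4"] .
      show "integrable M (\<lambda>\<omega>. (mart h n \<omega> ^ 4 + 8 * b\<^sup>2 * mart h n \<omega> ^ 2 + 3 * b ^ 4)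
        + 4 * mart h n \<omega> ^ 3 * ?D (Y n \<omega>) (Y (Suc n) \<omega>))"
        by (intro Bochner_Integration.integrable_add integrable_step[OF d3] i[of "\<lambda>m. m ^ 4 + 8 * b\<^sup>2 * m\<^sup>2 + 3 * b ^ 4"])
    qed (unfold mart_Suc, rule pt[OF sq])
    also have "\<dots> = (\<integral>\<omega>. mart h n \<omega> ^ 4 + 8 * b\<^sup>2 * mart h n \<omega> ^ 2 + 3 * b ^ 4 \<partial>M)"
      using i[of "\<lambda>m. m ^ 4 + 8 * b\<^sup>2 * m\<^sup>2 + 3 * b ^ 4"] integrable_step[OF d3, of ?D]
      by (subst Bochner_Integration.integral_add) (simp_all add: mart_orthogonal[OF d3])
    also have "\<dots> = (\<integral>\<omega>. mart h n \<omega> ^ 4 \<partial>M) + 8 * b\<^sup>2 * (\<integral>\<omega>. mart h n \<omega> ^ 2 \<partial>M) + 3 * b ^ 4"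
      using i[of "\<lambda>m. m ^ 4"] i[of "\<lambda>m. m ^ 2"] by (simp add: prob_space)
    also have "\<dots> \<le> 11 * b ^ 4 * real n ^ 2 + 8 * b\<^sup>2 * (b\<^sup>2 * real n) + 3 * b ^ 4"
      using Suc second[of n] by (intro add_mono mult_left_mono) auto
    also have "\<dots> = b ^ 4 * (11 * real n ^ 2 + 8 * real n + 3)"
      by (simp add: power4_eq_xxxx power2_eq_square algebra_simps)
    also have "\<dots> \<le> b ^ 4 * (11 * real (Suc n) ^ 2)"
      by (intro mult_left_mono) (auto simp: power2_eq_square algebra_simps)
    finally show ?case by (simp add: mult.assoc mult.left_commute)
  qed simp
qed

lemma sum_fourth_moment_real:
  fixes f :: "'y \<Rightarrow> real"
  assumes "stat_mean p f = 0"
  obtains C where "C \<ge> 0" "\<And>n. n \<ge> 1 \<Longrightarrow> (\<integral>\<omega>. (\<Sum>k=1..n. f (Y k \<omega>)) ^ 4 \<partial>M) \<le> C * real n ^ 2"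
proof -
  obtain h where h: "\<And>x. h x - stat_mean (K x) h = f x"
    using poisson_equation[OF inv uniq, of f] assms by auto
  obtain b where b: "b \<ge> 0" "\<And>x y. \<bar>h y - stat_mean (K x) h\<bar> \<le> b" using increment_bound[of h] by blast
  obtain B where B: "B \<ge> 0" "\<And>x. norm (stat_mean (K x) h) \<le> B" using finite_state_bound[of "\<lambda>x. stat_mean (K x) h"] by blast
  have pt: "(m + e) ^ 4 \<le> 8 * m ^ 4 + 8 * (2 * B) ^ 4" if "\<bar>e\<bar> \<le> 2 * B" for m e :: real
  proof -
    have "(m + e)\<^sup>2 \<le> 2 * (m\<^sup>2 + e\<^sup>2)" using sum_squares_bound[of m e] by (simp add: power2_sum)
    then have "((m + e)\<^sup>2)\<^sup>2 \<le> (2 * (m\<^sup>2 + e\<^sup>2))\<^sup>2" by (intro power_mono) auto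
    also have "\<dots> \<le> 8 * ((m\<^sup>2)\<^sup>2 + (e\<^sup>2)\<^sup>2)"
      using sum_squares_bound[of "m\<^sup>2" "e\<^sup>2"] by (simp add: power2_sum power_mult_distrib)
    finally have "(m + e) ^ 4 \<le> 8 * m ^ 4 + 8 * e ^ 4" by simp
    moreover have "e ^ 4 \<le> (2 * B) ^ 4"
      using power_mono[OF that, of 4] by (simp add: power_even_abs)
    then have "8 * e ^ 4 \<le> 8 * (2 * B) ^ 4" by (rule mult_left_mono) simp
    ultimately show ?thesis by (rule order_trans[OF _ add_left_mono])
  qed
  have i: "integrable M (\<lambda>\<omega>. G (mart h k \<omega>))" for G :: "real \<Rightarrow> real" and k
    using integrable_mart[of "\<lambda>m _. G m" h k] .
  show ?thesis
  proof (rule that[of "8 * (11 * b ^ 4) + 8 * (2 * B) ^ 4"])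
    fix n :: nat assume n: "n \<ge> 1"
    have eq: "(\<Sum>k=1..n. f (Y k \<omega>)) = mart h n \<omega> + (stat_mean (K (Y 0 \<omega>)) h - stat_mean (K (Y n \<omega>)) h)" for \<omega>
      using sum_eq_mart[of h \<omega> n] by (simp add: h)
    have bd: "\<bar>stat_mean (K x) h - stat_mean (K y) h\<bar> \<le> 2 * B" for x y
      using B(2)[of x] B(2)[of y] by simp
    have "determined n (\<lambda>\<omega>. (\<Sum>k=1..n. f (Y k \<omega>)) ^ 4)"
      unfolding determined_def by (auto intro!: arg_cong[where f = "\<lambda>x. x ^ 4"] sum.cong)
    then have "(\<integral>\<omega>. (\<Sum>k=1..n. f (Y k \<omega>)) ^ 4 \<partial>M) \<le> (\<integral>\<omega>. 8 * mart h n \<omega> ^ 4 + 8 * (2 * B) ^ 4 \<partial>M)"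
    proof (rule integral_mono[OF determined_integrable])
      show "integrable M (\<lambda>\<omega>. 8 * mart h n \<omega> ^ 4 + 8 * (2 * B) ^ 4)"
        using i[of "\<lambda>m. 8 * m ^ 4 + 8 * (2 * B) ^ 4"] .
    qed (unfold eq, rule pt[OF bd])
    also have "\<dots> = 8 * (\<integral>\<omega>. mart h n \<omega> ^ 4 \<partial>M) + 8 * (2 * B) ^ 4"
      using i[of "\<lambda>m. m ^ 4"] by (simp add: prob_space)
    also have "\<dots> \<le> 8 * (11 * b ^ 4 * real n ^ 2) + 8 * (2 * B) ^ 4 * real n ^ 2"
      using mart_fourth_moment(2)[OF b, of n] n mult_left_mono[of 1 "real n ^ 2" "8 * (2 * B) ^ 4"]
      by (auto intro!: add_mono)
    finally show "(\<integral>\<omega>. (\<Sum>k=1..n. f (Y k \<omega>)) ^ 4 \<partial>M) \<le> (8 * (11 * b ^ 4) + 8 * (2 * B) ^ 4) * real n ^ 2"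
      by (simp add: algebra_simps)
  qed simp
qed

lemma emp_mean_fourth_moment:
  fixes f :: "'y \<Rightarrow> 'a::euclidean_space"
  assumes "stat_mean p f = 0"
  obtains C where "C \<ge> 0" "\<And>n. n \<ge> 1 \<Longrightarrow> (\<integral>\<omega>. norm (emp_mean Y f n \<omega>) ^ 4 \<partial>M) \<le> C / real n ^ 2"
proof -
  have "stat_mean p (\<lambda>x. f x \<bullet> b) = 0" for b
    using stat_mean_linear[of "\<lambda>x. x \<bullet> b" p f] assms
    by (simp add: bounded_linear.linear bounded_linear_inner_left)
  then have "\<exists>C. C \<ge> 0 \<and> (\<forall>n\<ge>1. (\<integral>\<omega>. (\<Sum>k=1..n. f (Y k \<omega>) \<bullet> b) ^ 4 \<partial>M) \<le> C * real n ^ 2)" for b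
    using sum_fourth_moment_real[of "\<lambda>x. f x \<bullet> b"] by metis
  then obtain C where C: "\<And>b. C b \<ge> 0"
    "\<And>b n. n \<ge> 1 \<Longrightarrow> (\<integral>\<omega>. (\<Sum>k=1..n. f (Y k \<omega>) \<bullet> b) ^ 4 \<partial>M) \<le> C b * real n ^ 2" by metis
  let ?d = "real DIM('a)"
  have pt: "norm x ^ 4 \<le> ?d * (\<Sum>b\<in>Basis. (x \<bullet> b) ^ 4)" for x :: 'a
  proof -
    have "norm x ^ 4 = (\<Sum>b\<in>Basis. (x \<bullet> b)\<^sup>2)\<^sup>2"
      using norm_eq_sqrt_inner[of x] by (simp add: euclidean_inner[of x x] power2_eq_square power4_eq_xxxx sum_nonneg)
    also have "\<dots> \<le> ?d * (\<Sum>b\<in>Basis. ((x \<bullet> b)\<^sup>2)\<^sup>2)"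
      using sum_squared_le_sum_of_squares[of "\<lambda>b. (x \<bullet> b)\<^sup>2" "Basis :: 'a set"] by (simp add: mult.commute)
    finally show ?thesis by simp
  qed
  show ?thesis
  proof (rule that[of "?d * (\<Sum>b\<in>Basis. C b)"])
    show "0 \<le> ?d * (\<Sum>b\<in>Basis. C b)" using C(1) by (simp add: sum_nonneg)
    fix n :: nat assume n: "n \<ge> 1"
    have i: "integrable M (\<lambda>\<omega>. G (\<Sum>k=1..n. f (Y k \<omega>)))" for G :: "'a \<Rightarrow> real"
      by (rule determined_integrable[of n]) (auto simp: determined_def intro!: arg_cong[where f = G] sum.cong)
    have "(\<integral>\<omega>. norm (emp_mean Y f n \<omega>) ^ 4 \<partial>M) = (\<integral>\<omega>. norm (\<Sum>k=1..n. f (Y k \<omega>)) ^ 4 / real n ^ 4 \<partial>M)"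
      by (simp add: emp_mean_def power_mult_distrib power_divide)
    also have "\<dots> = (\<integral>\<omega>. norm (\<Sum>k=1..n. f (Y k \<omega>)) ^ 4 \<partial>M) / real n ^ 4" by simp
    also have "(\<integral>\<omega>. norm (\<Sum>k=1..n. f (Y k \<omega>)) ^ 4 \<partial>M)
        \<le> (\<integral>\<omega>. ?d * (\<Sum>b\<in>Basis. ((\<Sum>k=1..n. f (Y k \<omega>)) \<bullet> b) ^ 4) \<partial>M)"
      by (intro integral_mono i[of "\<lambda>s. norm s ^ 4"] i[of "\<lambda>s. ?d * (\<Sum>b\<in>Basis. (s \<bullet> b) ^ 4)"] pt)
    also have "\<dots> = ?d * (\<Sum>b\<in>Basis. (\<integral>\<omega>. ((\<Sum>k=1..n. f (Y k \<omega>)) \<bullet> b) ^ 4 \<partial>M))"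
      using i[of "\<lambda>s. (s \<bullet> _) ^ 4"] by (simp add: Bochner_Integration.integral_sum)
    also have "\<dots> \<le> ?d * (\<Sum>b\<in>Basis. C b * real n ^ 2)"
      using C(2)[OF n] by (intro mult_left_mono sum_mono) (simp_all add: inner_sum_left)
    finally have "(\<integral>\<omega>. norm (emp_mean Y f n \<omega>) ^ 4 \<partial>M) \<le> ?d * (\<Sum>b\<in>Basis. C b * real n ^ 2) / real n ^ 4"
      by (simp add: divide_right_mono)
    also have "\<dots> = ?d * (\<Sum>b\<in>Basis. C b) / real n ^ 2"
      using n by (simp add: sum_distrib_right[symmetric] field_simps power4_eq_xxxx power2_eq_square)
    finally show "(\<integral>\<omega>. norm (emp_mean Y f n \<omega>) ^ 4 \<partial>M) \<le> ?d * (\<Sum>b\<in>Basis. C b) / real n ^ 2" .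
  qed
qed

lemma emp_mean_integrable:
  fixes G :: "'a::real_vector \<Rightarrow> 'b::{banach,second_countable_topology}"
  shows "integrable M (\<lambda>\<omega>. G (emp_mean Y f n \<omega>))"
  by (rule determined_integrable[of n]) (auto simp: determined_def emp_mean_def intro!: arg_cong[where f = G] sum.cong)

text \<open>The fourth moments are summable, so almost surely the sum of the fourth powers is finite and its terms
  tend to zero.\<close>

lemma emp_mean_tendsto_0:
  fixes f :: "'y \<Rightarrow> 'a::euclidean_space"
  assumes "stat_mean p f = 0"
  shows "AE \<omega> in M. (\<lambda>n. emp_mean Y f n \<omega>) \<longlonglongrightarrow> 0"
proof -
  obtain C where C: "C \<ge> 0" "\<And>n. n \<ge> 1 \<Longrightarrow> (\<integral>\<omega>. norm (emp_mean Y f n \<omega>) ^ 4 \<partial>M) \<le> C / real n ^ 2"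
    using emp_mean_fourth_moment[OF assms] by blast
  let ?X = "\<lambda>n \<omega>. norm (emp_mean Y f (Suc n) \<omega>) ^ 4"
  have int: "integrable M (?X n)" for n by (rule emp_mean_integrable)
  have m [measurable]: "?X n \<in> borel_measurable M" for n using int[of n] by simp
  have "(\<integral>\<^sup>+\<omega>. (\<Sum>n. ennreal (?X n \<omega>)) \<partial>M) = (\<Sum>n. \<integral>\<^sup>+\<omega>. ennreal (?X n \<omega>) \<partial>M)"
    by (rule nn_integral_suminf) measurable
  also have "\<dots> = (\<Sum>n. ennreal (\<integral>\<omega>. ?X n \<omega> \<partial>M))"
    using int by (intro suminf_cong nn_integral_eq_integral) auto
  also have "\<dots> \<le> (\<Sum>n. ennreal (C * inverse (real (Suc n) ^ 2)))"
    using C(2)[of "Suc _"] by (intro suminf_le) (auto simp: divide_inverse intro!: ennreal_leI)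
  also have "\<dots> < \<infinity>"
  proof -
    have "summable (\<lambda>n. C * inverse (real (Suc n) ^ 2))"
      using inverse_power_summable[of 2, where 'a = real]
        summable_Suc_iff[of "\<lambda>n. inverse (real n ^ 2)"] by (intro summable_mult) simp
    then have "(\<Sum>n. ennreal (C * inverse (real (Suc n) ^ 2))) \<noteq> top"
      using C(1) by (intro ennreal_suminf_neq_top) auto
    then show ?thesis by (simp add: less_top[symmetric])
  qed
  finally have "(\<integral>\<^sup>+\<omega>. (\<Sum>n. ennreal (?X n \<omega>)) \<partial>M) \<noteq> \<infinity>" by simp
  then have "AE \<omega> in M. (\<Sum>n. ennreal (?X n \<omega>)) \<noteq> \<infinity>"
    by (intro nn_integral_noteq_infinite) measurable
  then show ?thesis
  proof eventually_elim
    case (elim \<omega>)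
    then have "summable (\<lambda>n. ?X n \<omega>)"
      by (intro summable_suminf_not_top) auto
    then have "(\<lambda>n. ?X n \<omega>) \<longlonglongrightarrow> 0" by (rule summable_LIMSEQ_zero)
    then have "(\<lambda>n. root 4 (?X n \<omega>)) \<longlonglongrightarrow> root 4 0" by (rule tendsto_real_root)
    then have "(\<lambda>n. norm (emp_mean Y f (Suc n) \<omega>)) \<longlonglongrightarrow> 0"
      by (simp add: real_root_power_cancel)
    then have "(\<lambda>n. emp_mean Y f (Suc n) \<omega>) \<longlonglongrightarrow> 0" by (rule tendsto_norm_zero_cancel)
    then show ?case by (rule LIMSEQ_imp_Suc)
  qed
qed

end

section \<open>The martingale central limit theorem along the chain\<close>

text \<open>The second-order expansion of one step of the corrected characteristic function below, with
  increment \<open>d\<close> and corrector \<open>w\<close>.\<close>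

lemma iexp_second_order:
  fixes s d w :: real
  assumes s: "0 \<le> s" and d: "\<bar>d\<bar> \<le> b" and w: "\<bar>w\<bar> \<le> U"
  shows "cmod (iexp (s * d) * complex_of_real (1 - s\<^sup>2 * w / 2)
      - (complex_of_real (1 - s\<^sup>2 * d\<^sup>2 / 2 - s\<^sup>2 * w / 2) + \<i> * complex_of_real (s * d)))
    \<le> (b ^ 3 / 6 + U * b / 2) * s ^ 3"
proof -
  define e3 where "e3 = iexp (s * d) - (complex_of_real (1 - s\<^sup>2 * d\<^sup>2 / 2) + \<i> * complex_of_real (s * d))"
  have "(\<Sum>k\<le>2. (\<i> * complex_of_real (s * d)) ^ k / fact k) =
      complex_of_real (1 - s\<^sup>2 * d\<^sup>2 / 2) + \<i> * complex_of_real (s * d)"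
    by (simp add: numeral_2_eq_2 power2_eq_square algebra_simps)
  then have e3: "cmod e3 \<le> \<bar>s * d\<bar> ^ 3 / 6"
    using iexp_approx1[of "s * d" 2] by (simp add: e3_def fact_numeral numeral_3_eq_3)
  have e1: "cmod (iexp (s * d) - 1) \<le> \<bar>s * d\<bar>"
    using iexp_approx1[of "s * d" 0] by simp
  have sd: "\<bar>s * d\<bar> \<le> s * b" using s d by (simp add: abs_mult mult_left_mono)
  have b: "0 \<le> b" and U: "0 \<le> U" using d w by linarith+
  have "iexp (s * d) * complex_of_real (1 - s\<^sup>2 * w / 2)
      - (complex_of_real (1 - s\<^sup>2 * d\<^sup>2 / 2 - s\<^sup>2 * w / 2) + \<i> * complex_of_real (s * d))
      = e3 - complex_of_real (s\<^sup>2 * w / 2) * (iexp (s * d) - 1)"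
    unfolding e3_def of_real_diff of_real_1 by (simp only: algebra_simps mult_1_left)
  also have "cmod \<dots> \<le> cmod e3 + (s\<^sup>2 * \<bar>w\<bar> / 2) * cmod (iexp (s * d) - 1)"
    by (rule order_trans[OF norm_triangle_ineq4]) (simp add: norm_mult norm_power abs_mult)
  also have "\<dots> \<le> (s * b) ^ 3 / 6 + (s\<^sup>2 * U / 2) * (s * b)"
  proof (intro add_mono mult_mono)
    show "cmod e3 \<le> (s * b) ^ 3 / 6"
      using e3 power_mono[OF sd, of 3] by simp
    show "s\<^sup>2 * \<bar>w\<bar> / 2 \<le> s\<^sup>2 * U / 2" using w by (simp add: mult_left_mono)
    show "cmod (iexp (s * d) - 1) \<le> s * b" using e1 sd by linarith
  qed (use s b U in auto)
  also have "\<dots> = (b ^ 3 / 6 + U * b / 2) * s ^ 3"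
    by (simp add: power_mult_distrib power3_eq_cube power2_eq_square algebra_simps)
  finally show ?thesis .
qed

context uniquely_ergodic_chain
begin

text \<open>The conditional variance of the increments depends on the state. The factor \<open>1 - s\<^sup>2 u / 2\<close>, where \<open>u\<close>
  solves the Poisson equation for that variance, replaces it by its stationary mean up to third order in \<open>s\<close>.\<close>

lemma mart_char_step:
  fixes h :: "'y \<Rightarrow> real"
  defines "\<sigma>2 \<equiv> stat_mean p (cond_cov h h)"
  assumes u: "\<And>x. u x - stat_mean (K x) u = cond_cov h h x - \<sigma>2"
    and b: "\<And>x y. \<bar>h y - stat_mean (K x) h\<bar> \<le> b" and U: "\<And>x. \<bar>u x\<bar> \<le> U"
    and s: "0 \<le> s" "s \<le> 1"
  defines "\<Psi> \<equiv> \<lambda>n. \<integral>\<omega>. iexp (s * mart h n \<omega>) * complex_of_real (1 - s\<^sup>2 * u (Y n \<omega>) / 2) \<partial>M"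
  shows "cmod (\<Psi> (Suc n) - complex_of_real (1 - s\<^sup>2 * \<sigma>2 / 2) * \<Psi> n)
    \<le> (b ^ 3 / 6 + U * b / 2 + \<bar>\<sigma>2\<bar> * U / 4) * s ^ 3"
proof -
  let ?D = "\<lambda>x y. h y - stat_mean (K x) h"
  let ?g = "\<lambda>x y. iexp (s * ?D x y) * complex_of_real (1 - s\<^sup>2 * u y / 2)"
  let ?q = "\<lambda>x y. complex_of_real (1 - s\<^sup>2 * (?D x y)\<^sup>2 / 2 - s\<^sup>2 * u y / 2) + \<i> * complex_of_real (s * ?D x y)"
  let ?\<rho> = "1 - s\<^sup>2 * \<sigma>2 / 2"
  let ?Z = "\<lambda>\<omega>. iexp (s * mart h n \<omega>)"
  let ?C = "(b ^ 3 / 6 + U * b / 2 + \<bar>\<sigma>2\<bar> * U / 4) * s ^ 3"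
  have Zd: "determined n ?Z"
    by (rule determined_mart[where F = "\<lambda>m _. iexp (s * m)"])
  have mean_q: "stat_mean (K x) (?q x) = complex_of_real (1 - s\<^sup>2 * (u x + \<sigma>2) / 2)" for x
  proof -
    have "stat_mean (K x) (?q x) = complex_of_real (stat_mean (K x) (\<lambda>y. 1 - s\<^sup>2 / 2 * (?D x y * ?D x y) - s\<^sup>2 / 2 * u y))
        + \<i> * complex_of_real (stat_mean (K x) (\<lambda>y. s * ?D x y))"
      unfolding stat_mean_add stat_mean_of_real[symmetric]
      by (simp add: power2_eq_square stat_mean_mult_left)
    also have "stat_mean (K x) (\<lambda>y. s * ?D x y) = 0"
      unfolding stat_mean_mult_left by (simp add: stat_mean_diff)
    also have "stat_mean (K x) (\<lambda>y. 1 - s\<^sup>2 / 2 * (?D x y * ?D x y) - s\<^sup>2 / 2 * u y)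
        = 1 - s\<^sup>2 / 2 * cond_cov h h x - s\<^sup>2 / 2 * stat_mean (K x) u"
      unfolding stat_mean_diff cond_cov_def stat_mean_mult_left stat_mean_const ..
    also have "\<dots> = 1 - s\<^sup>2 / 2 * (cond_cov h h x + stat_mean (K x) u)" by (simp add: algebra_simps)
    also have "cond_cov h h x + stat_mean (K x) u = u x + \<sigma>2" using u[of x] by simp
    finally show ?thesis by simp
  qed
  have close: "cmod (stat_mean (K x) (?g x) - complex_of_real ?\<rho> * complex_of_real (1 - s\<^sup>2 * u x / 2)) \<le> ?C" for x
  proof -
    have "stat_mean (K x) (?g x) - complex_of_real ?\<rho> * complex_of_real (1 - s\<^sup>2 * u x / 2)
      = stat_mean (K x) (\<lambda>y. ?g x y - ?q x y) - complex_of_real (s ^ 4 * \<sigma>2 * u x / 4)"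
      unfolding stat_mean_diff mean_q by (simp add: field_simps power4_eq_xxxx power2_eq_square)
    also have "cmod \<dots> \<le> (b ^ 3 / 6 + U * b / 2) * s ^ 3 + \<bar>s ^ 4 * \<sigma>2 * u x / 4\<bar>"
    proof (rule order_trans[OF norm_triangle_ineq4], rule add_mono)
      show "cmod (stat_mean (K x) (\<lambda>y. ?g x y - ?q x y)) \<le> (b ^ 3 / 6 + U * b / 2) * s ^ 3"
        by (rule norm_stat_mean_le) (rule iexp_second_order[OF s(1) b U])
    qed (simp only: norm_of_real)
    also have "\<bar>s ^ 4 * \<sigma>2 * u x / 4\<bar> \<le> s ^ 3 * (\<bar>\<sigma>2\<bar> * U / 4)"
    proof -
      have "\<bar>s ^ 4 * \<sigma>2 * u x / 4\<bar> = s ^ 4 * (\<bar>\<sigma>2\<bar> * \<bar>u x\<bar> / 4)" using s by (simp add: abs_mult)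
      also have "\<dots> \<le> s ^ 3 * (\<bar>\<sigma>2\<bar> * U / 4)"
      proof (rule mult_mono)
        show "s ^ 4 \<le> s ^ 3" by (rule power_decreasing) (use s in simp_all)
        have "\<bar>\<sigma>2\<bar> * \<bar>u x\<bar> \<le> \<bar>\<sigma>2\<bar> * U" using U by (rule mult_left_mono) simp
        then show "\<bar>\<sigma>2\<bar> * \<bar>u x\<bar> / 4 \<le> \<bar>\<sigma>2\<bar> * U / 4" by simp
      qed (use s in simp_all)
      finally show ?thesis .
    qed
    finally show ?thesis by (simp add: algebra_simps)
  qed
  have split: "iexp (s * (m + d)) = iexp (s * m) * iexp (s * d)" for m d :: real
    by (simp add: distrib_left exp_add)
  have "\<Psi> (Suc n) = (\<integral>\<omega>. ?Z \<omega> * ?g (Y n \<omega>) (Y (Suc n) \<omega>) \<partial>M)"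
    unfolding \<Psi>_def by (rule Bochner_Integration.integral_cong[OF refl]) (simp only: mart_Suc split mult.assoc)
  also have "\<dots> = (\<integral>\<omega>. ?Z \<omega> * stat_mean (K (Y n \<omega>)) (?g (Y n \<omega>)) \<partial>M)"
    by (rule markov_property[OF Zd])
  finally have Psi1: "\<Psi> (Suc n) = (\<integral>\<omega>. ?Z \<omega> * stat_mean (K (Y n \<omega>)) (?g (Y n \<omega>)) \<partial>M)" .
  have i1: "integrable M (\<lambda>\<omega>. ?Z \<omega> * stat_mean (K (Y n \<omega>)) (?g (Y n \<omega>)))"
    by (rule integrable_mart[where F = "\<lambda>m y. iexp (s * m) * stat_mean (K y) (?g y)"])
  have i2: "integrable M (\<lambda>\<omega>. ?Z \<omega> * complex_of_real (1 - s\<^sup>2 * u (Y n \<omega>) / 2))"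
    by (rule integrable_mart[where F = "\<lambda>m y. iexp (s * m) * complex_of_real (1 - s\<^sup>2 * u y / 2)"])
  have "\<Psi> (Suc n) - complex_of_real ?\<rho> * \<Psi> n = (\<integral>\<omega>. ?Z \<omega> * stat_mean (K (Y n \<omega>)) (?g (Y n \<omega>))
      - complex_of_real ?\<rho> * (?Z \<omega> * complex_of_real (1 - s\<^sup>2 * u (Y n \<omega>) / 2)) \<partial>M)"
    unfolding Psi1 unfolding \<Psi>_def
    by (subst Bochner_Integration.integral_diff[OF i1 integrable_mult_right[OF i2]])
      (simp only: integral_mult_right_zero)
  also have "\<dots> = (\<integral>\<omega>. ?Z \<omega> * (stat_mean (K (Y n \<omega>)) (?g (Y n \<omega>))
      - complex_of_real ?\<rho> * complex_of_real (1 - s\<^sup>2 * u (Y n \<omega>) / 2)) \<partial>M)"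
    by (rule Bochner_Integration.integral_cong[OF refl]) (simp only: right_diff_distrib mult.left_commute)
  finally have eq: "\<Psi> (Suc n) - complex_of_real ?\<rho> * \<Psi> n = (\<integral>\<omega>. ?Z \<omega> * (stat_mean (K (Y n \<omega>)) (?g (Y n \<omega>))
      - complex_of_real ?\<rho> * complex_of_real (1 - s\<^sup>2 * u (Y n \<omega>) / 2)) \<partial>M)" .
  have "cmod (\<integral>\<omega>. ?Z \<omega> * (stat_mean (K (Y n \<omega>)) (?g (Y n \<omega>))
      - complex_of_real ?\<rho> * complex_of_real (1 - s\<^sup>2 * u (Y n \<omega>) / 2)) \<partial>M) \<le> (\<integral>\<omega>. ?C \<partial>M)"
  proof (rule order_trans[OF integral_norm_bound], rule integral_mono)
    show "integrable M (\<lambda>\<omega>. cmod (?Z \<omega> * (stat_mean (K (Y n \<omega>)) (?g (Y n \<omega>))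
      - complex_of_real ?\<rho> * complex_of_real (1 - s\<^sup>2 * u (Y n \<omega>) / 2))))"
      by (rule integrable_mart[where F = "\<lambda>m y. cmod (iexp (s * m) * (stat_mean (K y) (?g y)
        - complex_of_real ?\<rho> * complex_of_real (1 - s\<^sup>2 * u y / 2)))"])
    show "cmod (?Z \<omega> * (stat_mean (K (Y n \<omega>)) (?g (Y n \<omega>))
      - complex_of_real ?\<rho> * complex_of_real (1 - s\<^sup>2 * u (Y n \<omega>) / 2))) \<le> ?C" for \<omega>
      using close[of "Y n \<omega>"] by (simp only: norm_mult norm_exp_i_times mult_1_left)
  qed simp
  also have "(\<integral>\<omega>. ?C \<partial>M) = ?C" by (simp add: prob_space)
  finally show ?thesis unfolding eq .
qed

lemma cond_cov_nonneg: "cond_cov h h x \<ge> 0"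
  by (simp add: cond_cov_def stat_mean_def sum_nonneg)

text \<open>The errors of order \<open>s\<^sup>3\<close> of the \<open>n\<close> steps add up to \<open>O(1 / sqrt n)\<close> at \<open>s = 1 / sqrt n\<close>, because the
  factor \<open>1 - s\<^sup>2 \<sigma>2 / 2\<close> does not exceed 1 in modulus. The corrector itself only contributes \<open>O(1 / n)\<close>.\<close>

lemma mart_char_limit:
  fixes h :: "'y \<Rightarrow> real"
  shows "(\<lambda>n. \<integral>\<omega>. iexp (mart h n \<omega> / sqrt (real n)) \<partial>M)
    \<longlonglongrightarrow> complex_of_real (exp (- stat_mean p (cond_cov h h) / 2))"
proof -
  define \<sigma>2 where "\<sigma>2 = stat_mean p (cond_cov h h)"
  obtain u where u: "\<And>x. u x - stat_mean (K x) u = cond_cov h h x - \<sigma>2"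
    using poisson_equation[OF inv uniq, of "cond_cov h h"] unfolding \<sigma>2_def by metis
  obtain b where b: "b \<ge> 0" "\<And>x y. \<bar>h y - stat_mean (K x) h\<bar> \<le> b" using increment_bound[of h] by blast
  obtain U where U: "U \<ge> 0" "\<And>x. \<bar>u x\<bar> \<le> U" using finite_state_bound[of u] by (metis real_norm_def)
  define C where "C = b ^ 3 / 6 + U * b / 2 + \<bar>\<sigma>2\<bar> * U / 4"
  have \<sigma>0: "\<sigma>2 \<ge> 0" using stat_mean_mono[of "\<lambda>_. 0" "cond_cov h h" p] cond_cov_nonneg by (simp add: \<sigma>2_def)
  have C0: "C \<ge> 0" using b U by (simp add: C_def)
  have bound: "cmod ((\<integral>\<omega>. iexp (mart h n \<omega> / sqrt (real n)) \<partial>M) - complex_of_real ((1 + (- \<sigma>2 / 2) / real n) ^ n))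
      \<le> U / real n + C / sqrt (real n)" if n: "n \<ge> 1" "real n \<ge> \<sigma>2" for n
  proof -
    define s where "s = 1 / sqrt (real n)"
    have s: "0 \<le> s" "s \<le> 1" using n by (simp_all add: s_def)
    have s2: "s\<^sup>2 = 1 / real n" using n by (simp add: s_def power_divide)
    define \<rho> where "\<rho> = 1 - s\<^sup>2 * \<sigma>2 / 2"
    have "s\<^sup>2 * \<sigma>2 \<le> 1" using n by (simp add: s2 field_simps)
    moreover have "0 \<le> s\<^sup>2 * \<sigma>2" using \<sigma>0 by simp
    ultimately have \<rho>: "0 \<le> \<rho>" "\<rho> \<le> 1" by (simp_all add: \<rho>_def)
    define \<Psi> where "\<Psi> = (\<lambda>k. \<integral>\<omega>. iexp (s * mart h k \<omega>) * complex_of_real (1 - s\<^sup>2 * u (Y k \<omega>) / 2) \<partial>M)"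
    have step: "cmod (\<Psi> (Suc k) - complex_of_real \<rho> * \<Psi> k) \<le> C * s ^ 3" for k
      using mart_char_step[of u h b U s k] u b U s unfolding \<Psi>_def \<rho>_def C_def \<sigma>2_def by blast
    have iter: "cmod (\<Psi> k - complex_of_real (\<rho> ^ k) * \<Psi> 0) \<le> real k * (C * s ^ 3)" for k
    proof (induction k)
      case (Suc k)
      have "\<Psi> (Suc k) - complex_of_real (\<rho> ^ Suc k) * \<Psi> 0 =
          (\<Psi> (Suc k) - complex_of_real \<rho> * \<Psi> k) + complex_of_real \<rho> * (\<Psi> k - complex_of_real (\<rho> ^ k) * \<Psi> 0)"
        by (simp add: algebra_simps)
      also have "cmod \<dots> \<le> C * s ^ 3 + \<rho> * (real k * (C * s ^ 3))"
        using step[of k] Suc \<rho> by (intro order_trans[OF norm_triangle_ineq] add_mono) (auto simp: norm_mult intro!: mult_left_mono)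
      also have "\<dots> \<le> C * s ^ 3 + 1 * (real k * (C * s ^ 3))"
        using \<rho> C0 s by (intro add_left_mono mult_right_mono) auto
      finally show ?case by (simp add: algebra_simps)
    qed simp
    have drop: "cmod (\<Psi> k - (\<integral>\<omega>. iexp (s * mart h k \<omega>) \<partial>M)) \<le> U / (2 * real n)" for k
    proof -
      have i1: "integrable M (\<lambda>\<omega>. iexp (s * mart h k \<omega>) * complex_of_real (1 - s\<^sup>2 * u (Y k \<omega>) / 2))"
        by (rule integrable_mart[where F = "\<lambda>m y. iexp (s * m) * complex_of_real (1 - s\<^sup>2 * u y / 2)"])
      have i2: "integrable M (\<lambda>\<omega>. iexp (s * mart h k \<omega>))"
        by (rule integrable_mart[where F = "\<lambda>m y. iexp (s * m)"])
      have "\<Psi> k - (\<integral>\<omega>. iexp (s * mart h k \<omega>) \<partial>M) =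
          (\<integral>\<omega>. iexp (s * mart h k \<omega>) * complex_of_real (1 - s\<^sup>2 * u (Y k \<omega>) / 2) - iexp (s * mart h k \<omega>) \<partial>M)"
        unfolding \<Psi>_def by (rule Bochner_Integration.integral_diff[symmetric, OF i1 i2])
      also have "\<dots> = (\<integral>\<omega>. iexp (s * mart h k \<omega>) * complex_of_real (- (s\<^sup>2 * u (Y k \<omega>) / 2)) \<partial>M)"
        by (rule Bochner_Integration.integral_cong) (simp_all add: algebra_simps)
      finally have eq: "\<Psi> k - (\<integral>\<omega>. iexp (s * mart h k \<omega>) \<partial>M) =
          (\<integral>\<omega>. iexp (s * mart h k \<omega>) * complex_of_real (- (s\<^sup>2 * u (Y k \<omega>) / 2)) \<partial>M)" .
      have "cmod (\<integral>\<omega>. iexp (s * mart h k \<omega>) * complex_of_real (- (s\<^sup>2 * u (Y k \<omega>) / 2)) \<partial>M)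
          \<le> (\<integral>\<omega>. U / (2 * real n) \<partial>M)"
      proof (rule order_trans[OF integral_norm_bound], rule integral_mono)
        show "integrable M (\<lambda>\<omega>. cmod (iexp (s * mart h k \<omega>) * complex_of_real (- (s\<^sup>2 * u (Y k \<omega>) / 2))))"
          by (rule integrable_mart[where F = "\<lambda>m y. cmod (iexp (s * m) * complex_of_real (- (s\<^sup>2 * u y / 2)))"])
        show "cmod (iexp (s * mart h k \<omega>) * complex_of_real (- (s\<^sup>2 * u (Y k \<omega>) / 2))) \<le> U / (2 * real n)" for \<omega>
          unfolding norm_mult norm_exp_i_times norm_of_real using divide_right_mono[OF U(2)[of "Y k \<omega>"], of "2 * real n"]
          by (simp add: s2 abs_mult mult.commute)
      qed simp
      also have "(\<integral>\<omega>. U / (2 * real n) \<partial>M) = U / (2 * real n)" by (simp add: prob_space)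
      finally show ?thesis unfolding eq .
    qed
    have "cmod (\<Psi> 0 - 1) \<le> U / (2 * real n)" using drop[of 0] by (simp add: prob_space)
    then have "cmod (complex_of_real (\<rho> ^ n) * (\<Psi> 0 - 1)) \<le> 1 * (U / (2 * real n))"
      unfolding norm_mult using \<rho> by (intro mult_mono) (auto simp: power_le_one norm_power)
    moreover have "(\<integral>\<omega>. iexp (s * mart h n \<omega>) \<partial>M) - complex_of_real (\<rho> ^ n) =
        - (\<Psi> n - (\<integral>\<omega>. iexp (s * mart h n \<omega>) \<partial>M)) + (\<Psi> n - complex_of_real (\<rho> ^ n) * \<Psi> 0)
          + complex_of_real (\<rho> ^ n) * (\<Psi> 0 - 1)" by (simp add: algebra_simps)
    ultimately have "cmod ((\<integral>\<omega>. iexp (s * mart h n \<omega>) \<partial>M) - complex_of_real (\<rho> ^ n))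
        \<le> U / (2 * real n) + real n * (C * s ^ 3) + U / (2 * real n)"
      using drop[of n] iter[of n]
      by (metis (no_types, lifting) add_mono mult_1 norm_minus_cancel norm_triangle_mono)
    also have "real n * (C * s ^ 3) = C / sqrt (real n)"
    proof -
      have "real n * s ^ 3 = s * (real n * s\<^sup>2)" by (simp add: power3_eq_cube power2_eq_square)
      also have "\<dots> = s" using n by (simp add: s2)
      finally show ?thesis by (simp add: s_def mult.left_commute)
    qed
    finally show ?thesis by (simp add: s_def \<rho>_def[unfolded s2] algebra_simps)
  qed
  have "(\<lambda>n. (\<integral>\<omega>. iexp (mart h n \<omega> / sqrt (real n)) \<partial>M) - complex_of_real ((1 + (- \<sigma>2 / 2) / real n) ^ n)) \<longlonglongrightarrow> 0"
  proof (rule Lim_null_comparison)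
    have "\<forall>\<^sub>F n in sequentially. n \<ge> 1 \<and> real n \<ge> \<sigma>2"
      using eventually_ge_at_top[of 1] eventually_ge_at_top[of "nat \<lceil>\<sigma>2\<rceil>"]
      by eventually_elim linarith
    then show "\<forall>\<^sub>F n in sequentially. cmod ((\<integral>\<omega>. iexp (mart h n \<omega> / sqrt (real n)) \<partial>M)
        - complex_of_real ((1 + (- \<sigma>2 / 2) / real n) ^ n)) \<le> U / real n + C / sqrt (real n)"
      by eventually_elim (use bound in blast)
    have "filterlim (\<lambda>n. sqrt (real n)) at_top sequentially"
      by (rule filterlim_compose[OF sqrt_at_top filterlim_real_sequentially])
    then show "(\<lambda>n. U / real n + C / sqrt (real n)) \<longlonglongrightarrow> 0"
      by (intro tendsto_add_zero tendsto_divide_0[OF tendsto_const] filterlim_at_top_imp_at_infinity filterlim_real_sequentially)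
  qed
  moreover have "(\<lambda>n. complex_of_real ((1 + (- \<sigma>2 / 2) / real n) ^ n)) \<longlonglongrightarrow> complex_of_real (exp (- \<sigma>2 / 2))"
    by (intro tendsto_of_real tendsto_exp_limit_sequentially)
  ultimately show ?thesis unfolding \<sigma>2_def by (rule Lim_transform[rotated])
qed

end

section \<open>From characteristic functions to weak convergence\<close>

text \<open>Weak convergence is tested on trigonometric polynomials, whose integrals are finite combinations of
  values of the characteristic function.\<close>

inductive trig_poly :: "('a::real_inner \<Rightarrow> complex) \<Rightarrow> bool" where
  char: "trig_poly (\<lambda>x. c * iexp (t \<bullet> x))"
| add: "trig_poly f \<Longrightarrow> trig_poly g \<Longrightarrow> trig_poly (\<lambda>x. f x + g x)"

lemma trig_poly_const: "trig_poly (\<lambda>x. c)"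
  using trig_poly.char[of c 0] by simp

lemma trig_poly_sum: "finite I \<Longrightarrow> (\<And>i. i \<in> I \<Longrightarrow> trig_poly (f i)) \<Longrightarrow> trig_poly (\<lambda>x. \<Sum>i\<in>I. f i x)"
  by (induction I rule: finite_induct) (auto intro: trig_poly_const trig_poly.add)

lemma trig_poly_mult:
  assumes "trig_poly f" "trig_poly g"
  shows "trig_poly (\<lambda>x. f x * g x)"
  using assms
proof (induction f rule: trig_poly.induct)
  case (char c t)
  then show ?case
  proof (induction g rule: trig_poly.induct)
    case (char d s)
    have "(\<lambda>x. c * iexp (t \<bullet> x) * (d * iexp (s \<bullet> x))) = (\<lambda>x. (c * d) * iexp ((t + s) \<bullet> x))"
      by (simp add: inner_add_left distrib_left exp_add algebra_simps)
    then show ?case using trig_poly.char[of "c * d" "t + s"] by simp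
  next
    case (add f g)
    then show ?case using trig_poly.add by (simp add: distrib_left)
  qed
next
  case (add f1 f2)
  then show ?case using trig_poly.add by (simp add: distrib_right)
qed

lemma trig_poly_sin: "trig_poly (\<lambda>x. complex_of_real (sin (t \<bullet> x)))"
proof -
  have "(\<lambda>x. complex_of_real (sin (t \<bullet> x))) =
      (\<lambda>x. (1 / (2 * \<i>)) * iexp (t \<bullet> x) + (- 1 / (2 * \<i>)) * iexp ((- t) \<bullet> x))"
    by (simp add: sin_of_real[symmetric] sin_exp_eq' divide_simps fun_eq_iff) (simp add: algebra_simps)
  then show ?thesis by (simp only: trig_poly.intros)
qed

text \<open>Composition with this map makes a polynomial trigonometric, hence bounded on the whole space, while
  the map is injective on the cube of half-width \<open>pi / (2 * a)\<close> around the origin.\<close>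

definition torus_map :: "real \<Rightarrow> 'a \<Rightarrow> 'a::euclidean_space" where
  "torus_map a x = (\<Sum>b\<in>Basis. sin (a * (x \<bullet> b)) *\<^sub>R b)"

lemma torus_map_inner: "b \<in> Basis \<Longrightarrow> torus_map a x \<bullet> b = sin (a * (x \<bullet> b))"
  by (simp add: torus_map_def)

lemma trig_poly_torus_map:
  fixes q :: "'a::euclidean_space \<Rightarrow> real"
  assumes "real_polynomial_function q"
  shows "trig_poly (\<lambda>x. complex_of_real (q (torus_map a x)))"
  using assms
proof (induction q rule: real_polynomial_function.induct)
  case (linear f)
  then have "linear f" by (rule bounded_linear.linear)
  then have "f (torus_map a x) = (\<Sum>b\<in>Basis. f b * sin ((a *\<^sub>R b) \<bullet> x))" for x
    by (simp add: torus_map_def linear_sum linear_cmul inner_commute mult.commute)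
  moreover have "trig_poly (\<lambda>x. \<Sum>b\<in>Basis. complex_of_real (f b) * complex_of_real (sin ((a *\<^sub>R b) \<bullet> x)))"
    by (intro trig_poly_sum trig_poly_mult trig_poly_const trig_poly_sin finite_Basis)
  ultimately show ?case by simp
next
  case (const c)
  then show ?case by (simp add: trig_poly_const)
next
  case (add f g)
  then show ?case by (simp add: trig_poly.add)
next
  case (mult f g)
  then show ?case by (simp add: trig_poly_mult)
qed

lemma trig_poly_integrable:
  fixes f :: "'a::euclidean_space \<Rightarrow> complex"
  assumes "trig_poly f" "prob_space Q" "sets Q = sets borel"
  shows "integrable Q f"
  using assms(1)
proof (induction rule: trig_poly.induct)
  case (char c t)
  interpret prob_space Q by fact
  have [measurable]: "(\<lambda>x. c * iexp (t \<bullet> x)) \<in> borel_measurable Q"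
    unfolding measurable_cong_sets[OF assms(3) refl]
    by (intro borel_measurable_continuous_onI continuous_intros)
  show ?case by (rule integrable_const_bound[of _ "cmod c"]) (auto simp: norm_mult)
qed simp

lemma trig_poly_integral_tendsto:
  fixes f :: "'a::euclidean_space \<Rightarrow> complex"
  assumes f: "trig_poly f"
    and Q: "\<And>n. prob_space (Q n)" "\<And>n. sets (Q n) = sets borel"
    and G: "prob_space G" "sets G = sets borel"
    and char: "\<And>t. (\<lambda>n. \<integral>x. iexp (t \<bullet> x) \<partial>Q n) \<longlonglongrightarrow> (\<integral>x. iexp (t \<bullet> x) \<partial>G)"
  shows "(\<lambda>n. \<integral>x. f x \<partial>Q n) \<longlonglongrightarrow> (\<integral>x. f x \<partial>G)"
  using f
proof (induction rule: trig_poly.induct)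
  case (char c t)
  then show ?case using assms(6)[of t] by (simp add: tendsto_mult_left)
next
  case (add f g)
  then show ?case
    using trig_poly_integrable[OF add.hyps(1) Q] trig_poly_integrable[OF add.hyps(2) Q]
      trig_poly_integrable[OF add.hyps(1) G] trig_poly_integrable[OF add.hyps(2) G]
    by (simp add: tendsto_add)
qed

lemma prob_tail_small:
  fixes G :: "'a::euclidean_space measure"
  assumes "prob_space G" "sets G = sets borel" "\<epsilon> > 0"
  obtains R where "R > 0" "\<And>R'. R' \<ge> R \<Longrightarrow> measure G {x. R' < norm x} \<le> \<epsilon>"
proof -
  interpret prob_space G by fact
  have m: "{x. R < norm x} \<in> sets G" for R :: real
    unfolding assms(2) by (intro borel_open open_Collect_less continuous_intros)
  have "(\<lambda>n. measure G {x. real n < norm x}) \<longlonglongrightarrow> measure G (\<Inter>n. {x. real n < norm x})"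
    using m by (intro finite_Lim_measure_decseq) (auto simp: decseq_def)
  moreover have "(\<Inter>n. {x::'a. real n < norm x}) = {}"
  proof -
    have "\<exists>n. \<not> real n < norm x" for x :: 'a
      using real_arch_simple[of "norm x"] by (auto simp: not_less)
    then show ?thesis by blast
  qed
  ultimately have "(\<lambda>n. measure G {x. real n < norm x}) \<longlonglongrightarrow> 0" by simp
  then have "\<forall>\<^sub>F n in sequentially. measure G {x. real n < norm x} < \<epsilon>"
    using assms(3) by (rule order_tendstoD(2))
  then obtain n where n: "measure G {x. real n < norm x} < \<epsilon>" by (auto simp: eventually_sequentially)
  show ?thesis
  proof (rule that[of "real n + 1"])
    fix R' assume "real n + 1 \<le> R'"
    then have "measure G {x. R' < norm x} \<le> measure G {x. real n < norm x}"
      by (intro finite_measure_mono m) auto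
    then show "measure G {x. R' < norm x} \<le> \<epsilon>" using n by simp
  qed simp
qed

text \<open>On the cube, \<open>f\<close> is a continuous function of \<open>torus_map a x\<close>, obtained through \<open>arcsin\<close>. That function
  is continuous and bounded by \<open>F\<close> on the whole target cube, so a polynomial approximating it uniformly there
  is close to \<open>f\<close> on the ball and bounded everywhere.\<close>

lemma torus_polynomial_approx:
  fixes f :: "'a::euclidean_space \<Rightarrow> real"
  assumes f: "continuous_on UNIV f" "\<And>x. \<bar>f x\<bar> \<le> F" and R: "R > 0" and \<epsilon>: "\<epsilon> > 0"
  obtains q a where "real_polynomial_function q"
    "\<And>x. norm x \<le> R \<Longrightarrow> \<bar>f x - q (torus_map a x)\<bar> \<le> \<epsilon>"
    "\<And>x. \<bar>f x - q (torus_map a x)\<bar> \<le> \<epsilon> + 2 * F"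
proof -
  define a where "a = pi / (2 * R)"
  have a: "a > 0" using R by (simp add: a_def)
  let ?S = "cbox (- One) (One :: 'a)"
  define g where "g = (\<lambda>z::'a. f (\<Sum>b\<in>Basis. (arcsin (z \<bullet> b) / a) *\<^sub>R b))"
  have S: "z \<in> ?S \<longleftrightarrow> (\<forall>b\<in>Basis. - 1 \<le> z \<bullet> b \<and> z \<bullet> b \<le> 1)" for z
    by (simp add: mem_box)
  have "continuous_on ?S g"
    unfolding g_def
    by (intro continuous_on_compose2[OF f(1)] continuous_intros) (use a S in auto)
  then obtain q where q: "real_polynomial_function q" "\<And>z. z \<in> ?S \<Longrightarrow> \<bar>g z - q z\<bar> < \<epsilon>"
    using Stone_Weierstrass_real_polynomial_function[of ?S g \<epsilon>] \<epsilon> by auto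
  have T: "torus_map a x \<in> ?S" for x by (simp add: S torus_map_inner)
  show ?thesis
  proof (rule that[OF q(1)])
    fix x :: 'a assume x: "norm x \<le> R"
    have "arcsin (sin (a * (x \<bullet> b))) = a * (x \<bullet> b)" if b: "b \<in> Basis" for b
    proof (rule arcsin_sin)
      have "\<bar>a * (x \<bullet> b)\<bar> \<le> a * R"
        using Basis_le_norm[OF b, of x] x a by (simp add: abs_mult)
      also have "a * R = pi / 2" using R by (simp add: a_def)
      finally show "- (pi / 2) \<le> a * (x \<bullet> b)" "a * (x \<bullet> b) \<le> pi / 2" by linarith+
    qed
    then have "g (torus_map a x) = f (\<Sum>b\<in>Basis. (x \<bullet> b) *\<^sub>R b)"
      using a by (simp add: g_def torus_map_inner)
    then have "g (torus_map a x) = f x" by (simp add: euclidean_representation)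
    then show "\<bar>f x - q (torus_map a x)\<bar> \<le> \<epsilon>" using q(2)[OF T[of x]] by simp
  next
    fix x :: 'a
    have "\<bar>g (torus_map a x)\<bar> \<le> F" by (simp add: g_def f(2))
    then show "\<bar>f x - q (torus_map a x)\<bar> \<le> \<epsilon> + 2 * F" using q(2)[OF T[of x]] f(2)[of x] by linarith
  qed
qed

lemma integral_diff_le_tail:
  fixes f g :: "'a::euclidean_space \<Rightarrow> real"
  assumes Q: "prob_space Q" "sets Q = sets borel" and int: "integrable Q f" "integrable Q g"
    and near: "\<And>x. norm x \<le> R \<Longrightarrow> \<bar>f x - g x\<bar> \<le> \<epsilon>" and far: "\<And>x. \<bar>f x - g x\<bar> \<le> \<epsilon> + D"
    and tail: "measure Q {x. R < norm x} \<le> \<eta>" and D: "D \<ge> 0"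
  shows "\<bar>(\<integral>x. f x \<partial>Q) - (\<integral>x. g x \<partial>Q)\<bar> \<le> \<epsilon> + D * \<eta>"
proof -
  interpret prob_space Q by fact
  have m: "{x. R < norm x} \<in> sets Q"
    unfolding Q(2) by (intro borel_open open_Collect_less continuous_intros)
  have i: "integrable Q (\<lambda>x. \<epsilon> + D * indicator {x. R < norm x} x)"
    using m by (intro Bochner_Integration.integrable_add integrable_const integrable_mult_right)
      (simp add: integrable_indicator_iff emeasure_eq_measure)
  have "\<bar>(\<integral>x. f x \<partial>Q) - (\<integral>x. g x \<partial>Q)\<bar> = \<bar>\<integral>x. f x - g x \<partial>Q\<bar>" using int by simp
  also have "\<dots> \<le> (\<integral>x. \<bar>f x - g x\<bar> \<partial>Q)" by (rule integral_abs_bound)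
  also have "\<dots> \<le> (\<integral>x. \<epsilon> + D * indicator {x. R < norm x} x \<partial>Q)"
  proof (rule integral_mono)
    show "integrable Q (\<lambda>x. \<bar>f x - g x\<bar>)" using int by simp
    show "\<bar>f x - g x\<bar> \<le> \<epsilon> + D * indicator {x. R < norm x} x" for x
      using near[of x] far[of x] by (auto simp: indicator_def)
  qed (rule i)
  also have "\<dots> = \<epsilon> + D * measure Q {x. R < norm x}"
    using m sets.sets_into_space[OF m] by (simp add: prob_space integrable_indicator_iff emeasure_eq_measure Int_absorb2)
  also have "\<dots> \<le> \<epsilon> + D * \<eta>" using tail D by (simp add: mult_left_mono)
  finally show ?thesis .
qed

text \<open>Tightness confines all the laws to one ball up to \<open>\<epsilon>\<close>; on that ball \<open>f\<close> is replaced by a trigonometric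
  polynomial, which is bounded also outside of it.\<close>

lemma weak_conv_of_char:
  fixes Q :: "nat \<Rightarrow> 'a::euclidean_space measure"
  assumes Q: "\<And>n. prob_space (Q n)" "\<And>n. sets (Q n) = sets borel"
    and G: "prob_space G" "sets G = sets borel"
    and char: "\<And>t. (\<lambda>n. \<integral>x. iexp (t \<bullet> x) \<partial>Q n) \<longlonglongrightarrow> (\<integral>x. iexp (t \<bullet> x) \<partial>G)"
    and tight: "\<And>\<epsilon>. \<epsilon> > 0 \<Longrightarrow> \<exists>R>0. \<forall>R'\<ge>R. \<forall>n. measure (Q n) {x. R' < norm x} \<le> \<epsilon>"
  shows "weak_conv_borel Q G"
  unfolding weak_conv_borel_def
proof (intro allI impI, elim conjE)
  fix f :: "'a \<Rightarrow> real" assume cont: "continuous_on UNIV f" and "bounded (range f)"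
  then obtain F where F: "\<And>x. \<bar>f x\<bar> \<le> F" by (auto simp: bounded_iff)
  have F0: "F \<ge> 0" using F[of 0] by linarith
  have intf: "integrable P f" if "prob_space P" "sets P = sets borel" for P
  proof -
    interpret prob_space P by fact
    have "f \<in> borel_measurable P"
      unfolding measurable_cong_sets[OF that(2) refl] by (rule borel_measurable_continuous_onI[OF cont])
    then show ?thesis using F by (intro integrable_const_bound[of _ F]) auto
  qed
  show "(\<lambda>n. \<integral>x. f x \<partial>Q n) \<longlonglongrightarrow> (\<integral>x. f x \<partial>G)"
  proof (rule LIMSEQ_I)
    fix e :: real assume e: "e > 0"
    define \<epsilon> where "\<epsilon> = e / (4 * (1 + F))"
    have \<epsilon>: "\<epsilon> > 0" using e F0 by (simp add: \<epsilon>_def)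
    obtain R1 where R1: "R1 > 0" "\<And>R' n. R' \<ge> R1 \<Longrightarrow> measure (Q n) {x. R' < norm x} \<le> \<epsilon>"
      using tight[OF \<epsilon>] by blast
    obtain R2 where R2: "R2 > 0" "\<And>R'. R' \<ge> R2 \<Longrightarrow> measure G {x. R' < norm x} \<le> \<epsilon>"
      using prob_tail_small[OF G \<epsilon>] by blast
    define R where "R = max R1 R2"
    have R: "R > 0" "\<And>n. measure (Q n) {x. R < norm x} \<le> \<epsilon>" "measure G {x. R < norm x} \<le> \<epsilon>"
      using R1 R2(2)[of R] by (simp_all only: R_def max.cobounded1 max.cobounded2 less_max_iff_disj simp_thms)
    have "\<exists>q a. real_polynomial_function q \<and> (\<forall>x. norm x \<le> R \<longrightarrow> \<bar>f x - q (torus_map a x)\<bar> \<le> \<epsilon>) \<and>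
        (\<forall>x. \<bar>f x - q (torus_map a x)\<bar> \<le> \<epsilon> + 2 * F)"
      by (rule torus_polynomial_approx[OF cont F R(1) \<epsilon>], intro exI conjI allI impI)
    then obtain q a where "real_polynomial_function q \<and>
        (\<forall>x. norm x \<le> R \<longrightarrow> \<bar>f x - q (torus_map a x)\<bar> \<le> \<epsilon>) \<and>
        (\<forall>x. \<bar>f x - q (torus_map a x)\<bar> \<le> \<epsilon> + 2 * F)"
      by (elim exE) (rule that)
    then have q: "real_polynomial_function q"
      "\<And>x. norm x \<le> R \<Longrightarrow> \<bar>f x - q (torus_map a x)\<bar> \<le> \<epsilon>"
      "\<And>x. \<bar>f x - q (torus_map a x)\<bar> \<le> \<epsilon> + 2 * F"
      by simp_all
    let ?g = "\<lambda>x. q (torus_map a x)"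
    have T: "trig_poly (\<lambda>x. complex_of_real (?g x))" by (rule trig_poly_torus_map[OF q(1)])
    have intg: "integrable P ?g" if "prob_space P" "sets P = sets borel" for P
      using integrable_Re[OF trig_poly_integrable[OF T that]] by simp
    have near: "\<bar>(\<integral>x. f x \<partial>P) - (\<integral>x. ?g x \<partial>P)\<bar> \<le> \<epsilon> + 2 * F * \<epsilon>"
      if "prob_space P" "sets P = sets borel" "measure P {x. R < norm x} \<le> \<epsilon>" for P
      using integral_diff_le_tail[OF that(1,2) intf[OF that(1,2)] intg[OF that(1,2)] q(2,3) that(3)] F0 by simp
    have "(\<lambda>n. \<integral>x. complex_of_real (?g x) \<partial>Q n) \<longlonglongrightarrow> (\<integral>x. complex_of_real (?g x) \<partial>G)"
      by (rule trig_poly_integral_tendsto[OF T Q G char])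
    then have "(\<lambda>n. \<integral>x. ?g x \<partial>Q n) \<longlonglongrightarrow> (\<integral>x. ?g x \<partial>G)"
      by (simp add: tendsto_of_real_iff)
    from LIMSEQ_D[OF this \<epsilon>]
    obtain n0 where n0: "\<And>n. n \<ge> n0 \<Longrightarrow> \<bar>(\<integral>x. ?g x \<partial>Q n) - (\<integral>x. ?g x \<partial>G)\<bar> < \<epsilon>"
      unfolding real_norm_def by blast
    have "norm ((\<integral>x. f x \<partial>Q n) - (\<integral>x. f x \<partial>G)) < e" if "n \<ge> n0" for n
    proof -
      have "\<bar>(\<integral>x. f x \<partial>Q n) - (\<integral>x. f x \<partial>G)\<bar> < (\<epsilon> + 2 * F * \<epsilon>) + \<epsilon> + (\<epsilon> + 2 * F * \<epsilon>)"
        using near[OF Q R(2)[of n]] near[OF G R(3)] n0[OF that] by linarith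
      also have "\<dots> \<le> 4 * (1 + F) * \<epsilon>" using \<epsilon> by (simp add: algebra_simps)
      also have "\<dots> = e" using F0 by (simp add: \<epsilon>_def)
      finally show ?thesis by simp
    qed
    then show "\<exists>n0. \<forall>n\<ge>n0. norm ((\<integral>x. f x \<partial>Q n) - (\<integral>x. f x \<partial>G)) < e" by blast
  qed
qed

section \<open>Gaussian laws with a covariance given as a sum of rank-one matrices\<close>

lemma std_normal_prob_space: "prob_space (std_normal_distribution)"
  by (simp add: prob_space_normal_density)

text \<open>The law of \<open>\<Sum>i. \<xi> i *\<^sub>R w i\<close> for independent standard normal \<open>\<xi> i\<close>. Singular covariances
  are included.\<close>

lemma gaussian_exists:
  fixes w :: "'p::finite \<Rightarrow> 'a::euclidean_space"
  shows "\<exists>G :: 'a measure. prob_space G \<and> sets G = sets borel \<and>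
    (\<forall>t. (\<integral>x. iexp (t \<bullet> x) \<partial>G) = complex_of_real (exp (- (\<Sum>i\<in>UNIV. (t \<bullet> w i)\<^sup>2) / 2)))"
proof -
  let ?N = "\<lambda>_::'p. std_normal_distribution"
  interpret N: product_prob_space ?N UNIV
    by (rule product_prob_spaceI) (rule std_normal_prob_space)
  let ?P = "Pi\<^sub>M UNIV ?N"
  let ?X = "\<lambda>\<xi>::'p \<Rightarrow> real. \<Sum>i\<in>UNIV. \<xi> i *\<^sub>R w i"
  have X [measurable]: "?X \<in> borel_measurable ?P"
    by measurable
  define G where "G = distr ?P borel ?X"
  have "(\<integral>x. iexp (t \<bullet> x) \<partial>G) = complex_of_real (exp (- (\<Sum>i\<in>UNIV. (t \<bullet> w i)\<^sup>2) / 2))" for t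
  proof -
    have "(\<integral>x. iexp (t \<bullet> x) \<partial>G) = (\<integral>\<xi>. iexp (t \<bullet> ?X \<xi>) \<partial>?P)"
      unfolding G_def by (intro integral_distr X borel_measurable_continuous_onI continuous_intros)
    also have "\<dots> = (\<integral>\<xi>. (\<Prod>i\<in>UNIV. iexp ((t \<bullet> w i) * \<xi> i)) \<partial>?P)"
      by (rule Bochner_Integration.integral_cong)
        (simp_all add: inner_sum_right exp_sum[symmetric] sum_distrib_left mult.commute)
    also have "\<dots> = (\<Prod>i\<in>UNIV. \<integral>x. iexp ((t \<bullet> w i) * x) \<partial>std_normal_distribution)"
    proof (rule N.product_integral_prod)
      fix i
      show "integrable std_normal_distribution (\<lambda>x. iexp ((t \<bullet> w i) * x))"
        by (rule finite_measure.integrable_const_bound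
            [OF prob_space.finite_measure[OF std_normal_prob_space], of _ 1]) auto
    qed simp
    also have "\<dots> = (\<Prod>i\<in>UNIV. complex_of_real (exp (- (t \<bullet> w i)\<^sup>2 / 2)))"
      using char_std_normal_distribution by (simp add: char_def fun_eq_iff)
    also have "\<dots> = complex_of_real (exp (\<Sum>i\<in>UNIV. - (t \<bullet> w i)\<^sup>2 / 2))"
      by (simp only: of_real_prod[symmetric] exp_sum[OF finite])
    finally show ?thesis by (simp add: sum_negf sum_divide_distrib)
  qed
  moreover have "prob_space G" unfolding G_def by (rule N.prob_space_distr) measurable
  moreover have "sets G = sets borel" by (simp add: G_def)
  ultimately show ?thesis by blast
qed

section \<open>Second-order asymptotics of a perturbed empirical mean\<close>

lemma outer_component [simp]: "outer x y $ i $ j = x $ i * y $ j"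
  by (simp add: outer_def)

lemma norm_outer: "norm (outer x y) = norm x * norm y"
proof -
  have "norm (outer x y) = L2_set (\<lambda>i. norm y * \<bar>x $ i\<bar>) UNIV"
  proof -
    have "outer x y $ i = (x $ i) *\<^sub>R y" for i by (simp add: vec_eq_iff)
    then show ?thesis by (simp add: norm_vec_def[of "outer x y"] mult.commute)
  qed
  also have "\<dots> = norm y * norm x"
    by (simp add: L2_set_right_distrib[symmetric] norm_vec_def[of x])
  finally show ?thesis by simp
qed

lemma outer_sum_diff:
  "outer (u + e) (u + e) - outer u u = outer u e + outer e u + outer e e"
  by (simp add: vec_eq_iff algebra_simps)

lemma continuous_outer: "continuous_on UNIV (\<lambda>x. outer x x)"
  unfolding outer_def by (intro continuous_on_vec_lambda continuous_intros continuous_on_component)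

lemma outer_matrix_vector:
  fixes B :: "real^'n^'n"
  shows "outer (B *v x) (B *v y) = B ** outer x y ** transpose B"
proof -
  have "outer (B *v x) (B *v y) $ i $ j = (B ** outer x y ** transpose B) $ i $ j" for i j
  proof -
    have "(B ** outer x y ** transpose B) $ i $ j = (\<Sum>l\<in>UNIV. (\<Sum>k\<in>UNIV. B $ i $ k * (x $ k * y $ l)) * B $ j $ l)"
      by (simp add: matrix_matrix_mult_def transpose_def)
    also have "\<dots> = (\<Sum>l\<in>UNIV. (\<Sum>k\<in>UNIV. B $ i $ k * x $ k) * (B $ j $ l * y $ l))"
      by (intro sum.cong refl) (simp add: sum_distrib_right sum_distrib_left mult_ac)
    also have "\<dots> = (\<Sum>k\<in>UNIV. B $ i $ k * x $ k) * (\<Sum>l\<in>UNIV. B $ j $ l * y $ l)"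
      by (rule sum_distrib_left[symmetric])
    finally show ?thesis by (simp add: matrix_vector_mult_def)
  qed
  then show ?thesis by (simp add: vec_eq_iff)
qed

lemma bounded_linear_congruence:
  fixes B :: "real^'n^'n"
  shows "bounded_linear (\<lambda>S. B ** S ** transpose B)"
  unfolding linear_conv_bounded_linear[symmetric]
  by (rule linearI)
    (simp_all add: vec_eq_iff matrix_matrix_mult_def sum.distrib sum_distrib_left sum_distrib_right algebra_simps)

lemma bounded_linear_entry: "bounded_linear (\<lambda>S :: real^'n^'m. S $ i $ j)"
  by (intro bounded_linear_compose[OF bounded_linear_vec_nth bounded_linear_vec_nth])

lemma norm_matrix_le_entries:
  fixes S :: "real^'n^'m"
  shows "norm S \<le> (\<Sum>i\<in>UNIV. \<Sum>j\<in>UNIV. \<bar>S $ i $ j\<bar>)"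
proof -
  have "norm S \<le> (\<Sum>i\<in>UNIV. norm (S $ i))"
    unfolding norm_vec_def[of S] by (rule L2_set_le_sum) simp
  also have "\<dots> \<le> (\<Sum>i\<in>UNIV. \<Sum>j\<in>UNIV. \<bar>S $ i $ j\<bar>)"
    by (intro sum_mono norm_le_l1_cart)
  finally show ?thesis .
qed

lemma cmod_iexp_diff_le: "cmod (iexp a - iexp b) \<le> \<bar>a - b\<bar>"
proof -
  have "iexp a - iexp b = iexp b * (iexp (a - b) - 1)"
    by (simp add: right_diff_distrib exp_add[symmetric] algebra_simps)
  then have "cmod (iexp a - iexp b) = cmod (iexp (a - b) - 1)" by (simp add: norm_mult)
  also have "\<dots> \<le> \<bar>a - b\<bar>" using iexp_approx1[of "a - b" 0] by simp
  finally show ?thesis .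
qed

lemma emp_mean_linear:
  assumes "linear L"
  shows "emp_mean Y (\<lambda>y. L (f y)) N \<omega> = L (emp_mean Y f N \<omega>)"
  by (simp add: emp_mean_def linear_cmul[OF assms] linear_sum[OF assms])

lemma emp_mean_centred:
  "N \<ge> 1 \<Longrightarrow> emp_mean Y (\<lambda>y. g y - a) N \<omega> = emp_mean Y g N \<omega> - a"
  by (simp add: emp_mean_def sum_subtractf scaleR_diff_right sum_constant_scaleR)

text \<open>Interpolation of the second and third power between the constant and the fourth power, at the
  scale \<open>d = O(1 / sqrt n)\<close> at which all terms have the same order.\<close>

lemma square_le_fourth:
  fixes d n :: real
  assumes "n > 0"
  shows "d\<^sup>2 \<le> 1 / n + n * d ^ 4"
proof -
  have "0 \<le> (1 - n * d\<^sup>2)\<^sup>2 / n + d\<^sup>2" using assms by simp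
  also have "\<dots> = 1 / n - d\<^sup>2 + n * d ^ 4"
    using assms by (simp add: field_simps power2_eq_square power4_eq_xxxx)
  finally show ?thesis by simp
qed

lemma cube_le_fourth:
  fixes d n :: real
  assumes "n > 0"
  shows "d ^ 3 \<le> (1 / n + 2 * n * d ^ 4) / sqrt n"
proof -
  define g where "g = sqrt n"
  have g: "g > 0" "n = g\<^sup>2" using assms by (simp_all add: g_def)
  have "0 \<le> (g * d - 1)\<^sup>2 * d\<^sup>2 / g" using g by simp
  then have "2 * d ^ 3 \<le> (d\<^sup>2 + n * d ^ 4) / g"
    using g by (simp add: field_simps power2_eq_square power3_eq_cube power4_eq_xxxx)
  moreover have "0 \<le> (g * d + 1)\<^sup>2 * d\<^sup>2 / g" using g by simp
  then have "- (2 * d ^ 3) \<le> (d\<^sup>2 + n * d ^ 4) / g"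
    using g by (simp add: field_simps power2_eq_square power3_eq_cube power4_eq_xxxx)
  moreover have "(d\<^sup>2 + n * d ^ 4) / g \<le> (1 / n + 2 * n * d ^ 4) / g"
    using square_le_fourth[OF assms, of d] g by (intro divide_right_mono) auto
  ultimately show ?thesis unfolding g_def[symmetric] by linarith
qed

context uniquely_ergodic_chain
begin

lemma mart_linear:
  assumes "linear L"
  shows "mart (\<lambda>y. L (h y)) n \<omega> = L (mart h n \<omega>)"
  by (simp add: mart_def stat_mean_linear[OF assms] linear_sum[OF assms] linear_diff[OF assms])

text \<open>Passing from the sum to its martingale part costs a bounded factor times the first absolute moment of
  the martingale, which is of order \<open>sqrt n\<close>.\<close>

lemma sum_covariance_rate:
  fixes h h' :: "'y \<Rightarrow> real"
  defines "S \<equiv> \<lambda>h n \<omega>. \<Sum>k=1..n. h (Y k \<omega>) - stat_mean (K (Y k \<omega>)) h"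
  shows "\<exists>C. \<forall>n\<ge>1.
    \<bar>(\<integral>\<omega>. S h n \<omega> * S h' n \<omega> \<partial>M) - real n * stat_mean p (cond_cov h h')\<bar> \<le> C * sqrt (real n)"
proof -
  obtain C0 where C0: "\<And>n. \<bar>(\<integral>\<omega>. mart h n \<omega> * mart h' n \<omega> \<partial>M) - real n * stat_mean p (cond_cov h h')\<bar> \<le> C0"
    using mart_covariance by blast
  have abs_moment: "(\<integral>\<omega>. \<bar>mart f n \<omega>\<bar> \<partial>M) \<le> (b\<^sup>2 + 1) * sqrt (real n)"
    if b: "b \<ge> 0" "\<And>x y. \<bar>f y - stat_mean (K x) f\<bar> \<le> b" and n: "n \<ge> 1" for f :: "'y \<Rightarrow> real" and b and n :: nat
  proof -
    define g where "g = sqrt (real n)"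
    have g: "g > 0" "g * g = real n" using n by (simp_all add: g_def)
    have pt: "\<bar>m\<bar> \<le> m\<^sup>2 / g + g" for m :: real
    proof -
      have "0 \<le> (\<bar>m\<bar> - g)\<^sup>2 / g + \<bar>m\<bar>" using g by simp
      also have "\<dots> = m\<^sup>2 / g + g - \<bar>m\<bar>" using g by (simp add: field_simps power2_eq_square)
      finally show ?thesis by simp
    qed
    have i: "integrable M (\<lambda>\<omega>. G (mart f n \<omega>))" for G :: "real \<Rightarrow> real"
      by (rule integrable_mart[where F = "\<lambda>m _. G m"])
    have "(\<integral>\<omega>. \<bar>mart f n \<omega>\<bar> \<partial>M) \<le> (\<integral>\<omega>. (mart f n \<omega>)\<^sup>2 / g + g \<partial>M)"
      by (intro integral_mono i[of abs] i[of "\<lambda>m. m\<^sup>2 / g + g"] pt)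
    also have "\<dots> = (\<integral>\<omega>. (mart f n \<omega>)\<^sup>2 \<partial>M) / g + g"
      using i[of "\<lambda>m. m\<^sup>2"] by (simp add: prob_space)
    also have "\<dots> \<le> (b\<^sup>2 * real n) / g + g"
      using mart_fourth_moment(1)[OF b, of n] g by (intro add_right_mono divide_right_mono) auto
    also have "(b\<^sup>2 * real n) / g = b\<^sup>2 * g" using g by (simp add: g(2)[symmetric])
    finally show ?thesis by (simp add: g_def algebra_simps)
  qed
  obtain b where b: "b \<ge> 0" "\<And>x y. \<bar>h y - stat_mean (K x) h\<bar> \<le> b" using increment_bound[of h] by blast
  obtain b' where b': "b' \<ge> 0" "\<And>x y. \<bar>h' y - stat_mean (K x) h'\<bar> \<le> b'" using increment_bound[of h'] by blast
  obtain B where B: "B \<ge> 0" "\<And>x. norm (stat_mean (K x) h) \<le> B" using finite_state_bound[of "\<lambda>x. stat_mean (K x) h"] by blast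
  obtain B' where B': "B' \<ge> 0" "\<And>x. norm (stat_mean (K x) h') \<le> B'" using finite_state_bound[of "\<lambda>x. stat_mean (K x) h'"] by blast
  define e where "e = (\<lambda>f n \<omega>. stat_mean (K (Y 0 \<omega>)) f - stat_mean (K (Y n \<omega>)) f :: real)"
  have e: "\<bar>e h n \<omega>\<bar> \<le> 2 * B" "\<bar>e h' n \<omega>\<bar> \<le> 2 * B'" for n \<omega>
    using B(2)[of "Y 0 \<omega>"] B(2)[of "Y n \<omega>"] B'(2)[of "Y 0 \<omega>"] B'(2)[of "Y n \<omega>"]
    unfolding e_def real_norm_def by linarith+
  have S: "S f n \<omega> = mart f n \<omega> + e f n \<omega>" for f n \<omega>
    using sum_eq_mart[of f \<omega> n] by (simp add: S_def e_def)
  have de: "determined n (e f n)" for f n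
    unfolding e_def determined_def by simp
  have dS: "determined n (S f n)" for f n
    unfolding S_def determined_def by (intro ballI impI sum.cong) auto
  show ?thesis
  proof (intro exI[of _ "2 * B' * (b\<^sup>2 + 1) + 2 * B * (b'\<^sup>2 + 1) + 4 * B * B' + \<bar>C0\<bar>"] allI impI)
    fix n :: nat assume n: "n \<ge> 1"
    let ?g = "sqrt (real n)"
    let ?R = "\<lambda>\<omega>. 2 * B' * \<bar>mart h n \<omega>\<bar> + 2 * B * \<bar>mart h' n \<omega>\<bar> + 4 * B * B'"
    have g: "1 \<le> ?g" using n by simp
    have i: "integrable M (\<lambda>\<omega>. \<bar>mart f n \<omega>\<bar>)" for f :: "'y \<Rightarrow> real"
      by (rule integrable_mart[where F = "\<lambda>m _. \<bar>m\<bar>"])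
    have iS: "integrable M (\<lambda>\<omega>. S h n \<omega> * S h' n \<omega>)"
      by (rule determined_integrable[OF determined_mult[OF dS dS]])
    have iM: "integrable M (\<lambda>\<omega>. mart h n \<omega> * mart h' n \<omega>)"
      by (rule determined_integrable[OF determined_mult[OF determined_mart_self determined_mart_self]])
    have pt: "\<bar>S h n \<omega> * S h' n \<omega> - mart h n \<omega> * mart h' n \<omega>\<bar> \<le> ?R \<omega>" for \<omega>
    proof -
      have "S h n \<omega> * S h' n \<omega> - mart h n \<omega> * mart h' n \<omega> =
          e h' n \<omega> * mart h n \<omega> + e h n \<omega> * mart h' n \<omega> + e h n \<omega> * e h' n \<omega>"
        by (simp add: S algebra_simps)
      then have "\<bar>S h n \<omega> * S h' n \<omega> - mart h n \<omega> * mart h' n \<omega>\<bar> \<le>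
          \<bar>e h' n \<omega>\<bar> * \<bar>mart h n \<omega>\<bar> + \<bar>e h n \<omega>\<bar> * \<bar>mart h' n \<omega>\<bar> + \<bar>e h n \<omega>\<bar> * \<bar>e h' n \<omega>\<bar>"
        by (simp add: abs_mult[symmetric])
      also have "\<dots> \<le> (2 * B') * \<bar>mart h n \<omega>\<bar> + (2 * B) * \<bar>mart h' n \<omega>\<bar> + (2 * B) * (2 * B')"
        using e B(1) B'(1) by (intro add_mono mult_right_mono mult_mono) auto
      finally show ?thesis by simp
    qed
    have "\<bar>(\<integral>\<omega>. S h n \<omega> * S h' n \<omega> \<partial>M) - (\<integral>\<omega>. mart h n \<omega> * mart h' n \<omega> \<partial>M)\<bar> =
        \<bar>\<integral>\<omega>. S h n \<omega> * S h' n \<omega> - mart h n \<omega> * mart h' n \<omega> \<partial>M\<bar>"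
      using iS iM by simp
    also have "\<dots> \<le> (\<integral>\<omega>. \<bar>S h n \<omega> * S h' n \<omega> - mart h n \<omega> * mart h' n \<omega>\<bar> \<partial>M)"
      by (rule integral_abs_bound)
    also have "\<dots> \<le> (\<integral>\<omega>. ?R \<omega> \<partial>M)"
      using iS iM i by (intro integral_mono pt) auto
    also have "\<dots> = 2 * B' * (\<integral>\<omega>. \<bar>mart h n \<omega>\<bar> \<partial>M) + 2 * B * (\<integral>\<omega>. \<bar>mart h' n \<omega>\<bar> \<partial>M) + 4 * B * B'"
      using i by (simp add: prob_space)
    also have "\<dots> \<le> 2 * B' * ((b\<^sup>2 + 1) * ?g) + 2 * B * ((b'\<^sup>2 + 1) * ?g) + 4 * B * B' * ?g"
      using abs_moment[OF b n] abs_moment[OF b' n] B(1) B'(1) g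
        mult_left_mono[OF g, of "4 * B * B'"]
      by (intro add_mono mult_left_mono) simp_all
    finally have 1: "\<bar>(\<integral>\<omega>. S h n \<omega> * S h' n \<omega> \<partial>M) - (\<integral>\<omega>. mart h n \<omega> * mart h' n \<omega> \<partial>M)\<bar>
        \<le> 2 * B' * ((b\<^sup>2 + 1) * ?g) + 2 * B * ((b'\<^sup>2 + 1) * ?g) + 4 * B * B' * ?g" .
    have "C0 \<le> \<bar>C0\<bar> * ?g" using g mult_left_mono[OF g, of "\<bar>C0\<bar>"] by simp
    then have 2: "\<bar>(\<integral>\<omega>. mart h n \<omega> * mart h' n \<omega> \<partial>M) - real n * stat_mean p (cond_cov h h')\<bar> \<le> \<bar>C0\<bar> * ?g"
      using C0[of n] by linarith
    have "\<bar>(\<integral>\<omega>. S h n \<omega> * S h' n \<omega> \<partial>M) - real n * stat_mean p (cond_cov h h')\<bar>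
        \<le> (2 * B' * ((b\<^sup>2 + 1) * ?g) + 2 * B * ((b'\<^sup>2 + 1) * ?g) + 4 * B * B' * ?g) + \<bar>C0\<bar> * ?g"
      using 1 2 by linarith
    then show "\<bar>(\<integral>\<omega>. S h n \<omega> * S h' n \<omega> \<partial>M) - real n * stat_mean p (cond_cov h h')\<bar>
        \<le> (2 * B' * (b\<^sup>2 + 1) + 2 * B * (b'\<^sup>2 + 1) + 4 * B * B' + \<bar>C0\<bar>) * ?g"
      by (simp add: algebra_simps)
  qed
qed

text \<open>The stationary covariance of one martingale increment. It equals the limit of \<open>n\<close> times the covariance
  of the empirical mean, by \<open>emp_mean_covariance_rate\<close>.\<close>

definition asymp_cov :: "('y \<Rightarrow> real^'n) \<Rightarrow> real^'n^'n" where
  "asymp_cov h = stat_mean p (\<lambda>x. stat_mean (K x)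
     (\<lambda>y. outer (h y - stat_mean (K x) h) (h y - stat_mean (K x) h)))"

lemma asymp_cov_entry: "asymp_cov h $ i $ j = stat_mean p (cond_cov (\<lambda>y. h y $ i) (\<lambda>y. h y $ j))"
  by (simp add: asymp_cov_def cond_cov_def stat_mean_def)

lemma emp_mean_covariance_rate:
  fixes w :: "'y \<Rightarrow> real^'n"
  assumes h: "\<And>x. h x - stat_mean (K x) h = w x"
  obtains C where "C \<ge> 0" "\<And>n. n \<ge> 1 \<Longrightarrow>
    norm (real n *\<^sub>R (\<integral>\<omega>. outer (emp_mean Y w n \<omega>) (emp_mean Y w n \<omega>) \<partial>M) - asymp_cov h) \<le> C / sqrt (real n)"
proof -
  let ?W = "\<lambda>n \<omega>. emp_mean Y w n \<omega>"
  have lin1: "linear (\<lambda>x::real^'n. x $ i)" for i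
    using bounded_linear_vec_nth by (rule bounded_linear.linear)
  have hi: "h x $ i - stat_mean (K x) (\<lambda>y. h y $ i) = w x $ i" for x i
    using stat_mean_linear[OF lin1, where p = "K x" and f = h, of i] h[of x] by (metis vector_minus_component)
  define C where "C = (\<lambda>i j. SOME C. \<forall>n\<ge>1. \<bar>(\<integral>\<omega>. (\<Sum>k=1..n. w (Y k \<omega>) $ i) * (\<Sum>k=1..n. w (Y k \<omega>) $ j) \<partial>M)
      - real n * asymp_cov h $ i $ j\<bar> \<le> C * sqrt (real n))"
  have "\<forall>n\<ge>1. \<bar>(\<integral>\<omega>. (\<Sum>k=1..n. w (Y k \<omega>) $ i) * (\<Sum>k=1..n. w (Y k \<omega>) $ j) \<partial>M)
      - real n * asymp_cov h $ i $ j\<bar> \<le> C i j * sqrt (real n)" for i j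
    unfolding C_def
    by (rule someI_ex) (use sum_covariance_rate[of "\<lambda>y. h y $ i" "\<lambda>y. h y $ j"] in \<open>unfold hi asymp_cov_entry\<close>)
  then have C: "\<bar>(\<integral>\<omega>. (\<Sum>k=1..n. w (Y k \<omega>) $ i) * (\<Sum>k=1..n. w (Y k \<omega>) $ j) \<partial>M)
      - real n * asymp_cov h $ i $ j\<bar> \<le> C i j * sqrt (real n)" if "n \<ge> 1" for i j n
    using that by blast
  show ?thesis
  proof (rule that[of "\<Sum>i\<in>UNIV. \<Sum>j\<in>UNIV. \<bar>C i j\<bar>"])
    fix n :: nat assume n: "n \<ge> 1"
    let ?E = "\<integral>\<omega>. outer (?W n \<omega>) (?W n \<omega>) \<partial>M"
    have entry: "\<bar>(real n *\<^sub>R ?E - asymp_cov h) $ i $ j\<bar> \<le> \<bar>C i j\<bar> / sqrt (real n)" for i j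
    proof -
      have int: "integrable M (\<lambda>\<omega>. outer (?W n \<omega>) (?W n \<omega>))"
        by (rule emp_mean_integrable[where G = "\<lambda>x. outer x x"])
      have "?E $ i $ j = (\<integral>\<omega>. ?W n \<omega> $ i * ?W n \<omega> $ j \<partial>M)"
        using integral_bounded_linear[OF bounded_linear_entry int, of i j] by simp
      also have "\<dots> = (\<integral>\<omega>. ((\<Sum>k=1..n. w (Y k \<omega>) $ i) * (\<Sum>k=1..n. w (Y k \<omega>) $ j)) / (real n)\<^sup>2 \<partial>M)"
        by (simp add: emp_mean_def power2_eq_square)
      also have "\<dots> = (\<integral>\<omega>. (\<Sum>k=1..n. w (Y k \<omega>) $ i) * (\<Sum>k=1..n. w (Y k \<omega>) $ j) \<partial>M) / (real n)\<^sup>2"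
        by simp
      finally have "(real n *\<^sub>R ?E - asymp_cov h) $ i $ j =
          ((\<integral>\<omega>. (\<Sum>k=1..n. w (Y k \<omega>) $ i) * (\<Sum>k=1..n. w (Y k \<omega>) $ j) \<partial>M)
            - real n * asymp_cov h $ i $ j) / real n"
        using n by (simp add: field_simps power2_eq_square)
      also have "\<bar>\<dots>\<bar> \<le> C i j * sqrt (real n) / real n"
        using C[OF n, of i j] by (simp add: divide_right_mono)
      also have "\<dots> = C i j / sqrt (real n)"
        using n by (simp add: field_simps)
      also have "\<dots> \<le> \<bar>C i j\<bar> / sqrt (real n)" by (simp add: divide_right_mono)
      finally show ?thesis .
    qed
    have "norm (real n *\<^sub>R ?E - asymp_cov h) \<le> (\<Sum>i\<in>UNIV. \<Sum>j\<in>UNIV. \<bar>C i j\<bar> / sqrt (real n))"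
      by (rule order_trans[OF norm_matrix_le_entries]) (intro sum_mono entry)
    then show "norm (real n *\<^sub>R ?E - asymp_cov h) \<le> (\<Sum>i\<in>UNIV. \<Sum>j\<in>UNIV. \<bar>C i j\<bar>) / sqrt (real n)"
      by (simp add: sum_divide_distrib)
  qed (simp add: sum_nonneg)
qed

text \<open>The covariance is a sum of rank-one matrices over the transitions \<open>(x, y)\<close>, weighted by the
  stationary probability of the transition. So independent normal variables indexed by the transitions realise it.\<close>

lemma asymptotic_gaussian:
  fixes B :: "real^'n^'n" and h :: "'y \<Rightarrow> real^'n"
  shows "\<exists>G. multivariate_normal 0 (B ** asymp_cov h ** transpose B) G \<and>
    (\<forall>t. (\<integral>x. iexp (t \<bullet> x) \<partial>G) =
      complex_of_real (exp (- stat_mean p (cond_cov (\<lambda>y. t \<bullet> (B *v h y)) (\<lambda>y. t \<bullet> (B *v h y))) / 2)))"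
proof -
  let ?S = "B ** asymp_cov h ** transpose B"
  define a where "a = (\<lambda>x y. B *v (h y - stat_mean (K x) h))"
  have S: "?S = stat_mean p (\<lambda>x. stat_mean (K x) (\<lambda>y. outer (a x y) (a x y)))"
    unfolding asymp_cov_def stat_mean_linear[OF bounded_linear.linear[OF bounded_linear_congruence[of B]], symmetric]
    by (simp add: a_def outer_matrix_vector)
  have S_entry: "?S $ i $ j = (\<Sum>x\<in>UNIV. \<Sum>y\<in>UNIV. pmf p x * pmf (K x) y * (a x y $ i * a x y $ j))" for i j
    unfolding S by (simp add: stat_mean_def sum_distrib_left mult.assoc)
  have var: "stat_mean p (cond_cov (\<lambda>y. t \<bullet> (B *v h y)) (\<lambda>y. t \<bullet> (B *v h y)))
      = (\<Sum>x\<in>UNIV. \<Sum>y\<in>UNIV. pmf p x * pmf (K x) y * (t \<bullet> a x y)\<^sup>2)" for t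
  proof -
    have lin: "linear (\<lambda>z. t \<bullet> (B *v z))"
      by (rule linearI) (simp_all add: matrix_vector_right_distrib inner_add_right matrix_vector_mult_scaleR)
    have "t \<bullet> (B *v h y) - stat_mean (K x) (\<lambda>y. t \<bullet> (B *v h y)) = t \<bullet> a x y" for x y
      unfolding stat_mean_linear[OF lin] a_def by (simp add: linear_diff[OF lin] matrix_vector_mult_diff_distrib inner_diff_right)
    then show ?thesis
      by (simp add: cond_cov_def stat_mean_def[of p] stat_mean_def[of "K _" "\<lambda>y. t \<bullet> a _ y * _ y"] power2_eq_square sum_distrib_left mult.assoc)
  qed
  obtain G where G: "prob_space G" "sets G = sets borel"
    "\<forall>t. (\<integral>x. iexp (t \<bullet> x) \<partial>G) = complex_of_real (exp (-
      (\<Sum>xy\<in>UNIV. (t \<bullet> (case xy of (x, y) \<Rightarrow> sqrt (pmf p x * pmf (K x) y) *\<^sub>R a x y))\<^sup>2) / 2))"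
    using gaussian_exists[of "\<lambda>xy. case xy of (x, y) \<Rightarrow> sqrt (pmf p x * pmf (K x) y) *\<^sub>R a x y"]
    by (elim exE conjE) (rule that)
  have sum: "(\<Sum>xy\<in>UNIV. (t \<bullet> (case xy of (x, y) \<Rightarrow> sqrt (pmf p x * pmf (K x) y) *\<^sub>R a x y))\<^sup>2)
      = (\<Sum>x\<in>UNIV. \<Sum>y\<in>UNIV. pmf p x * pmf (K x) y * (t \<bullet> a x y)\<^sup>2)" for t
  proof -
    have "(\<Sum>x\<in>UNIV. \<Sum>y\<in>UNIV. pmf p x * pmf (K x) y * (t \<bullet> a x y)\<^sup>2)
        = (\<Sum>(x, y)\<in>UNIV \<times> UNIV. pmf p x * pmf (K x) y * (t \<bullet> a x y)\<^sup>2)"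
      by (rule sum.cartesian_product)
    also have "\<dots> = (\<Sum>xy\<in>UNIV. (t \<bullet> (case xy of (x, y) \<Rightarrow> sqrt (pmf p x * pmf (K x) y) *\<^sub>R a x y))\<^sup>2)"
      unfolding UNIV_Times_UNIV by (rule sum.cong) (auto simp: power_mult_distrib)
    finally show ?thesis ..
  qed
  have char: "(\<integral>x. iexp (t \<bullet> x) \<partial>G) =
      complex_of_real (exp (- stat_mean p (cond_cov (\<lambda>y. t \<bullet> (B *v h y)) (\<lambda>y. t \<bullet> (B *v h y))) / 2))" for t
    unfolding G(3)[rule_format] sum var ..
  have quad: "t \<bullet> (?S *v t) = stat_mean p (cond_cov (\<lambda>y. t \<bullet> (B *v h y)) (\<lambda>y. t \<bullet> (B *v h y)))" for t
  proof -
    have lin: "linear (\<lambda>S. t \<bullet> (S *v t))"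
      by (rule linearI) (simp_all add: matrix_vector_mult_add_rdistrib inner_add_right scaleR_matrix_vector_assoc[symmetric])
    have o: "t \<bullet> (outer u u *v t) = (t \<bullet> u)\<^sup>2" for u :: "real^'n"
    proof -
      have "outer u u *v t = (u \<bullet> t) *\<^sub>R u"
        by (simp add: vec_eq_iff matrix_vector_mult_def inner_vec_def sum_distrib_right sum_distrib_left mult_ac)
      then show ?thesis by (simp add: power2_eq_square inner_commute)
    qed
    show ?thesis
      unfolding var S stat_mean_linear[OF lin, symmetric] o
      by (simp add: stat_mean_def sum_distrib_left mult.assoc)
  qed
  have "multivariate_normal 0 ?S G"
    unfolding multivariate_normal_def
  proof (intro conjI allI)
    show "transpose ?S = ?S"
    proof (intro vec_eq_iff[THEN iffD2] allI)
      fix i j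
      have "?S $ j $ i = ?S $ i $ j"
        unfolding S_entry by (intro sum.cong refl) (simp add: mult.commute)
      then show "transpose ?S $ i $ j = ?S $ i $ j"
        by (simp only: transpose_def[of ?S] vec_lambda_beta)
    qed
    show "(\<integral>x. iexp (t \<bullet> x) \<partial>G) =
        exp (\<i> * complex_of_real (t \<bullet> 0) - complex_of_real ((t \<bullet> (?S *v t)) / 2))" for t
      unfolding char quad by (simp add: exp_of_real[symmetric])
  qed (rule G)+
  then show ?thesis using char by blast
qed

end

text \<open>A sequence \<open>X\<close> that agrees with a linear image of an empirical mean up to the square of another
  empirical mean. The estimation error of the linear program has this form, and the mean-square expansion
  and the central limit theorem depend on nothing else.\<close>

locale perturbed_mean = uniquely_ergodic_chain M K Y p
  for M :: "'w measure" and K :: "'y::finite \<Rightarrow> 'y pmf" and Y :: "nat \<Rightarrow> 'w \<Rightarrow> 'y" and p :: "'y pmf" +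
  fixes f :: "'y \<Rightarrow> 'z::euclidean_space" and w h :: "'y \<Rightarrow> real^'n" and B :: "real^'n^'n"
    and X :: "nat \<Rightarrow> 'w \<Rightarrow> real^'n" and c C :: real
  assumes centred: "stat_mean p f = 0"
    and poisson: "\<And>x. h x - stat_mean (K x) h = w x"
    and c: "c \<ge> 0" and C: "C \<ge> 0"
    and linear_part: "\<And>n \<omega>. norm (emp_mean Y w n \<omega>) \<le> c * norm (emp_mean Y f n \<omega>)"
    and measurable_X: "\<And>n. n \<ge> 1 \<Longrightarrow> X n \<in> borel_measurable M"
    and remainder: "\<And>n \<omega>. n \<ge> 1 \<Longrightarrow> \<omega> \<in> space M \<Longrightarrow>
      norm (X n \<omega> - B *v emp_mean Y w n \<omega>) \<le> C * norm (emp_mean Y f n \<omega>) ^ 2"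
begin

definition \<Delta> :: "nat \<Rightarrow> 'w \<Rightarrow> real" where
  "\<Delta> n \<omega> = norm (emp_mean Y f n \<omega>)"

lemma \<Delta>_nonneg: "\<Delta> n \<omega> \<ge> 0"
  by (simp add: \<Delta>_def)

lemma integrable_\<Delta>: "integrable M (\<lambda>\<omega>. G (\<Delta> n \<omega>) :: real)"
  unfolding \<Delta>_def by (rule emp_mean_integrable[where G = "\<lambda>z. G (norm z)"])

lemma \<Delta>_moments:
  "\<exists>C4\<ge>0. \<forall>n\<ge>1. (\<integral>\<omega>. \<Delta> n \<omega> ^ 4 \<partial>M) \<le> C4 / real n ^ 2 \<and>
     (\<integral>\<omega>. \<Delta> n \<omega> ^ 3 \<partial>M) \<le> C4 / (real n * sqrt (real n)) \<and> (\<integral>\<omega>. \<Delta> n \<omega> ^ 2 \<partial>M) \<le> C4 / real n"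
proof -
  obtain C4 where C4: "C4 \<ge> 0" "\<And>n. n \<ge> 1 \<Longrightarrow> (\<integral>\<omega>. norm (emp_mean Y f n \<omega>) ^ 4 \<partial>M) \<le> C4 / real n ^ 2"
    using emp_mean_fourth_moment[OF centred] by blast
  show ?thesis
  proof (intro exI[of _ "1 + 2 * C4"] conjI allI impI)
    fix n :: nat assume n: "n \<ge> 1"
    then have n0: "real n > 0" by simp
    have m4: "(\<integral>\<omega>. \<Delta> n \<omega> ^ 4 \<partial>M) \<le> C4 / real n ^ 2" using C4(2)[OF n] by (simp add: \<Delta>_def)
    have "C4 / real n ^ 2 \<le> (1 + 2 * C4) / real n ^ 2"
      using C4(1) by (intro divide_right_mono) auto
    then show "(\<integral>\<omega>. \<Delta> n \<omega> ^ 4 \<partial>M) \<le> (1 + 2 * C4) / real n ^ 2" using m4 by linarith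
    have i4: "integrable M (\<lambda>\<omega>. \<Delta> n \<omega> ^ 4)" by (rule integrable_\<Delta>[of "\<lambda>d. d ^ 4"])
    have sq: "real n * (C4 / real n ^ 2) = C4 / real n" using n0 by (simp add: power2_eq_square)
    have m4n: "real n * (\<integral>\<omega>. \<Delta> n \<omega> ^ 4 \<partial>M) \<le> C4 / real n"
      using mult_left_mono[OF m4, of "real n"] unfolding sq by simp
    have "(\<integral>\<omega>. \<Delta> n \<omega> ^ 2 \<partial>M) \<le> (\<integral>\<omega>. 1 / real n + real n * \<Delta> n \<omega> ^ 4 \<partial>M)"
      by (intro integral_mono integrable_\<Delta>[of "\<lambda>d. d\<^sup>2"] integrable_\<Delta>[of "\<lambda>d. 1 / real n + real n * d ^ 4"]
          square_le_fourth n0)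
    also have "\<dots> = 1 / real n + real n * (\<integral>\<omega>. \<Delta> n \<omega> ^ 4 \<partial>M)" using i4 by (simp add: prob_space)
    also have "\<dots> \<le> 1 / real n + 2 * (C4 / real n)"
      using m4n C4(1) n0 divide_nonneg_pos[of C4 "real n"] by linarith
    also have "\<dots> = (1 + 2 * C4) / real n" by (simp add: add_divide_distrib)
    finally show "(\<integral>\<omega>. \<Delta> n \<omega> ^ 2 \<partial>M) \<le> (1 + 2 * C4) / real n" .
    have "(\<integral>\<omega>. \<Delta> n \<omega> ^ 3 \<partial>M) \<le> (\<integral>\<omega>. (1 / real n + 2 * real n * \<Delta> n \<omega> ^ 4) / sqrt (real n) \<partial>M)"
      by (intro integral_mono integrable_\<Delta>[of "\<lambda>d. d ^ 3"]
          integrable_\<Delta>[of "\<lambda>d. (1 / real n + 2 * real n * d ^ 4) / sqrt (real n)"] cube_le_fourth n0)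
    also have "\<dots> = (1 / real n + 2 * (real n * (\<integral>\<omega>. \<Delta> n \<omega> ^ 4 \<partial>M))) / sqrt (real n)"
      using i4 by (simp add: prob_space)
    also have "\<dots> \<le> (1 / real n + 2 * (C4 / real n)) / sqrt (real n)"
      using m4n by (intro divide_right_mono add_left_mono mult_left_mono) auto
    also have "\<dots> = (1 + 2 * C4) / (real n * sqrt (real n))"
      by (simp add: add_divide_distrib)
    finally show "(\<integral>\<omega>. \<Delta> n \<omega> ^ 3 \<partial>M) \<le> (1 + 2 * C4) / (real n * sqrt (real n))" .
  qed (use C4 in simp)
qed

lemma norm_linear_part: "norm (B *v emp_mean Y w n \<omega>) \<le> norm B * c * \<Delta> n \<omega>"
proof -
  have "norm (B *v emp_mean Y w n \<omega>) \<le> norm B * norm (emp_mean Y w n \<omega>)"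
    by (rule norm_matrix_vector_mult_le)
  also have "\<dots> \<le> norm B * (c * \<Delta> n \<omega>)"
    unfolding \<Delta>_def by (intro mult_left_mono linear_part) simp
  finally show ?thesis by (simp add: mult.assoc)
qed

lemma norm_X_le:
  assumes "n \<ge> 1" "\<omega> \<in> space M"
  shows "norm (X n \<omega>) \<le> norm B * c * \<Delta> n \<omega> + C * \<Delta> n \<omega> ^ 2"
proof -
  have "norm (X n \<omega>) \<le> norm (B *v emp_mean Y w n \<omega>) + norm (X n \<omega> - B *v emp_mean Y w n \<omega>)"
    using norm_triangle_ineq[of "B *v emp_mean Y w n \<omega>" "X n \<omega> - B *v emp_mean Y w n \<omega>"] by simp
  then show ?thesis
    using norm_linear_part[of n \<omega>] remainder[OF assms] unfolding \<Delta>_def by linarith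
qed

lemma integrable_outer_X:
  assumes "n \<ge> 1"
  shows "integrable M (\<lambda>\<omega>. outer (X n \<omega>) (X n \<omega>))"
proof (rule Bochner_Integration.integrable_bound)
  show "integrable M (\<lambda>\<omega>. (norm B * c * \<Delta> n \<omega> + C * \<Delta> n \<omega> ^ 2)\<^sup>2)"
    by (rule integrable_\<Delta>[of "\<lambda>d. (norm B * c * d + C * d ^ 2)\<^sup>2"])
  show "(\<lambda>\<omega>. outer (X n \<omega>) (X n \<omega>)) \<in> borel_measurable M"
    by (rule measurable_compose[OF measurable_X[OF assms] borel_measurable_continuous_onI[OF continuous_outer]])
  show "AE \<omega> in M. norm (outer (X n \<omega>) (X n \<omega>)) \<le> norm ((norm B * c * \<Delta> n \<omega> + C * \<Delta> n \<omega> ^ 2)\<^sup>2)"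
  proof (rule AE_I2)
    fix \<omega> assume "\<omega> \<in> space M"
    from power_mono[OF norm_X_le[OF assms this] norm_ge_zero, of 2]
    show "norm (outer (X n \<omega>) (X n \<omega>)) \<le> norm ((norm B * c * \<Delta> n \<omega> + C * \<Delta> n \<omega> ^ 2)\<^sup>2)"
      by (simp add: norm_outer power2_eq_square)
  qed
qed

text \<open>The leading error is the product of the linear part and the remainder, of size \<open>\<Delta>\<^sup>3\<close>; its expectation is
  \<open>O(n powr (-3/2))\<close>, which after multiplication by \<open>n\<close> gives the rate.\<close>

lemma mse_rate:
  "\<exists>C'. \<forall>n\<ge>1. norm (real n *\<^sub>R (\<integral>\<omega>. outer (X n \<omega>) (X n \<omega>) \<partial>M) - B ** asymp_cov h ** transpose B)
      \<le> C' / sqrt (real n)"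
proof -
  obtain C4 where C4: "C4 \<ge> 0" "\<forall>n\<ge>1. (\<integral>\<omega>. \<Delta> n \<omega> ^ 4 \<partial>M) \<le> C4 / real n ^ 2 \<and>
     (\<integral>\<omega>. \<Delta> n \<omega> ^ 3 \<partial>M) \<le> C4 / (real n * sqrt (real n)) \<and> (\<integral>\<omega>. \<Delta> n \<omega> ^ 2 \<partial>M) \<le> C4 / real n"
    using \<Delta>_moments by blast
  obtain C5 where C5: "C5 \<ge> 0" "\<And>n. n \<ge> 1 \<Longrightarrow>
    norm (real n *\<^sub>R (\<integral>\<omega>. outer (emp_mean Y w n \<omega>) (emp_mean Y w n \<omega>) \<partial>M) - asymp_cov h) \<le> C5 / sqrt (real n)"
    using emp_mean_covariance_rate[OF poisson] by blast
  let ?T = "\<lambda>S. B ** S ** transpose B"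
  obtain k where k: "k \<ge> 0" "\<And>S. norm (?T S) \<le> norm S * k"
    using bounded_linear.nonneg_bounded[OF bounded_linear_congruence[of B]] by blast
  define b where "b = norm B * c"
  have b: "b \<ge> 0" using c by (simp add: b_def)
  show ?thesis
  proof (intro exI[of _ "2 * b * C * C4 + C\<^sup>2 * C4 + C5 * k"] allI impI)
    fix n :: nat assume n: "n \<ge> 1"
    then have n0: "real n > 0" by simp
    let ?W = "\<lambda>\<omega>. emp_mean Y w n \<omega>" and ?g = "sqrt (real n)"
    let ?U = "\<lambda>\<omega>. B *v ?W \<omega>"
    have iW: "integrable M (\<lambda>\<omega>. outer (?W \<omega>) (?W \<omega>))"
      by (rule emp_mean_integrable[where G = "\<lambda>x. outer x x"])
    have iU: "integrable M (\<lambda>\<omega>. outer (?U \<omega>) (?U \<omega>))"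
      by (rule emp_mean_integrable[where G = "\<lambda>x. outer (B *v x) (B *v x)"])
    note iX = integrable_outer_X[OF n]
    have EU: "(\<integral>\<omega>. outer (?U \<omega>) (?U \<omega>) \<partial>M) = ?T (\<integral>\<omega>. outer (?W \<omega>) (?W \<omega>) \<partial>M)"
      unfolding outer_matrix_vector by (rule integral_bounded_linear[OF bounded_linear_congruence iW])
    have pt: "norm (outer (X n \<omega>) (X n \<omega>) - outer (?U \<omega>) (?U \<omega>)) \<le> 2 * b * C * \<Delta> n \<omega> ^ 3 + C\<^sup>2 * \<Delta> n \<omega> ^ 4"
      if "\<omega> \<in> space M" for \<omega>
    proof -
      define R where "R = X n \<omega> - ?U \<omega>"
      have R: "norm R \<le> C * \<Delta> n \<omega> ^ 2" using remainder[OF n that] by (simp add: R_def \<Delta>_def)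
      have U: "norm (?U \<omega>) \<le> b * \<Delta> n \<omega>" using norm_linear_part by (simp add: b_def)
      have "outer (X n \<omega>) (X n \<omega>) - outer (?U \<omega>) (?U \<omega>) = outer (?U \<omega>) R + outer R (?U \<omega>) + outer R R"
        using outer_sum_diff[of "?U \<omega>" R] by (simp add: R_def)
      then have "norm (outer (X n \<omega>) (X n \<omega>) - outer (?U \<omega>) (?U \<omega>))
          \<le> norm (?U \<omega>) * norm R + norm R * norm (?U \<omega>) + norm R * norm R"
        by (simp only: norm_outer[symmetric]) (intro norm_triangle_mono order_refl)
      also have "\<dots> \<le> (b * \<Delta> n \<omega>) * (C * \<Delta> n \<omega> ^ 2) + (C * \<Delta> n \<omega> ^ 2) * (b * \<Delta> n \<omega>)
          + (C * \<Delta> n \<omega> ^ 2) * (C * \<Delta> n \<omega> ^ 2)"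
        using R U b C \<Delta>_nonneg by (intro add_mono mult_mono) auto
      also have "\<dots> = 2 * b * C * \<Delta> n \<omega> ^ 3 + C\<^sup>2 * \<Delta> n \<omega> ^ 4"
        by (simp add: power2_eq_square power3_eq_cube power4_eq_xxxx algebra_simps)
      finally show ?thesis .
    qed
    let ?D = "(\<integral>\<omega>. outer (X n \<omega>) (X n \<omega>) \<partial>M) - (\<integral>\<omega>. outer (?U \<omega>) (?U \<omega>) \<partial>M)"
    have "norm ?D = norm (\<integral>\<omega>. outer (X n \<omega>) (X n \<omega>) - outer (?U \<omega>) (?U \<omega>) \<partial>M)"
      by (simp only: Bochner_Integration.integral_diff[OF iX iU])
    also have "\<dots> \<le> (\<integral>\<omega>. norm (outer (X n \<omega>) (X n \<omega>) - outer (?U \<omega>) (?U \<omega>)) \<partial>M)"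
      by (rule integral_norm_bound)
    also have "\<dots> \<le> (\<integral>\<omega>. 2 * b * C * \<Delta> n \<omega> ^ 3 + C\<^sup>2 * \<Delta> n \<omega> ^ 4 \<partial>M)"
      using pt by (intro integral_mono integrable_norm Bochner_Integration.integrable_diff iX iU
          integrable_\<Delta>[of "\<lambda>d. 2 * b * C * d ^ 3 + C\<^sup>2 * d ^ 4"])
    also have "\<dots> = 2 * b * C * (\<integral>\<omega>. \<Delta> n \<omega> ^ 3 \<partial>M) + C\<^sup>2 * (\<integral>\<omega>. \<Delta> n \<omega> ^ 4 \<partial>M)"
      using integrable_\<Delta>[of "\<lambda>d. d ^ 3"] integrable_\<Delta>[of "\<lambda>d. d ^ 4"] by simp
    also have "\<dots> \<le> 2 * b * C * (C4 / (real n * ?g)) + C\<^sup>2 * (C4 / real n ^ 2)"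
      using C4(2) n b C by (intro add_mono mult_left_mono) auto
    finally have "real n * norm ?D \<le> real n * (2 * b * C * (C4 / (real n * ?g)) + C\<^sup>2 * (C4 / real n ^ 2))"
      by (rule mult_left_mono) simp
    also have "\<dots> = 2 * b * C * C4 / ?g + C\<^sup>2 * C4 / real n"
      using n0 by (simp add: distrib_left power2_eq_square)
    also have "\<dots> \<le> 2 * b * C * C4 / ?g + C\<^sup>2 * C4 / ?g"
    proof -
      have "?g \<le> real n" using n real_sqrt_le_mono[of "real n" "(real n)\<^sup>2"] by (simp add: power2_eq_square)
      then show ?thesis using n C4(1) by (intro add_left_mono divide_left_mono) auto
    qed
    finally have 1: "norm (real n *\<^sub>R ?D) \<le> 2 * b * C * C4 / ?g + C\<^sup>2 * C4 / ?g" by simp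
    let ?E = "\<integral>\<omega>. outer (?W \<omega>) (?W \<omega>) \<partial>M"
    have T: "linear ?T" by (rule bounded_linear.linear[OF bounded_linear_congruence])
    have "real n *\<^sub>R (\<integral>\<omega>. outer (?U \<omega>) (?U \<omega>) \<partial>M) - ?T (asymp_cov h) = ?T (real n *\<^sub>R ?E - asymp_cov h)"
      unfolding EU linear_diff[OF T] linear_cmul[OF T] ..
    then have "norm (real n *\<^sub>R (\<integral>\<omega>. outer (?U \<omega>) (?U \<omega>) \<partial>M) - ?T (asymp_cov h)) \<le> C5 / ?g * k"
      using k(2)[of "real n *\<^sub>R ?E - asymp_cov h"] mult_right_mono[OF C5(2)[OF n] k(1)] by simp
    then have "norm (real n *\<^sub>R ?D + (real n *\<^sub>R (\<integral>\<omega>. outer (?U \<omega>) (?U \<omega>) \<partial>M) - ?T (asymp_cov h)))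
        \<le> (2 * b * C * C4 / ?g + C\<^sup>2 * C4 / ?g) + C5 / ?g * k"
      by (intro norm_triangle_mono 1)
    then show "norm (real n *\<^sub>R (\<integral>\<omega>. outer (X n \<omega>) (X n \<omega>) \<partial>M) - ?T (asymp_cov h))
        \<le> (2 * b * C * C4 + C\<^sup>2 * C4 + C5 * k) / ?g"
      by (simp add: scaleR_diff_right add_divide_distrib)
  qed
qed

text \<open>Characteristic functions are Lipschitz in the variable, and \<open>sqrt n *\<^sub>R X n\<close> differs from the rescaled
  martingale by \<open>O(1 / sqrt n)\<close> in mean.\<close>

lemma char_limit:
  "(\<lambda>n. \<integral>\<omega>. iexp (t \<bullet> (sqrt (real n) *\<^sub>R X n \<omega>)) \<partial>M) \<longlonglongrightarrow>
    complex_of_real (exp (- stat_mean p (cond_cov (\<lambda>y. t \<bullet> (B *v h y)) (\<lambda>y. t \<bullet> (B *v h y))) / 2))"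
proof -
  let ?L = "\<lambda>z. t \<bullet> (B *v z)"
  have L: "linear ?L"
    by (rule linearI) (simp_all add: matrix_vector_right_distrib inner_add_right matrix_vector_mult_scaleR)
  have Lb: "\<bar>?L z\<bar> \<le> norm t * norm B * norm z" for z
    using Cauchy_Schwarz_ineq2[of t "B *v z"] mult_left_mono[OF norm_matrix_vector_mult_le[of B z] norm_ge_zero[of t]]
    by (simp add: mult.assoc)
  obtain C4 where C4: "C4 \<ge> 0" "\<forall>n\<ge>1. (\<integral>\<omega>. \<Delta> n \<omega> ^ 4 \<partial>M) \<le> C4 / real n ^ 2 \<and>
     (\<integral>\<omega>. \<Delta> n \<omega> ^ 3 \<partial>M) \<le> C4 / (real n * sqrt (real n)) \<and> (\<integral>\<omega>. \<Delta> n \<omega> ^ 2 \<partial>M) \<le> C4 / real n"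
    using \<Delta>_moments by blast
  obtain H where H: "H \<ge> 0" "\<And>x. norm (stat_mean (K x) h) \<le> H"
    using finite_state_bound[of "\<lambda>x. stat_mean (K x) h"] by blast
  define D where "D = norm t * C * C4 + norm t * norm B * (2 * H)"
  have bound: "cmod ((\<integral>\<omega>. iexp (t \<bullet> (sqrt (real n) *\<^sub>R X n \<omega>)) \<partial>M)
      - (\<integral>\<omega>. iexp (mart (\<lambda>y. ?L (h y)) n \<omega> / sqrt (real n)) \<partial>M)) \<le> D / sqrt (real n)" if n: "n \<ge> 1" for n
  proof -
    let ?g = "sqrt (real n)"
    have g: "?g > 0" "?g * ?g = real n" using n by simp_all
    have alg: "g * ((m + l) / k) = m / g + l / g" if "g > 0" "g * g = k" for g k m l :: real
      using that(1) by (simp add: that(2)[symmetric] add_divide_distrib distrib_left)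
    let ?a = "\<lambda>\<omega>. t \<bullet> (?g *\<^sub>R X n \<omega>)" and ?b = "\<lambda>\<omega>. mart (\<lambda>y. ?L (h y)) n \<omega> / ?g"
    have mX: "X n \<in> borel_measurable M" by (rule measurable_X[OF n])
    have ia: "integrable M (\<lambda>\<omega>. iexp (?a \<omega>))"
    proof (rule integrable_const_bound[of _ 1])
      show "(\<lambda>\<omega>. iexp (?a \<omega>)) \<in> borel_measurable M"
        by (rule measurable_compose[OF mX borel_measurable_continuous_onI]) (intro continuous_intros)
    qed simp
    have ib: "integrable M (\<lambda>\<omega>. iexp (?b \<omega>))"
      by (rule integrable_mart[where F = "\<lambda>m _. iexp (m / ?g)"])
    have pt: "\<bar>?a \<omega> - ?b \<omega>\<bar> \<le> norm t * C * (?g * \<Delta> n \<omega> ^ 2) + norm t * norm B * (2 * H) / ?g"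
      if "\<omega> \<in> space M" for \<omega>
    proof -
      define e where "e = stat_mean (K (Y 0 \<omega>)) h - stat_mean (K (Y n \<omega>)) h"
      have "norm e \<le> 2 * H"
        using norm_triangle_ineq4[of "stat_mean (K (Y 0 \<omega>)) h" "stat_mean (K (Y n \<omega>)) h"]
          H(2)[of "Y 0 \<omega>"] H(2)[of "Y n \<omega>"] by (simp add: e_def)
      then have e: "\<bar>?L e\<bar> \<le> norm t * norm B * (2 * H)"
        using Lb[of e] by (smt (verit) mult_left_mono mult_nonneg_nonneg norm_ge_zero)
      have "emp_mean Y w n \<omega> = (1 / real n) *\<^sub>R (mart h n \<omega> + e)"
        using sum_eq_mart[of h \<omega> n] by (simp add: emp_mean_def poisson e_def)
      then have "?L (emp_mean Y w n \<omega>) = (mart (\<lambda>y. ?L (h y)) n \<omega> + ?L e) / real n"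
        by (simp only: linear_cmul[OF L] linear_add[OF L] mart_linear[OF L]) simp
      then have "?g * ?L (emp_mean Y w n \<omega>) = ?b \<omega> + ?L e / ?g"
        using alg[OF g] by simp
      then have "?a \<omega> - ?b \<omega> = ?g * (t \<bullet> (X n \<omega> - B *v emp_mean Y w n \<omega>)) + ?L e / ?g"
        by (simp add: inner_diff_right algebra_simps)
      then have "\<bar>?a \<omega> - ?b \<omega>\<bar> \<le> ?g * \<bar>t \<bullet> (X n \<omega> - B *v emp_mean Y w n \<omega>)\<bar> + \<bar>?L e\<bar> / ?g"
        using abs_triangle_ineq[of "?g * (t \<bullet> (X n \<omega> - B *v emp_mean Y w n \<omega>))" "?L e / ?g"] g by (simp add: abs_mult)
      also have "\<dots> \<le> ?g * (norm t * (C * \<Delta> n \<omega> ^ 2)) + norm t * norm B * (2 * H) / ?g"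
      proof (intro add_mono mult_left_mono divide_right_mono e)
        show "\<bar>t \<bullet> (X n \<omega> - B *v emp_mean Y w n \<omega>)\<bar> \<le> norm t * (C * \<Delta> n \<omega> ^ 2)"
          using Cauchy_Schwarz_ineq2[of t "X n \<omega> - B *v emp_mean Y w n \<omega>"]
            mult_left_mono[OF remainder[OF n that] norm_ge_zero[of t]] by (simp add: \<Delta>_def)
      qed (use g in auto)
      finally show ?thesis by (simp add: algebra_simps)
    qed
    have "cmod ((\<integral>\<omega>. iexp (?a \<omega>) \<partial>M) - (\<integral>\<omega>. iexp (?b \<omega>) \<partial>M)) = cmod (\<integral>\<omega>. iexp (?a \<omega>) - iexp (?b \<omega>) \<partial>M)"
      by (simp only: Bochner_Integration.integral_diff[OF ia ib])
    also have "\<dots> \<le> (\<integral>\<omega>. cmod (iexp (?a \<omega>) - iexp (?b \<omega>)) \<partial>M)" by (rule integral_norm_bound)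
    also have "\<dots> \<le> (\<integral>\<omega>. norm t * C * (?g * \<Delta> n \<omega> ^ 2) + norm t * norm B * (2 * H) / ?g \<partial>M)"
    proof (rule integral_mono)
      show "integrable M (\<lambda>\<omega>. cmod (iexp (?a \<omega>) - iexp (?b \<omega>)))"
        by (intro integrable_norm Bochner_Integration.integrable_diff ia ib)
      show "integrable M (\<lambda>\<omega>. norm t * C * (?g * \<Delta> n \<omega> ^ 2) + norm t * norm B * (2 * H) / ?g)"
        by (rule integrable_\<Delta>[of "\<lambda>d. norm t * C * (?g * d ^ 2) + norm t * norm B * (2 * H) / ?g"])
    qed (rule order_trans[OF cmod_iexp_diff_le pt])
    also have "\<dots> = norm t * C * (?g * (\<integral>\<omega>. \<Delta> n \<omega> ^ 2 \<partial>M)) + norm t * norm B * (2 * H) / ?g"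
      using integrable_\<Delta>[of "\<lambda>d. d ^ 2"] by (simp add: prob_space)
    also have "\<dots> \<le> norm t * C * (?g * (C4 / real n)) + norm t * norm B * (2 * H) / ?g"
      using C4(2) n C by (intro add_right_mono mult_left_mono) auto
    also have "?g * (C4 / real n) = C4 / ?g" using alg[OF g, of C4 0] by simp
    finally show ?thesis by (simp add: D_def add_divide_distrib)
  qed
  have "filterlim (\<lambda>n. sqrt (real n)) at_top sequentially"
    by (rule filterlim_compose[OF sqrt_at_top filterlim_real_sequentially])
  then have "(\<lambda>n. D / sqrt (real n)) \<longlonglongrightarrow> 0"
    by (intro tendsto_divide_0[OF tendsto_const] filterlim_at_top_imp_at_infinity)
  then have "(\<lambda>n. (\<integral>\<omega>. iexp (t \<bullet> (sqrt (real n) *\<^sub>R X n \<omega>)) \<partial>M)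
      - (\<integral>\<omega>. iexp (mart (\<lambda>y. ?L (h y)) n \<omega> / sqrt (real n)) \<partial>M)) \<longlonglongrightarrow> 0"
    by (rule Lim_null_comparison[rotated]) (use bound in \<open>auto simp: eventually_sequentially\<close>)
  then show ?thesis by (rule Lim_transform[OF mart_char_limit])
qed

lemma second_moment_bound:
  "\<exists>V\<ge>0. \<forall>n\<ge>1. integrable M (\<lambda>\<omega>. (norm (sqrt (real n) *\<^sub>R X n \<omega>))\<^sup>2) \<and>
     (\<integral>\<omega>. (norm (sqrt (real n) *\<^sub>R X n \<omega>))\<^sup>2 \<partial>M) \<le> V"
proof -
  obtain C4 where C4: "C4 \<ge> 0" "\<forall>n\<ge>1. (\<integral>\<omega>. \<Delta> n \<omega> ^ 4 \<partial>M) \<le> C4 / real n ^ 2 \<and>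
     (\<integral>\<omega>. \<Delta> n \<omega> ^ 3 \<partial>M) \<le> C4 / (real n * sqrt (real n)) \<and> (\<integral>\<omega>. \<Delta> n \<omega> ^ 2 \<partial>M) \<le> C4 / real n"
    using \<Delta>_moments by blast
  define b where "b = norm B * c"
  show ?thesis
  proof (intro exI[of _ "2 * b\<^sup>2 * C4 + 2 * C\<^sup>2 * C4"] conjI allI impI)
    fix n :: nat assume n: "n \<ge> 1"
    let ?V = "\<lambda>\<omega>. real n * (2 * b\<^sup>2 * \<Delta> n \<omega> ^ 2 + 2 * C\<^sup>2 * \<Delta> n \<omega> ^ 4)"
    have iV: "integrable M ?V" by (rule integrable_\<Delta>[of "\<lambda>d. real n * (2 * b\<^sup>2 * d ^ 2 + 2 * C\<^sup>2 * d ^ 4)"])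
    have pt: "(norm (sqrt (real n) *\<^sub>R X n \<omega>))\<^sup>2 \<le> ?V \<omega>" if "\<omega> \<in> space M" for \<omega>
    proof -
      have "(norm (X n \<omega>))\<^sup>2 \<le> (b * \<Delta> n \<omega> + C * \<Delta> n \<omega> ^ 2)\<^sup>2"
        using norm_X_le[OF n that] by (intro power_mono) (simp_all add: b_def)
      also have "\<dots> \<le> 2 * b\<^sup>2 * \<Delta> n \<omega> ^ 2 + 2 * C\<^sup>2 * \<Delta> n \<omega> ^ 4"
        using sum_squares_bound[of "b * \<Delta> n \<omega>" "C * \<Delta> n \<omega> ^ 2"]
        by (simp add: power2_sum power_mult_distrib)
      finally show ?thesis by (simp add: power_mult_distrib mult_left_mono)
    qed
    have "(\<lambda>\<omega>. (norm (sqrt (real n) *\<^sub>R X n \<omega>))\<^sup>2) \<in> borel_measurable M"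
      using measurable_X[OF n] by measurable
    then show i: "integrable M (\<lambda>\<omega>. (norm (sqrt (real n) *\<^sub>R X n \<omega>))\<^sup>2)"
      by (rule Bochner_Integration.integrable_bound[OF iV]) (use pt in \<open>auto intro!: AE_I2 order_trans[OF _ abs_ge_self]\<close>)
    have "(\<integral>\<omega>. (norm (sqrt (real n) *\<^sub>R X n \<omega>))\<^sup>2 \<partial>M) \<le> (\<integral>\<omega>. ?V \<omega> \<partial>M)"
      by (rule integral_mono[OF i iV pt])
    also have "\<dots> = real n * (2 * b\<^sup>2 * (\<integral>\<omega>. \<Delta> n \<omega> ^ 2 \<partial>M) + 2 * C\<^sup>2 * (\<integral>\<omega>. \<Delta> n \<omega> ^ 4 \<partial>M))"
      using integrable_\<Delta>[of "\<lambda>d. d ^ 2"] integrable_\<Delta>[of "\<lambda>d. d ^ 4"] by simp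
    also have "\<dots> \<le> real n * (2 * b\<^sup>2 * (C4 / real n) + 2 * C\<^sup>2 * (C4 / real n ^ 2))"
      using C4(2) n by (intro mult_left_mono add_mono) auto
    also have "\<dots> = 2 * b\<^sup>2 * C4 + 2 * C\<^sup>2 * C4 / real n"
      using n by (simp add: distrib_left power2_eq_square)
    also have "\<dots> \<le> 2 * b\<^sup>2 * C4 + 2 * C\<^sup>2 * C4"
      using n C4(1) divide_left_mono[of 1 "real n" "2 * C\<^sup>2 * C4"] by simp
    finally show "(\<integral>\<omega>. (norm (sqrt (real n) *\<^sub>R X n \<omega>))\<^sup>2 \<partial>M) \<le> 2 * b\<^sup>2 * C4 + 2 * C\<^sup>2 * C4" .
  qed (use C4 in simp)
qed

lemma central_limit:
  "\<exists>G. multivariate_normal 0 (B ** asymp_cov h ** transpose B) G \<and>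
     weak_conv_borel (\<lambda>n. distr M borel (\<lambda>\<omega>. sqrt (real n) *\<^sub>R X n \<omega>)) G"
proof -
  obtain G where G: "multivariate_normal 0 (B ** asymp_cov h ** transpose B) G"
    "\<forall>t. (\<integral>x. iexp (t \<bullet> x) \<partial>G) =
      complex_of_real (exp (- stat_mean p (cond_cov (\<lambda>y. t \<bullet> (B *v h y)) (\<lambda>y. t \<bullet> (B *v h y))) / 2))"
    using asymptotic_gaussian[of B h] by (elim exE conjE) (rule that)
  have Gp: "prob_space G" "sets G = sets borel" using G(1) by (simp_all add: multivariate_normal_def)
  \<comment> \<open>Shifted by one, since \<open>X 0\<close> may fail to be measurable.\<close>
  define Z where "Z = (\<lambda>n \<omega>. sqrt (real (Suc n)) *\<^sub>R X (Suc n) \<omega>)"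
  define Q where "Q = (\<lambda>n. distr M borel (Z n))"
  have mZ [measurable]: "Z n \<in> borel_measurable M" for n
    unfolding Z_def using measurable_X[of "Suc n"] by measurable
  have Q: "prob_space (Q n)" "sets (Q n) = sets borel" for n
    unfolding Q_def by (rule prob_space_distr[OF mZ], simp)
  \<comment> \<open>The tails are bounded uniformly in \<open>n\<close> by the second moment.\<close>
  have "weak_conv_borel Q G"
  proof (rule weak_conv_of_char[OF Q Gp])
    fix t
    have "(\<integral>x. iexp (t \<bullet> x) \<partial>Q n) = (\<integral>\<omega>. iexp (t \<bullet> Z n \<omega>) \<partial>M)" for n
      unfolding Q_def by (intro integral_distr mZ borel_measurable_continuous_onI continuous_intros)
    then show "(\<lambda>n. \<integral>x. iexp (t \<bullet> x) \<partial>Q n) \<longlonglongrightarrow> (\<integral>x. iexp (t \<bullet> x) \<partial>G)"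
      unfolding G(2)[rule_format] Z_def using LIMSEQ_Suc[OF char_limit[of t]] by simp
  next
    fix \<epsilon> :: real assume \<epsilon>: "\<epsilon> > 0"
    obtain V where V: "V \<ge> 0" "\<forall>n\<ge>1. integrable M (\<lambda>\<omega>. (norm (sqrt (real n) *\<^sub>R X n \<omega>))\<^sup>2) \<and>
     (\<integral>\<omega>. (norm (sqrt (real n) *\<^sub>R X n \<omega>))\<^sup>2 \<partial>M) \<le> V"
      using second_moment_bound by blast
    show "\<exists>R>0. \<forall>R'\<ge>R. \<forall>n. measure (Q n) {x. R' < norm x} \<le> \<epsilon>"
    proof (intro exI[of _ "max 1 (V / \<epsilon>)"] conjI allI impI)
      fix R' n assume R': "max 1 (V / \<epsilon>) \<le> R'"
      then have R1: "1 \<le> R'" "V / \<epsilon> \<le> R'" by simp_all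
      have i: "integrable M (\<lambda>\<omega>. (norm (Z n \<omega>))\<^sup>2)" "(\<integral>\<omega>. (norm (Z n \<omega>))\<^sup>2 \<partial>M) \<le> V"
        using V(2)[rule_format, of "Suc n"] unfolding Z_def by simp_all
      have m: "{x :: real^'n. R' < norm x} \<in> sets borel"
        by (intro borel_open open_Collect_less continuous_intros)
      have "measure (Q n) {x. R' < norm x} = \<P>(\<omega> in M. R' < norm (Z n \<omega>))"
        unfolding Q_def by (subst measure_distr[OF mZ m]) (auto intro!: arg_cong[where f = "measure M"])
      also have "\<dots> \<le> \<P>(\<omega> in M. R'\<^sup>2 \<le> (norm (Z n \<omega>))\<^sup>2)"
        using R1 by (intro finite_measure_mono) (auto intro!: power_mono)
      also have "\<dots> \<le> (\<integral>\<omega>. (norm (Z n \<omega>))\<^sup>2 \<partial>M) / R'\<^sup>2"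
        using i R1 by (intro integral_Markov_inequality_measure[where A = "{}"]) auto
      also have "\<dots> \<le> V / R'\<^sup>2" using i by (intro divide_right_mono) auto
      also have "\<dots> \<le> V / R'"
        using R1 V(1) self_le_power[of R' 2] by (intro divide_left_mono) auto
      also have "\<dots> \<le> \<epsilon>" using R1 \<epsilon> by (simp add: field_simps)
      finally show "measure (Q n) {x. R' < norm x} \<le> \<epsilon>" .
    qed simp
  qed
  then have "weak_conv_borel (\<lambda>n. distr M borel (\<lambda>\<omega>. sqrt (real n) *\<^sub>R X n \<omega>)) G"
    unfolding weak_conv_borel_def Q_def Z_def by (blast intro: LIMSEQ_imp_Suc)
  then show ?thesis using G(1) by blast
qed

end

section \<open>The linear program with Markovian data\<close>

theorem propositionA1:
  fixes M :: "'w measure"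
    and K :: "'y::finite \<Rightarrow> 'y pmf" and Y :: "nat \<Rightarrow> 'w \<Rightarrow> 'y" and \<pi>inv :: "'y pmf"
    and A :: "'y \<Rightarrow> real^'n^'m" and \<beta> :: "'y \<Rightarrow> real^'m"
    and v :: "real^'n" and \<theta>star :: "real^'n" and r :: real
    and \<theta> :: "nat \<Rightarrow> 'w \<Rightarrow> real^'n" and \<theta>r :: "nat \<Rightarrow> 'w \<Rightarrow> real^'n"
    and idx :: "'n \<Rightarrow> 'm"
  assumes dims: "1 < CARD('n)" "CARD('n) < CARD('m)"
    and chain: "markov_chain M K Y" "uni_chain K" "aperiodic K"
    and inv: "invariant_pmf K \<pi>inv" "\<And>p. invariant_pmf K p \<Longrightarrow> p = \<pi>inv"
    and opt: "lp_solution v (stat_mean \<pi>inv A) (stat_mean \<pi>inv \<beta>) \<theta>star"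
    and uniq: "\<And>x. lp_solution v (stat_mean \<pi>inv A) (stat_mean \<pi>inv \<beta>) x \<Longrightarrow> x = \<theta>star"
    and idx: "inj idx"
      "\<And>i. i \<in> range idx \<Longrightarrow> (stat_mean \<pi>inv A *v \<theta>star - stat_mean \<pi>inv \<beta>) $ i = 0"
      "\<And>i. i \<notin> range idx \<Longrightarrow> (stat_mean \<pi>inv A *v \<theta>star - stat_mean \<pi>inv \<beta>) $ i < 0"
    and r: "r > 0" "\<And>i. \<bar>\<theta>star $ i\<bar> < r"
    and \<theta>: "\<And>N \<omega>. N \<ge> 1 \<Longrightarrow> \<omega> \<in> space M \<Longrightarrow>
        \<exists>x. lp_solution v (emp_mean Y A N \<omega>) (emp_mean Y \<beta> N \<omega>) x \<Longrightarrow>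
        lp_solution v (emp_mean Y A N \<omega>) (emp_mean Y \<beta> N \<omega>) (\<theta> N \<omega>)"
    and \<theta>r_degenerate: "\<And>N \<omega>. N \<ge> 1 \<Longrightarrow> \<omega> \<in> space M \<Longrightarrow>
        lp_unbounded v (emp_mean Y A N \<omega>) (emp_mean Y \<beta> N \<omega>) \<or>
        lp_infeasible (emp_mean Y A N \<omega>) (emp_mean Y \<beta> N \<omega>) \<Longrightarrow> \<theta>r N \<omega> = 0"
    and \<theta>r_projection: "\<And>N \<omega>. N \<ge> 1 \<Longrightarrow> \<omega> \<in> space M \<Longrightarrow>
        \<not> (lp_unbounded v (emp_mean Y A N \<omega>) (emp_mean Y \<beta> N \<omega>) \<or>
           lp_infeasible (emp_mean Y A N \<omega>) (emp_mean Y \<beta> N \<omega>)) \<Longrightarrow>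
        Linf_projection (sym_box r) (\<theta> N \<omega>) (\<theta>r N \<omega>)"
    and \<theta>r_measurable: "\<And>N. N \<ge> 1 \<Longrightarrow> \<theta>r N \<in> borel_measurable M"
  shows "(AE \<omega> in M. (\<lambda>N. \<theta>r N \<omega>) \<longlonglongrightarrow> \<theta>star) \<and>
    (AE \<omega> in M. (\<lambda>N. \<theta> N \<omega>) \<longlonglongrightarrow> \<theta>star) \<and>
    invertible (select_rows idx (stat_mean \<pi>inv A)) \<and>
    (\<exists>\<Sigma>W \<Sigma>\<theta>.
        (\<lambda>N. real N *\<^sub>R (\<integral>\<omega>. outer (emp_mean Y (lp_noise \<pi>inv A \<beta> idx \<theta>star) N \<omega>)
                                 (emp_mean Y (lp_noise \<pi>inv A \<beta> idx \<theta>star) N \<omega>) \<partial>M))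
          \<longlonglongrightarrow> \<Sigma>W \<and>
        \<Sigma>\<theta> = matrix_inv (select_rows idx (stat_mean \<pi>inv A)) ** \<Sigma>W **
               transpose (matrix_inv (select_rows idx (stat_mean \<pi>inv A))) \<and>
        (\<lambda>N. norm (real N *\<^sub>R (\<integral>\<omega>. outer (\<theta>r N \<omega> - \<theta>star) (\<theta>r N \<omega> - \<theta>star) \<partial>M) - \<Sigma>\<theta>))
          \<in> O(\<lambda>N. 1 / sqrt (real N)) \<and>
        (\<exists>G. multivariate_normal 0 \<Sigma>\<theta> G \<and>
          weak_conv_borel (\<lambda>N. distr M borel (\<lambda>\<omega>. sqrt (real N) *\<^sub>R (\<theta>r N \<omega> - \<theta>star))) G))"
proof -
  let ?p = "\<pi>inv"
  have prob: "prob_space M" using chain(1) by (simp add: markov_chain_def)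
  define Ab where "Ab = stat_mean ?p A"
  define bb where "bb = stat_mean ?p \<beta>"
  note uniq' = uniq[folded Ab_def bb_def] and opt' = opt[folded Ab_def bb_def]
    and act = idx(2)[folded Ab_def bb_def] and inact = idx(3)[folded Ab_def bb_def]
    and inv_p = inv
  interpret uniquely_ergodic_chain M K Y ?p
    by (intro uniquely_ergodic_chain.intro uniquely_ergodic_chain_axioms.intro prob chain(1) inv)
  define P where "P = select_rows idx Ab"
  define B where "B = matrix_inv P"
  define f where "f = (\<lambda>y. (A y - Ab, \<beta> y - bb))"
  define L where "L = (\<lambda>z :: (real^'n^'m) \<times> (real^'m). select_rows idx (snd z) - select_rows idx (fst z) *v \<theta>star)"
  define w where "w = lp_noise ?p A \<beta> idx \<theta>star"
  define c where "c = 1 + norm \<theta>star"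
  have c: "c \<ge> 0" by (simp add: c_def add_nonneg_nonneg)
  have L: "linear L"
    unfolding L_def
    by (rule linearI)
      (simp_all add: vec_eq_iff select_rows_component select_rows_mult_component matrix_vector_mult_add_rdistrib
        scaleR_matrix_vector_assoc[symmetric] algebra_simps)
  have norm_L: "norm (L z) \<le> c * norm z" for z
  proof -
    have "norm (L z) \<le> norm (select_rows idx (snd z)) + norm (select_rows idx (fst z)) * norm \<theta>star"
      unfolding L_def
      using norm_triangle_ineq4[of "select_rows idx (snd z)" "select_rows idx (fst z) *v \<theta>star"]
        norm_matrix_vector_mult_le[of "select_rows idx (fst z)" \<theta>star] by linarith
    also have "\<dots> \<le> norm z + norm z * norm \<theta>star"
      using norm_select_rows_le[OF idx(1), of "snd z"] norm_select_rows_le[OF idx(1), of "fst z"]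
        norm_fst_le[of "fst z" "snd z"] norm_snd_le[of "snd z" "fst z"]
      by (intro add_mono mult_right_mono) auto
    finally show ?thesis by (simp add: c_def algebra_simps)
  qed
  have w: "w y = L (f y)" for y
    by (simp add: w_def lp_noise_def L_def f_def Ab_def bb_def)
  have f0: "stat_mean ?p f = 0"
  proof (rule prod_eqI)
    show "fst (stat_mean ?p f) = fst 0"
      using stat_mean_linear[OF bounded_linear.linear[OF bounded_linear_fst], of ?p f]
      by (simp add: f_def stat_mean_diff Ab_def)
    show "snd (stat_mean ?p f) = snd 0"
      using stat_mean_linear[OF bounded_linear.linear[OF bounded_linear_snd], of ?p f]
      by (simp add: f_def stat_mean_diff bb_def)
  qed
  have "stat_mean ?p w = 0"
    using stat_mean_linear[OF L, of ?p f] by (simp add: w[abs_def] f0 linear_0[OF L])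
  then obtain h where h: "\<And>x. h x - stat_mean (K x) h = w x"
    using poisson_equation[OF inv_p, of w] by auto
  have emp_w: "emp_mean Y w N \<omega> = L (emp_mean Y f N \<omega>)" for N \<omega>
    unfolding w[abs_def] by (rule emp_mean_linear[OF L])
  have emp_f: "emp_mean Y f N \<omega> = (emp_mean Y A N \<omega> - Ab, emp_mean Y \<beta> N \<omega> - bb)" if "N \<ge> 1" for N \<omega>
  proof (rule prod_eqI)
    show "fst (emp_mean Y f N \<omega>) = fst (emp_mean Y A N \<omega> - Ab, emp_mean Y \<beta> N \<omega> - bb)"
      using that emp_mean_linear[OF bounded_linear.linear[OF bounded_linear_fst], of Y f N \<omega>]
      by (simp add: f_def emp_mean_centred)
    show "snd (emp_mean Y f N \<omega>) = snd (emp_mean Y A N \<omega> - Ab, emp_mean Y \<beta> N \<omega> - bb)"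
      using that emp_mean_linear[OF bounded_linear.linear[OF bounded_linear_snd], of Y f N \<omega>]
      by (simp add: f_def emp_mean_centred)
  qed
  have active: "select_rows idx bb = P *v \<theta>star"
    using act by (simp add: vec_eq_iff P_def select_rows_component select_rows_mult_component)
  have emp_w': "emp_mean Y w N \<omega> =
      select_rows idx (emp_mean Y \<beta> N \<omega>) - select_rows idx (emp_mean Y A N \<omega>) *v \<theta>star" if "N \<ge> 1" for N \<omega>
    unfolding emp_w emp_f[OF that] L_def
    by (simp add: select_rows_diff matrix_vector_mult_diff_rdistrib active P_def)
  have "\<exists>\<delta>>0. \<exists>C0\<ge>0. \<forall>A' b'. norm (A' - Ab) \<le> \<delta> \<longrightarrow> norm (b' - bb) \<le> \<delta> \<longrightarrow>
      (\<exists>x'. (\<forall>z. lp_solution v A' b' z \<longleftrightarrow> z = x') \<and> x' \<in> sym_box r \<and>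
        norm (x' - \<theta>star - matrix_inv (select_rows idx Ab) *v
                (select_rows idx b' - select_rows idx A' *v \<theta>star))
          \<le> C0 * norm (A' - Ab) * norm (select_rows idx b' - select_rows idx A' *v \<theta>star))"
    by (rule lp_perturbation[OF opt' uniq' idx(1) act inact r(2)])
  then obtain \<delta> C0 where \<delta>: "\<delta> > 0" and C0: "C0 \<ge> 0"
    and pert: "\<forall>A' b'. norm (A' - Ab) \<le> \<delta> \<longrightarrow> norm (b' - bb) \<le> \<delta> \<longrightarrow>
      (\<exists>x'. (\<forall>z. lp_solution v A' b' z \<longleftrightarrow> z = x') \<and> x' \<in> sym_box r \<and>
        norm (x' - \<theta>star - matrix_inv (select_rows idx Ab) *v
                (select_rows idx b' - select_rows idx A' *v \<theta>star))
          \<le> C0 * norm (A' - Ab) * norm (select_rows idx b' - select_rows idx A' *v \<theta>star))"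
    by (elim exE conjE) (rule that)
  have good: "\<theta>r N \<omega> = \<theta> N \<omega>"
      "norm (\<theta>r N \<omega> - \<theta>star - B *v emp_mean Y w N \<omega>) \<le> C0 * c * norm (emp_mean Y f N \<omega>) ^ 2"
    if N: "N \<ge> 1" and \<omega>: "\<omega> \<in> space M" and small: "norm (emp_mean Y f N \<omega>) \<le> \<delta>" for N \<omega>
  proof -
    let ?A = "emp_mean Y A N \<omega>" and ?b = "emp_mean Y \<beta> N \<omega>"
    have nA: "norm (?A - Ab) \<le> norm (emp_mean Y f N \<omega>)" and nb: "norm (?b - bb) \<le> norm (emp_mean Y f N \<omega>)"
      unfolding emp_f[OF N] by (rule norm_fst_le, rule norm_snd_le)
    obtain x' where "(\<forall>z. lp_solution v ?A ?b z \<longleftrightarrow> z = x') \<and> x' \<in> sym_box r \<and>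
        norm (x' - \<theta>star - matrix_inv (select_rows idx Ab) *v (select_rows idx ?b - select_rows idx ?A *v \<theta>star))
          \<le> C0 * norm (?A - Ab) * norm (select_rows idx ?b - select_rows idx ?A *v \<theta>star)"
      using pert[rule_format, OF order_trans[OF nA small] order_trans[OF nb small]] by (elim exE) (rule that)
    then have x': "\<And>z. lp_solution v ?A ?b z \<longleftrightarrow> z = x'" "x' \<in> sym_box r"
      and close: "norm (x' - \<theta>star - B *v emp_mean Y w N \<omega>) \<le> C0 * norm (?A - Ab) * norm (emp_mean Y w N \<omega>)"
      unfolding emp_w'[OF N] B_def P_def by simp_all
    have sol: "lp_solution v ?A ?b x'" using x'(1) by blast
    have "\<theta> N \<omega> = x'" using \<theta>[OF N \<omega>] sol x'(1) by blast
    have "\<not> lp_unbounded v ?A ?b"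
      using sol unfolding lp_unbounded_def lp_solution_def by (meson not_less)
    moreover have "\<not> lp_infeasible ?A ?b"
      using sol unfolding lp_infeasible_def lp_solution_def by blast
    ultimately have "Linf_projection (sym_box r) x' (\<theta>r N \<omega>)"
      using \<theta>r_projection[OF N \<omega>] \<open>\<theta> N \<omega> = x'\<close> by simp
    then have "infnorm (x' - \<theta>r N \<omega>) \<le> infnorm (x' - x')"
      using x'(2) unfolding Linf_projection_def by blast
    then have "\<theta>r N \<omega> = x'" using infnorm_pos_le[of "x' - \<theta>r N \<omega>"] by (simp add: infnorm_0 infnorm_eq_0)
    then show "\<theta>r N \<omega> = \<theta> N \<omega>" using \<open>\<theta> N \<omega> = x'\<close> by simp
    have "C0 * norm (?A - Ab) * norm (emp_mean Y w N \<omega>)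
        \<le> C0 * norm (emp_mean Y f N \<omega>) * (c * norm (emp_mean Y f N \<omega>))"
      using nA norm_L[of "emp_mean Y f N \<omega>"] C0 c by (intro mult_mono) (auto simp: emp_w)
    then show "norm (\<theta>r N \<omega> - \<theta>star - B *v emp_mean Y w N \<omega>) \<le> C0 * c * norm (emp_mean Y f N \<omega>) ^ 2"
      using close \<open>\<theta>r N \<omega> = x'\<close> by (simp add: power2_eq_square mult_ac)
  qed
  define D where "D = real CARD('n) * r + norm \<theta>star"
  have D: "norm (\<theta>r N \<omega> - \<theta>star) \<le> D" if N: "N \<ge> 1" and \<omega>: "\<omega> \<in> space M" for N \<omega>
  proof -
    have "\<theta>r N \<omega> \<in> sym_box r"
      using \<theta>r_degenerate[OF N \<omega>] \<theta>r_projection[OF N \<omega>] r(1) unfolding Linf_projection_def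
      by (cases "lp_unbounded v (emp_mean Y A N \<omega>) (emp_mean Y \<beta> N \<omega>) \<or>
        lp_infeasible (emp_mean Y A N \<omega>) (emp_mean Y \<beta> N \<omega>)") (simp_all add: sym_box_def)
    then have "(\<Sum>i\<in>UNIV. \<bar>\<theta>r N \<omega> $ i\<bar>) \<le> (\<Sum>i\<in>(UNIV::'n set). r)"
      by (intro sum_mono) (simp add: sym_box_def)
    then have "norm (\<theta>r N \<omega>) \<le> real CARD('n) * r" using norm_le_l1_cart[of "\<theta>r N \<omega>"] by simp
    then show ?thesis using norm_triangle_ineq4[of "\<theta>r N \<omega>" \<theta>star] by (simp add: D_def)
  qed
  have D0: "D \<ge> 0" using r(1) by (simp add: D_def)
  \<comment> \<open>For a deviation \<open>d \<le> \<delta>\<close> the expansion of the solution applies. For \<open>d > \<delta>\<close> the bounded estimate and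
    the linear part are dominated by \<open>d\<^sup>2\<close>, as \<open>D \<le> D * (d / \<delta>)\<^sup>2\<close> and \<open>d \<le> d\<^sup>2 / \<delta>\<close>.\<close>
  define C1 where "C1 = C0 * c + D / \<delta>\<^sup>2 + norm B * c / \<delta>"
  have C1: "C1 \<ge> 0" using C0 c D0 \<delta> by (simp add: C1_def)
  have rem: "norm (\<theta>r N \<omega> - \<theta>star - B *v emp_mean Y w N \<omega>) \<le> C1 * norm (emp_mean Y f N \<omega>) ^ 2"
    if N: "N \<ge> 1" and \<omega>: "\<omega> \<in> space M" for N \<omega>
  proof -
    define d where "d = norm (emp_mean Y f N \<omega>)"
    have parts: "C1 * d\<^sup>2 = C0 * c * d\<^sup>2 + D / \<delta>\<^sup>2 * d\<^sup>2 + norm B * c / \<delta> * d\<^sup>2"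
      by (simp add: C1_def distrib_right)
    have nonneg: "0 \<le> C0 * c * d\<^sup>2" "0 \<le> D / \<delta>\<^sup>2 * d\<^sup>2" "0 \<le> norm B * c / \<delta> * d\<^sup>2"
      using C0 c D0 \<delta> by simp_all
    show ?thesis
    proof (cases "d \<le> \<delta>")
      case True
      then show ?thesis
        using good(2)[OF N \<omega>] parts nonneg unfolding d_def[symmetric] by linarith
    next
      case False
      have "norm (\<theta>r N \<omega> - \<theta>star - B *v emp_mean Y w N \<omega>) \<le> D + norm B * (c * d)"
        using norm_triangle_ineq4[of "\<theta>r N \<omega> - \<theta>star" "B *v emp_mean Y w N \<omega>"] D[OF N \<omega>]
          norm_matrix_vector_mult_le[of B "emp_mean Y w N \<omega>"]
          mult_left_mono[OF norm_L[of "emp_mean Y f N \<omega>"] norm_ge_zero[of B]]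
        unfolding emp_w d_def by linarith
      moreover have "D \<le> D / \<delta>\<^sup>2 * d\<^sup>2"
      proof -
        have "\<delta>\<^sup>2 \<le> d\<^sup>2" using False \<delta> by (intro power_mono) auto
        then have "D * \<delta>\<^sup>2 \<le> D * d\<^sup>2" using D0 by (rule mult_left_mono)
        then show ?thesis using \<delta> by (simp add: field_simps)
      qed
      moreover have "norm B * (c * d) \<le> norm B * c / \<delta> * d\<^sup>2"
      proof -
        have "(norm B * c * d) * \<delta> \<le> (norm B * c * d) * d"
          using False c \<delta> by (intro mult_left_mono) (auto simp: d_def)
        then show ?thesis using \<delta> by (simp add: field_simps power2_eq_square)
      qed
      ultimately show ?thesis using parts nonneg(1) unfolding d_def[symmetric] by linarith
    qed
  qed
  interpret perturbed_mean M K Y ?p f w h B "\<lambda>N \<omega>. \<theta>r N \<omega> - \<theta>star" c C1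
  proof (intro perturbed_mean.intro perturbed_mean_axioms.intro)
    show "uniquely_ergodic_chain M K Y ?p" by (rule uniquely_ergodic_chain_axioms)
    show "(\<lambda>\<omega>. \<theta>r N \<omega> - \<theta>star) \<in> borel_measurable M" if "N \<ge> 1" for N
      using \<theta>r_measurable[OF that] by measurable
    show "norm (emp_mean Y w N \<omega>) \<le> c * norm (emp_mean Y f N \<omega>)" for N \<omega>
      unfolding emp_w by (rule norm_L)
  qed (use f0 h c C1 rem in auto)
  have conv: "AE \<omega> in M. (\<lambda>N. emp_mean Y f N \<omega>) \<longlonglongrightarrow> 0"
    by (rule emp_mean_tendsto_0[OF f0])
  have conv_r: "AE \<omega> in M. (\<lambda>N. \<theta>r N \<omega>) \<longlonglongrightarrow> \<theta>star"
    using conv AE_space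
  proof eventually_elim
    case (elim \<omega>)
    have "(\<lambda>N. \<Delta> N \<omega>) \<longlonglongrightarrow> 0"
      unfolding \<Delta>_def using elim(1) by (rule tendsto_norm_zero)
    then have "(\<lambda>N. norm B * c * \<Delta> N \<omega> + C1 * \<Delta> N \<omega> ^ 2) \<longlonglongrightarrow> norm B * c * 0 + C1 * 0 ^ 2"
      by (intro tendsto_intros)
    then have lim: "(\<lambda>N. norm B * c * \<Delta> N \<omega> + C1 * \<Delta> N \<omega> ^ 2) \<longlonglongrightarrow> 0" by simp
    have "\<forall>\<^sub>F N in sequentially. norm (\<theta>r N \<omega> - \<theta>star) \<le> norm B * c * \<Delta> N \<omega> + C1 * \<Delta> N \<omega> ^ 2"
      using eventually_ge_at_top[of 1] by eventually_elim (rule norm_X_le[OF _ elim(2)])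
    then have "(\<lambda>N. \<theta>r N \<omega> - \<theta>star) \<longlonglongrightarrow> 0"
      using lim by (rule Lim_null_comparison)
    then show ?case by (rule LIM_zero_cancel)
  qed
  have conv_\<theta>: "AE \<omega> in M. (\<lambda>N. \<theta> N \<omega>) \<longlonglongrightarrow> \<theta>star"
    using conv conv_r AE_space
  proof eventually_elim
    case (elim \<omega>)
    have "\<forall>\<^sub>F N in sequentially. norm (emp_mean Y f N \<omega>) < \<delta>"
      using tendsto_norm_zero[OF elim(1)] \<delta> by (rule order_tendstoD(2))
    then have "\<forall>\<^sub>F N in sequentially. \<theta>r N \<omega> = \<theta> N \<omega>"
      using eventually_ge_at_top[of 1] by eventually_elim (rule good(1)[OF _ elim(3) less_imp_le])
    then show ?case using elim(2) by (rule Lim_transform_eventually[rotated])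
  qed
  have "invertible P"
    unfolding P_def by (rule lp_active_rows_invertible[OF opt' uniq' inact])
  have cov: "(\<lambda>N. real N *\<^sub>R (\<integral>\<omega>. outer (emp_mean Y w N \<omega>) (emp_mean Y w N \<omega>) \<partial>M)) \<longlonglongrightarrow> asymp_cov h"
  proof -
    obtain C5 where C5: "\<And>n. n \<ge> 1 \<Longrightarrow>
      norm (real n *\<^sub>R (\<integral>\<omega>. outer (emp_mean Y w n \<omega>) (emp_mean Y w n \<omega>) \<partial>M) - asymp_cov h) \<le> C5 / sqrt (real n)"
      using emp_mean_covariance_rate[OF h] by blast
    have "filterlim (\<lambda>n. sqrt (real n)) at_top sequentially"
      by (rule filterlim_compose[OF sqrt_at_top filterlim_real_sequentially])
    then have "(\<lambda>n. C5 / sqrt (real n)) \<longlonglongrightarrow> 0"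
      by (intro tendsto_divide_0[OF tendsto_const] filterlim_at_top_imp_at_infinity)
    moreover have "\<forall>\<^sub>F n in sequentially. norm (real n *\<^sub>R (\<integral>\<omega>. outer (emp_mean Y w n \<omega>) (emp_mean Y w n \<omega>) \<partial>M)
        - asymp_cov h) \<le> C5 / sqrt (real n)"
      using eventually_ge_at_top[of 1] by eventually_elim (rule C5)
    ultimately show ?thesis by (rule LIM_zero_cancel[OF Lim_null_comparison, rotated])
  qed
  have rate: "(\<lambda>N. norm (real N *\<^sub>R (\<integral>\<omega>. outer (\<theta>r N \<omega> - \<theta>star) (\<theta>r N \<omega> - \<theta>star) \<partial>M)
      - B ** asymp_cov h ** transpose B)) \<in> O(\<lambda>N. 1 / sqrt (real N))"
  proof -
    obtain C' where C': "\<forall>n\<ge>1. norm (real n *\<^sub>R (\<integral>\<omega>. outer (\<theta>r n \<omega> - \<theta>star) (\<theta>r n \<omega> - \<theta>star) \<partial>M)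
        - B ** asymp_cov h ** transpose B) \<le> C' / sqrt (real n)"
      using mse_rate by blast
    show ?thesis
      by (rule bigoI[of _ C']) (use C' in \<open>auto simp: eventually_sequentially\<close>)
  qed
  show ?thesis
    unfolding Ab_def[symmetric] P_def[symmetric] B_def[symmetric] w_def[symmetric]
    by (intro conjI conv_r conv_\<theta> \<open>invertible P\<close>, rule exI[of _ "asymp_cov h"],
        rule exI[of _ "B ** asymp_cov h ** transpose B"]) (intro conjI cov refl rate central_limit)
qed

end
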